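(* Let $f:S_d\to[0,+\infty]$ be convex, positively $1$-homogeneous and lower semicontinuous, with $\operatorname{dom}(f)\subset S_d^+$, $\operatorname{dom}(f)\neq\emptyset$, and $\operatorname{dom}(f)\cap S_d^{++}$ dense in $\operatorname{dom}(f)$. For each $\mu,\nu\in\mathcal P_2(\mathbb R^d)$, $$F(\mu,\nu)=\sup\left\{\int_{\mathbb R^d}\psi\,d\nu-\int_{\mathbb R^d}\psi\,d\mu \;:\; \psi\in C_b^2(\mathbb R^d),\ -f^*\left(\tfrac12\nabla^2\psi(x)\right)=0\ \text{for all }x\in\mathbb R^d\right\}.$$ Moreover, if $F(\mu,\nu)<+\infty$, then the infimum in the dynamic problem defining $F(\mu,\nu)$ is attained, and so is the infimum in the static problem $$\inf\left\{\int_{\mathbb R^d} f\left(\frac{d\lambda}{d|\lambda|}\right)d|\lambda| \;:\; \operatorname{tr}\left(\tfrac12\nabla^2\lambda\right)=\nu-\mu\right\}.$$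
   Context: $S_d$ is the space of real symmetric $d\times d$ matrices with inner product $A:B=\operatorname{tr}(A^{T}B)$ and norm $\|A\|=\sqrt{A:A}$; $S_d^+$ (resp. $S_d^{++}$) is the set of nonnegative (resp. positive) definite ones. $\operatorname{dom}(f)=\{M\in S_d: f(M)<+\infty\}$. Positively $1$-homogeneous means $f(tA)=tf(A)$ for all $A\in S_d$, $t\ge 0$. Fenchel conjugate: $f^*(A)=\sup\{A:M-f(M): M\in S_d\}$ (it takes values in $\{0,+\infty\}$). $\mathcal P_2(\mathbb R^d)$ is the set of Borel probability measures on $\mathbb R^d$ with finite second moment; $\mathcal P_2((0,1)\times\mathbb R^d)$ is the set of Borel probability measures $\varrho$ on $(0,1)\times\mathbb R^d$ with $\int |x|^2\,d\varrho(t,x)<\infty$. For $X=\mathbb R^d$ or $X=(0,1)\times\mathbb R^d$, $\mathcal M(X,S_d^+)$ is the set of $S_d$-valued Borel measures $\lambda$ on $X$ with $\lambda(E)\in S_d^+$ for every Borel $E$; $|\lambda|$ is the total variation measure. $C_b^2(\mathbb R^d)$ is the space of twice continuously differentiable functions on $\mathbb R^d$ with uniformly bounded Hessian (the function itself need not be bounded). $C_b^{1,2}((0,1)\times\mathbb R^d)$ is the space of functions $\varphi$ that are once continuously differentiable in $t$ and twice in $x$ with $\partial_t\varphi$ and $\nabla_x^2\varphi$ uniformly bounded. Fokker-Planck equation. A pair $(\varrho,\lambda)\in\mathcal P_2((0,1)\times\mathbb R^d)\times\mathcal M((0,1)\times\mathbb R^d,S_d^+)$ which can be disintegrated as $\varrho=\varrho_t\otimes\mathcal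 L^1|_{(0,1)}$, $\lambda=\lambda_t\otimes\mathcal L^1|_{(0,1)}$ solves $\partial_t\varrho=\operatorname{tr}(\frac12\nabla^2\lambda)$ if $\int_0^1|\lambda_t|(\mathbb R^d)\,dt<\infty$ and $$\int_0^1\int_{\mathbb R^d}\partial_t\varphi\,d\varrho_t\,dt=-\int_0^1\int_{\mathbb R^d}\tfrac12\nabla_x^2\varphi:d\lambda_t\,dt$$ for all $\varphi\in C_b^{1,2}((0,1)\times\mathbb R^d)$ whose closed support is contained in $(0,1)\times\mathbb R^d$. For such a solution $t\mapsto\varrho_t$ has a narrowly continuous representative on $[0,1]$ with values in $\mathcal P_2(\mathbb R^d)$, which is always used; $\varrho_0,\varrho_1$ denote its endpoint values. Dynamic problem: $$F(\mu,\nu)=\inf\left\{\int_0^1\int_{\mathbb R^d}f\left(\frac{d\lambda_t}{d|\lambda_t|}\right)d|\lambda_t|\,dt \;:\; \partial_t\varrho=\operatorname{tr}\left(\tfrac12\nabla^2\lambda\right),\ \varrho_0=\mu,\ \varrho_1=\nu\right\},$$ with $\inf\emptyset=+\infty$. Static equation: $\operatorname{tr}(\frac12\nabla^2\lambda)=\nu-\mu$ means $\lambda\in\mathcal M(\mathbb R^d,S_d^+)$, $|\lambda|(\mathbb R^d)<\infty$ and $\int\frac12\nabla^2\varphi:d\lambda=\int\varphi\,d\nu-\int\varphi\,d\mu$ for all $\varphi\in C_b^2(\mathbb R^d)$. *)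

theory Defs
  imports "HOL-Probability.Probability"
begin

text \<open>
  The space \<open>\<real>\<^sup>d\<close> is \<^typ>\<open>real^'n\<close> and \<open>d \<times> d\<close> matrices are elements of
  \<^typ>\<open>real^'n^'n\<close>, on which \<^term>\<open>A \<bullet> B\<close> is \<open>tr (A\<^sup>T B)\<close> and \<^const>\<open>norm\<close> is the
  Frobenius norm.
\<close>

definition sym_mats :: "(real^'n^'n) set" where
  "sym_mats = {A. transpose A = A}"

definition psd_mats :: "(real^'n^'n) set" where
  "psd_mats = {A \<in> sym_mats. \<forall>x. 0 \<le> x \<bullet> (A *v x)}"

definition pd_mats :: "(real^'n^'n) set" where
  "pd_mats = {A \<in> sym_mats. \<forall>x. x \<noteq> 0 \<longrightarrow> 0 < x \<bullet> (A *v x)}"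

text \<open>
  A functional on \<open>S\<^sub>d\<close> with values in \<open>[0,+\<infinity>]\<close> is a function
  \<^typ>\<open>real^'n^'n \<Rightarrow> ennreal\<close> of which only the values on \<^const>\<open>sym_mats\<close> matter.
\<close>

definition dom_fun :: "(real^'n^'n \<Rightarrow> ennreal) \<Rightarrow> (real^'n^'n) set" where
  "dom_fun f = {M \<in> sym_mats. f M < \<infinity>}"

definition fenchel_conj :: "(real^'n^'n \<Rightarrow> ennreal) \<Rightarrow> real^'n^'n \<Rightarrow> ereal" where
  "fenchel_conj f A = (SUP M\<in>sym_mats. ereal (A \<bullet> M) - enn2ereal (f M))"


subsection \<open>Matrix-valued measures\<close>

definition matrix_measures :: "'a measure \<Rightarrow> ('a set \<Rightarrow> real^'n^'n) set" where
  "matrix_measures M = {L. (\<forall>E\<in>sets M. L E \<in> psd_mats) \<and> L {} = 0 \<and>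
     (\<forall>A::nat \<Rightarrow> 'a set. range A \<subseteq> sets M \<longrightarrow> disjoint_family A \<longrightarrow>
        (\<lambda>i. L (A i)) sums L (\<Union>i. A i))}"

definition total_variation :: "'a measure \<Rightarrow> ('a set \<Rightarrow> real^'n^'n) \<Rightarrow> 'a measure" where
  "total_variation M L = measure_of (space M) (sets M)
     (\<lambda>E. SUP A \<in> {A::nat \<Rightarrow> 'a set. range A \<subseteq> sets M \<and> disjoint_family A \<and> (\<Union>i. A i) = E}.
            (\<Sum>i. ennreal (norm (L (A i)))))"

text \<open>
  A version of the density of \<open>L\<close> with respect to \<open>|L|\<close>. It is determined \<open>|L|\<close>-almost
  everywhere; all versions are taken with values in \<open>S\<^sub>d\<close>.
\<close>

definition polar_density :: "'a measure \<Rightarrow> ('a set \<Rightarrow> real^'n^'n) \<Rightarrow> 'a \<Rightarrow> real^'n^'n" where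
  "polar_density M L = (SOME \<sigma>. integrable (total_variation M L) \<sigma> \<and>
     (\<forall>x. \<sigma> x \<in> sym_mats) \<and>
     (\<forall>E\<in>sets M. L E = (LINT x:E|total_variation M L. \<sigma> x)))"

definition matrix_integral ::
    "'a measure \<Rightarrow> ('a set \<Rightarrow> real^'n^'n) \<Rightarrow> ('a \<Rightarrow> real^'n^'n) \<Rightarrow> real" where
  "matrix_integral M L A = (LINT x|total_variation M L. A x \<bullet> polar_density M L x)"

definition action ::
    "(real^'n^'n \<Rightarrow> ennreal) \<Rightarrow> 'a measure \<Rightarrow> ('a set \<Rightarrow> real^'n^'n) \<Rightarrow> ennreal" where
  "action f M L = (\<integral>\<^sup>+x. f (polar_density M L x) \<partial>total_variation M L)"


subsection \<open>Test functions\<close>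

definition grad :: "(real^'n \<Rightarrow> real) \<Rightarrow> real^'n \<Rightarrow> real^'n" where
  "grad g x = (\<chi> i. frechet_derivative g (at x) (axis i 1))"

definition hessian :: "(real^'n \<Rightarrow> real) \<Rightarrow> real^'n \<Rightarrow> real^'n^'n" where
  "hessian g x = jacobian (grad g) (at x)"

definition twice_differentiable :: "(real^'n \<Rightarrow> real) \<Rightarrow> bool" where
  "twice_differentiable g \<longleftrightarrow>
     (\<forall>x. g differentiable (at x)) \<and> (\<forall>x. grad g differentiable (at x))"

definition Cb2 :: "(real^'n \<Rightarrow> real) set" where
  "Cb2 = {\<psi>. twice_differentiable \<psi> \<and> continuous_on UNIV (hessian \<psi>) \<and>
             bounded (range (hessian \<psi>))}"

definition dt :: "(real \<times> (real^'n) \<Rightarrow> real) \<Rightarrow> real \<times> (real^'n) \<Rightarrow> real" where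
  "dt \<phi> p = deriv (\<lambda>s. \<phi> (s, snd p)) (fst p)"

definition grad_x :: "(real \<times> (real^'n) \<Rightarrow> real) \<Rightarrow> real \<times> (real^'n) \<Rightarrow> real^'n" where
  "grad_x \<phi> p = grad (\<lambda>y. \<phi> (fst p, y)) (snd p)"

definition hessian_x :: "(real \<times> (real^'n) \<Rightarrow> real) \<Rightarrow> real \<times> (real^'n) \<Rightarrow> real^'n^'n" where
  "hessian_x \<phi> p = hessian (\<lambda>y. \<phi> (fst p, y)) (snd p)"

abbreviation strip :: "(real \<times> (real^'n)) set" where
  "strip \<equiv> {0<..<1} \<times> UNIV"

text \<open>
  Functions on \<open>(0,1) \<times> \<real>\<^sup>d\<close> are represented by total functions; values outside of the strip
  are irrelevant.
\<close>

definition Cb12 :: "(real \<times> (real^'n) \<Rightarrow> real) set" where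
  "Cb12 = {\<phi>.
     (\<forall>t\<in>{0<..<1}. \<forall>x. (\<lambda>s. \<phi> (s, x)) differentiable (at t)) \<and>
     (\<forall>t\<in>{0<..<1}. twice_differentiable (\<lambda>x. \<phi> (t, x))) \<and>
     continuous_on strip \<phi> \<and> continuous_on strip (dt \<phi>) \<and>
     continuous_on strip (grad_x \<phi>) \<and> continuous_on strip (hessian_x \<phi>) \<and>
     bounded (dt \<phi> ` strip) \<and> bounded (hessian_x \<phi> ` strip)}"

text \<open>
  The support is closed in \<open>\<real> \<times> \<real>\<^sup>d\<close>, so it misses the times \<open>0\<close> and \<open>1\<close>; it need
  not be compact.
\<close>

definition supported_in_strip :: "(real \<times> (real^'n) \<Rightarrow> real) \<Rightarrow> bool" where
  "supported_in_strip \<phi> \<longleftrightarrow> closure {p \<in> strip. \<phi> p \<noteq> 0} \<subseteq> strip"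


subsection \<open>The Fokker-Planck equation and the dynamic problem\<close>

abbreviation time :: "real measure" where
  "time \<equiv> restrict_space lborel {0<..<1}"

abbreviation spacetime :: "(real \<times> (real^'n)) measure" where
  "spacetime \<equiv> restrict_space borel strip"

definition P2 :: "(real^'n) measure set" where
  "P2 = {\<mu>. sets \<mu> = sets borel \<and> prob_space \<mu> \<and> integrable \<mu> (\<lambda>x. (norm x)\<^sup>2)}"

definition P2_spacetime :: "(real \<times> (real^'n)) measure set" where
  "P2_spacetime = {\<rho>. sets \<rho> = sets spacetime \<and> prob_space \<rho> \<and>
     integrable \<rho> (\<lambda>p. (norm (snd p))\<^sup>2)}"

definition disintegration ::
    "(real \<times> (real^'n)) measure \<Rightarrow> (real \<Rightarrow> (real^'n) measure) \<Rightarrow> bool" where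
  "disintegration \<rho> \<rho>t \<longleftrightarrow> \<rho>t \<in> measurable time (prob_algebra borel) \<and>
     (\<forall>E\<in>sets spacetime. emeasure \<rho> E = (\<integral>\<^sup>+t. emeasure (\<rho>t t) (Pair t -` E) \<partial>time))"

definition matrix_disintegration ::
    "((real \<times> (real^'n)) set \<Rightarrow> real^'n^'n) \<Rightarrow> (real \<Rightarrow> (real^'n) set \<Rightarrow> real^'n^'n) \<Rightarrow> bool" where
  "matrix_disintegration L Lt \<longleftrightarrow>
     (\<forall>t\<in>{0<..<1}. Lt t \<in> matrix_measures borel) \<and>
     (\<forall>E\<in>sets spacetime. has_bochner_integral time (\<lambda>t. Lt t (Pair t -` E)) (L E))"

definition fokker_planck ::
    "(real \<times> (real^'n)) measure \<Rightarrow> (real \<Rightarrow> (real^'n) measure) \<Rightarrow>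
     ((real \<times> (real^'n)) set \<Rightarrow> real^'n^'n) \<Rightarrow> (real \<Rightarrow> (real^'n) set \<Rightarrow> real^'n^'n) \<Rightarrow> bool" where
  "fokker_planck \<rho> \<rho>t L Lt \<longleftrightarrow>
     \<rho> \<in> P2_spacetime \<and> L \<in> matrix_measures spacetime \<and>
     disintegration \<rho> \<rho>t \<and> matrix_disintegration L Lt \<and>
     (\<integral>\<^sup>+t. emeasure (total_variation borel (Lt t)) UNIV \<partial>time) < \<infinity> \<and>
     (\<forall>\<phi>\<in>Cb12. supported_in_strip \<phi> \<longrightarrow>
        (LINT t|time. LINT x|\<rho>t t. dt \<phi> (t, x)) =
        - (LINT t|time. matrix_integral borel (Lt t) (\<lambda>x. (1/2) *\<^sub>R hessian_x \<phi> (t, x))))"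

text \<open>
  Disintegrations are unique up to null sets of times; this selects the narrowly continuous
  representative on \<open>[0,1]\<close>.
\<close>

definition narrowly_continuous_P2 :: "(real \<Rightarrow> (real^'n) measure) \<Rightarrow> bool" where
  "narrowly_continuous_P2 \<rho>t \<longleftrightarrow> (\<forall>t\<in>{0..1}. \<rho>t t \<in> P2) \<and>
     (\<forall>g::real^'n \<Rightarrow> real. continuous_on UNIV g \<longrightarrow> bounded (range g) \<longrightarrow>
        continuous_on {0..1} (\<lambda>t. LINT x|\<rho>t t. g x))"

definition dynamic_competitor ::
    "(real^'n) measure \<Rightarrow> (real^'n) measure \<Rightarrow>
     (real \<times> (real^'n)) measure \<Rightarrow> (real \<Rightarrow> (real^'n) measure) \<Rightarrow>
     ((real \<times> (real^'n)) set \<Rightarrow> real^'n^'n) \<Rightarrow> (real \<Rightarrow> (real^'n) set \<Rightarrow> real^'n^'n) \<Rightarrow> bool" where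
  "dynamic_competitor \<mu> \<nu> \<rho> \<rho>t L Lt \<longleftrightarrow>
     fokker_planck \<rho> \<rho>t L Lt \<and> narrowly_continuous_P2 \<rho>t \<and> \<rho>t 0 = \<mu> \<and> \<rho>t 1 = \<nu>"

definition dynamic_cost ::
    "(real^'n^'n \<Rightarrow> ennreal) \<Rightarrow> (real \<Rightarrow> (real^'n) set \<Rightarrow> real^'n^'n) \<Rightarrow> ennreal" where
  "dynamic_cost f Lt = (\<integral>\<^sup>+t. action f borel (Lt t) \<partial>time)"

definition dynamic_value ::
    "(real^'n^'n \<Rightarrow> ennreal) \<Rightarrow> (real^'n) measure \<Rightarrow> (real^'n) measure \<Rightarrow> ennreal" where
  "dynamic_value f \<mu> \<nu> = Inf {dynamic_cost f Lt | \<rho> \<rho>t L Lt. dynamic_competitor \<mu> \<nu> \<rho> \<rho>t L Lt}"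


subsection \<open>The static problem\<close>

definition static_competitor ::
    "(real^'n) measure \<Rightarrow> (real^'n) measure \<Rightarrow> ((real^'n) set \<Rightarrow> real^'n^'n) \<Rightarrow> bool" where
  "static_competitor \<mu> \<nu> L \<longleftrightarrow>
     L \<in> matrix_measures borel \<and> emeasure (total_variation borel L) UNIV < \<infinity> \<and>
     (\<forall>\<psi>\<in>Cb2. matrix_integral borel L (\<lambda>x. (1/2) *\<^sub>R hessian \<psi> x) =
        (LINT x|\<nu>. \<psi> x) - (LINT x|\<mu>. \<psi> x))"

definition static_value ::
    "(real^'n^'n \<Rightarrow> ennreal) \<Rightarrow> (real^'n) measure \<Rightarrow> (real^'n) measure \<Rightarrow> ennreal" where
  "static_value f \<mu> \<nu> = Inf {action f borel L | L. static_competitor \<mu> \<nu> L}"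

end

theory Submission
  imports Defs
begin

text \<open>
  The dual problem only sees the Hessians of \<open>\<psi>\<close>. Write \<open>K\<close> for the set of matrices
  \<open>A\<close> with \<open>A \<bullet> M \<le> f M\<close> on the domain of \<open>f\<close>; this is the set where the conjugate of \<open>f\<close>
  vanishes, \<open>\<psi>\<close> is feasible if \<open>(1/2) \<nabla>\<^sup>2\<psi>\<close> takes values in \<open>K\<close>, and its gain is
  \<open>\<integral>\<psi> d\<nu> - \<integral>\<psi> d\<mu>\<close>. The proof compares the dynamic problem, the static problem and the supremum of
  all gains in a circle: gain \<open>\<le>\<close> dynamic cost, gain \<open>\<le>\<close> static cost, a static competitor whose
  cost is the supremum of the gains, and the observation that every static competitor is also a
  dynamic one with the same cost.
  
  Weak duality. For a feasible \<open>\<psi>\<close> the pairing of \<open>(1/2) \<nabla>\<^sup>2\<psi>\<close> with the polar density is at most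
  \<open>f\<close> of it, pointwise. Integrating this against a static competitor bounds the gain by the cost.
  For a dynamic competitor (\<open>dynamic_weak_duality\<close>) the equation is tested with
  \<open>cutoff n t * \<Psi> x\<close>, where the cutoff vanishes near the times \<open>0\<close> and \<open>1\<close> and \<open>\<Psi>\<close> is a bounded
  truncation of \<open>\<psi>\<close>; boundedness is forced because test functions have a bounded time derivative. As
  \<open>n \<rightarrow> \<infinity>\<close> the time derivative of the cutoff concentrates at the end points and produces
  \<open>\<integral>\<Psi> d\<mu> - \<integral>\<Psi> d\<nu>\<close> by narrow continuity. Then the truncation is removed; the Hessians stay
  bounded since \<open>\<psi>\<close> grows at most quadratically.
  
  Strong duality. Suppose that the gains are bounded, with supremum \<open>S\<close>. The map
  \<open>(1/2) \<nabla>\<^sup>2\<psi> \<mapsto> gain \<psi>\<close> is linear on a subspace of the bounded continuous matrix fields and at most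
  \<open>S\<close> on its \<open>K\<close>-valued members. Because \<open>f\<close> is finite only on positive semidefinite matrices,
  multiples of \<open>|x|\<^sup>2\<close> dominate every bounded field, and a Hahn-Banach argument extends the
  map to a functional \<open>l\<close> on all bounded continuous fields that is still at most \<open>S\<close> on \<open>K\<close>-valued
  ones and nonnegative on fields that pair nonnegatively with the domain of \<open>f\<close>
  (\<open>extended_functional\<close>).
  
  Such an \<open>l\<close> could lose mass at infinity. It does not: on the Hessian of
  \<open>e |x|\<^sup>4 / (1 + e |x|\<^sup>2)\<close>, which is small near the origin and close to twice the identity or more far
  away, \<open>l\<close> equals the gain, and this tends to \<open>0\<close> with \<open>e\<close> because \<open>\<mu>\<close> and \<open>\<nu>\<close> have finite second
  moments. So \<open>l\<close> is tight, the Riesz theorem (\<open>integral_Riesz\<close>) applies to suitable nonnegative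
  combinations of its entries, and with the Radon-Nikodym theorem \<open>l \<Phi> = \<integral> \<Phi> \<bullet> \<sigma> dm\<close> for a
  finite measure \<open>m\<close> and an integrable \<open>\<sigma>\<close> (\<open>density_representation\<close>).
  
  It remains to bound \<open>\<integral> f \<sigma> dm\<close> by \<open>S\<close>. By separation in the epigraph, \<open>f M\<close> is the supremum of
  countably many \<open>A n \<bullet> M\<close> with \<open>A n \<in> K\<close> (\<open>cost_as_supremum\<close>). Choosing the best of the first \<open>n\<close>
  matrices at every point gives a Borel field with values in \<open>K\<close>; by convexity of \<open>K\<close> it is an \<open>L\<^sup>1\<close>
  limit of continuous \<open>K\<close>-valued fields, so its pairing with \<open>\<sigma>\<close> is at most \<open>S\<close>, and monotone
  convergence finishes (\<open>nn_integral_SUP_le\<close>). In particular \<open>\<sigma>\<close> is positive semidefinite almost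
  everywhere, and \<open>\<lambda> = \<sigma> m\<close> is a static competitor of cost at most \<open>S\<close> (\<open>static_solution\<close>).
  
  Finally \<open>\<rho>\<^sub>t = (1 - t) \<mu> + t \<nu>\<close> with the constant curve \<open>\<lambda>\<^sub>t = \<lambda>\<close> solves the Fokker-Planck
  equation, at the cost of \<open>\<lambda>\<close> (\<open>stationary_competitor\<close>). Hence all three values are \<open>S\<close> and
  both minima are attained. If the gains are unbounded, weak duality makes the dynamic value infinite.
\<close>

section \<open>A Hahn-Banach theorem\<close>

text \<open>
  Positive factors suffice, since they force the value \<open>0\<close> at \<open>0\<close>.
\<close>

definition sublinear :: "('a::real_vector \<Rightarrow> real) \<Rightarrow> bool" where
  "sublinear p \<longleftrightarrow> (\<forall>x y. p (x + y) \<le> p x + p y) \<and> (\<forall>c x. 0 < c \<longrightarrow> p (c *\<^sub>R x) = c * p x)"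

lemma sublinear_zero: assumes "sublinear p" shows "p 0 = 0"
proof -
  have "p (2 *\<^sub>R 0) = 2 * p 0" using assms unfolding sublinear_def by (meson zero_less_numeral)
  then show ?thesis by simp
qed

lemma sublinear_neg: assumes "sublinear p" shows "- p (- x) \<le> p x"
proof -
  have "p (x + - x) \<le> p x + p (- x)" using assms unfolding sublinear_def by blast
  then show ?thesis using sublinear_zero[OF assms] by simp
qed

text \<open>
  The lower bounds needed for Zorn's lemma. Along a chain the infimum is subadditive, since two members
  that nearly attain the infima at \<open>x\<close> and \<open>y\<close> can be replaced by the smaller one of them; it is
  finite because \<open>q x \<ge> - p (- x)\<close>.
\<close>

lemma sublinear_Inf_chain:
  assumes ne: "C \<noteq> {}" and sub: "\<And>q. q \<in> C \<Longrightarrow> sublinear q \<and> (\<forall>x. q x \<le> p x)"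
    and chain: "\<And>q r. q \<in> C \<Longrightarrow> r \<in> C \<Longrightarrow> (\<forall>x. q x \<le> r x) \<or> (\<forall>x. r x \<le> q x)"
  shows "sublinear (\<lambda>x. INF q\<in>C. q x)" "\<And>q x. q \<in> C \<Longrightarrow> (INF q\<in>C. q x) \<le> q x"
proof -
  have bdd: "bdd_below ((\<lambda>q. q x) ` C)" for x
  proof (rule bdd_belowI2)
    fix q assume "q \<in> C"
    then show "- p (- x) \<le> q x" using sub[of q] sublinear_neg[of q x]
      by (smt (verit, best))
  qed
  show low: "\<And>q x. q \<in> C \<Longrightarrow> (INF q\<in>C. q x) \<le> q x"
    by (rule cINF_lower[OF bdd])
  show "sublinear (\<lambda>x. INF q\<in>C. q x)"
    unfolding sublinear_def
  proof (intro conjI allI impI)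
    fix x y
    have key: "(INF q\<in>C. q (x + y)) \<le> q1 x + q2 y" if q: "q1 \<in> C" "q2 \<in> C" for q1 q2
    proof -
      obtain q where "q \<in> C" "q x \<le> q1 x" "q y \<le> q2 y"
        using chain[OF q] q by fastforce
      moreover have "q (x + y) \<le> q x + q y" using sub[OF \<open>q \<in> C\<close>] unfolding sublinear_def by blast
      ultimately show ?thesis using low[OF \<open>q \<in> C\<close>, of "x + y"] by linarith
    qed
    have "(INF q\<in>C. q (x + y)) - q1 x \<le> (INF q\<in>C. q y)" if "q1 \<in> C" for q1
      by (rule cINF_greatest[OF ne]) (use key[OF that] in \<open>smt (verit)\<close>)
    then have "(INF q\<in>C. q (x + y)) - (INF q\<in>C. q y) \<le> (INF q\<in>C. q x)"
      by (intro cINF_greatest[OF ne]) (smt (verit))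
    then show "(INF q\<in>C. q (x + y)) \<le> (INF q\<in>C. q x) + (INF q\<in>C. q y)" by linarith
  next
    fix c :: real and x :: 'a assume c: "0 < c"
    have eq: "q (c *\<^sub>R x) = c * q x" if "q \<in> C" for q
      using sub[OF that] c unfolding sublinear_def by blast
    have "(INF q\<in>C. q (c *\<^sub>R x)) / c \<le> (INF q\<in>C. q x)"
      using low[of _ "c *\<^sub>R x"] eq c
      by (intro cINF_greatest[OF ne]) (simp add: field_simps)
    moreover have "c * (INF q\<in>C. q x) \<le> (INF q\<in>C. q (c *\<^sub>R x))"
      using low[of _ x] eq c by (intro cINF_greatest[OF ne]) (simp add: eq)
    ultimately show "(INF q\<in>C. q (c *\<^sub>R x)) = c * (INF q\<in>C. q x)"
      using c by (simp add: field_simps)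
  qed
qed

text \<open>
  Lowering a sublinear functional along the ray of \<open>x\<close>: the largest sublinear minorant that
  takes at \<open>-x\<close> the smallest conceivable value \<open>-q x\<close>.
\<close>

lemma sublinear_lower_ray:
  assumes q: "sublinear q"
  obtains r where "sublinear r" "\<And>y. r y \<le> q y" "\<And>y. r y \<le> q (y + x) - q x"
proof -
  define r where "r y = (INF t\<in>{0::real..}. q (y + t *\<^sub>R x) - t * q x)" for y
  have add: "q (a + b) \<le> q a + q b" for a b using q unfolding sublinear_def by blast
  have hom: "q (c *\<^sub>R a) = c * q a" if "0 \<le> c" for c a
    using q that sublinear_zero[OF q] unfolding sublinear_def by (cases "c = 0") auto
  have bdd: "bdd_below ((\<lambda>t. q (y + t *\<^sub>R x) - t * q x) ` {0..})" for y
  proof (rule bdd_belowI2)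
    fix t :: real assume "t \<in> {0..}"
    then show "- q (- y) \<le> q (y + t *\<^sub>R x) - t * q x"
      using add[of "y + t *\<^sub>R x" "- y"] hom[of t x] by auto
  qed
  have low: "r y \<le> q (y + t *\<^sub>R x) - t * q x" if "0 \<le> t" for t y
    unfolding r_def using that by (intro cINF_lower[OF bdd]) auto
  have ne: "{0::real..} \<noteq> {}" by auto
  have "sublinear r"
    unfolding sublinear_def
  proof (intro conjI allI impI)
    fix y z
    have key: "r (y + z) \<le> (q (y + s *\<^sub>R x) - s * q x) + (q (z + t *\<^sub>R x) - t * q x)"
      if "0 \<le> s" "0 \<le> t" for s t
    proof -
      have "r (y + z) \<le> q ((y + s *\<^sub>R x) + (z + t *\<^sub>R x)) - (s + t) * q x"
        using low[of "s + t" "y + z"] that by (simp add: algebra_simps)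
      then show ?thesis using add[of "y + s *\<^sub>R x" "z + t *\<^sub>R x"] by (simp add: algebra_simps)
    qed
    have "r (y + z) - (q (y + s *\<^sub>R x) - s * q x) \<le> r z" if "0 \<le> s" for s
      unfolding r_def[of z] using key[OF that] by (intro cINF_greatest[OF ne]) (smt (verit) atLeast_iff)
    then have "r (y + z) - r z \<le> r y"
      unfolding r_def[of y] by (intro cINF_greatest[OF ne]) (smt (verit) atLeast_iff)
    then show "r (y + z) \<le> r y + r z" by linarith
  next
    fix c :: real and y assume c: "0 < c"
    have le: "r (c *\<^sub>R y) \<le> c * r y" if c: "0 < c" for c :: real and y
    proof -
      have "r (c *\<^sub>R y) / c \<le> q (y + t *\<^sub>R x) - t * q x" if "0 \<le> t" for t
      proof -
        have "r (c *\<^sub>R y) \<le> q (c *\<^sub>R (y + t *\<^sub>R x)) - (c * t) * q x"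
          using low[of "c * t" "c *\<^sub>R y"] that c by (simp add: algebra_simps)
        moreover have "q (c *\<^sub>R (y + t *\<^sub>R x)) = c * q (y + t *\<^sub>R x)" using hom c by simp
          ultimately have "r (c *\<^sub>R y) \<le> c * (q (y + t *\<^sub>R x) - t * q x)"
            by (simp add: algebra_simps)
          then show ?thesis using c by (simp add: divide_le_eq mult.commute)
      qed
      then have "r (c *\<^sub>R y) / c \<le> r y"
        unfolding r_def[of y] by (intro cINF_greatest[OF ne]) auto
      then show ?thesis using c by (simp add: field_simps)
    qed
    have "r ((1/c) *\<^sub>R (c *\<^sub>R y)) \<le> (1/c) * r (c *\<^sub>R y)" by (rule le) (use c in simp)
    then have "c * r y \<le> r (c *\<^sub>R y)" using c by (simp add: field_simps)
    with le[OF c, of y] show "r (c *\<^sub>R y) = c * r y" by linarith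
  qed
  moreover have "r y \<le> q y" for y using low[of 0 y] by simp
  moreover have "r y \<le> q (y + x) - q x" for y using low[of 1 y] by simp
  ultimately show ?thesis using that by blast
qed

text \<open>
  By Zorn's lemma there is a minimal sublinear functional below \<open>p\<close>; a minimal one cannot be
  lowered along any ray, and this makes it superadditive, hence linear.
\<close>

theorem Hahn_Banach_dominated:
  fixes p :: "'a::real_vector \<Rightarrow> real"
  assumes p: "sublinear p"
  obtains l where "linear l" "\<And>x. l x \<le> p x"
proof -
  define A where "A = {q. sublinear q \<and> (\<forall>x. q x \<le> p x)}"
  define P :: "('a \<Rightarrow> real) \<Rightarrow> ('a \<Rightarrow> real) \<Rightarrow> bool" where "P q r \<longleftrightarrow> (\<forall>x. r x \<le> q x)" for q r
  have "\<exists>m\<in>A. \<forall>a\<in>A. P m a \<longrightarrow> a = m"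
  proof (rule predicate_Zorn)
    show "partial_order_on A (relation_of P A)"
      unfolding partial_order_on_def preorder_on_def refl_on_def trans_def antisym_def relation_of_def P_def
      by (auto intro: order_trans) (meson ext order_antisym)
    fix C assume "C \<in> Chains (relation_of P A)"
    then have CA: "C \<subseteq> A" and ch: "\<And>q r. q \<in> C \<Longrightarrow> r \<in> C \<Longrightarrow> P q r \<or> P r q"
      unfolding Chains_def relation_of_def by auto
    show "\<exists>u\<in>A. \<forall>a\<in>C. P a u"
    proof (cases "C = {}")
      case True then show ?thesis using p unfolding A_def by auto
    next
      case False
      have 1: "\<And>q. q \<in> C \<Longrightarrow> sublinear q \<and> (\<forall>x. q x \<le> p x)" using CA unfolding A_def by auto
      have 2: "\<And>q r. q \<in> C \<Longrightarrow> r \<in> C \<Longrightarrow> (\<forall>x. q x \<le> r x) \<or> (\<forall>x. r x \<le> q x)"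
        using ch unfolding P_def by blast
      have I: "sublinear (\<lambda>x. INF q\<in>C. q x)" "\<And>q x. q \<in> C \<Longrightarrow> (INF q\<in>C. q x) \<le> q x"
        by (rule sublinear_Inf_chain[of C p]; use False 1 2 in \<open>assumption | blast\<close>)+
      obtain q0 where "q0 \<in> C" using False by blast
      then have le: "\<forall>x. (INF q\<in>C. q x) \<le> p x"
        using I(2)[of q0] 1[of q0] by (meson order_trans)
      have "(\<lambda>x. INF q\<in>C. q x) \<in> A"
        unfolding A_def mem_Collect_eq by (rule conjI[OF I(1) le])
      moreover have "\<forall>a\<in>C. P a (\<lambda>x. INF q\<in>C. q x)"
        unfolding P_def by (intro ballI allI I(2))
      ultimately show ?thesis by (intro bexI[where x = "\<lambda>x. INF q\<in>C. q x"])
    qed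
  qed
  then obtain m where "m \<in> A" and mA: "\<And>a. a \<in> A \<Longrightarrow> P m a \<Longrightarrow> a = m" by blast
  then have m: "sublinear m" "\<And>x. m x \<le> p x" unfolding A_def by auto
  have min: "a = m" if "sublinear a" "\<And>x. a x \<le> m x" for a
  proof (rule mA)
    show "a \<in> A" using that m(2) unfolding A_def by (simp, meson order_trans)
    show "P m a" using that unfolding P_def by simp
  qed
  have add: "m (y + x) = m y + m x" for x y
  proof -
    obtain r where r: "sublinear r" "\<And>y. r y \<le> m y" "\<And>y. r y \<le> m (y + x) - m x"
      using sublinear_lower_ray[OF m(1)] by metis
    then have "r = m" using min by blast
    with r(3)[of y] have "m y + m x \<le> m (y + x)" by simp
    then show ?thesis using m(1) unfolding sublinear_def by (meson order_antisym)
  qed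
  have "m (c *\<^sub>R x) = c * m x" for c x
  proof -
    have neg: "m (- x) = - m x" for x using add[of "- x" x] sublinear_zero[OF m(1)] by simp
    have pos: "m (c *\<^sub>R x) = c * m x" if "0 < c" for c x using m(1) that unfolding sublinear_def by blast
    show ?thesis
      using pos[of c x] pos[of "- c" x] neg[of "c *\<^sub>R x"] sublinear_zero[OF m(1)]
      by (cases "c > 0"; cases "c = 0") auto
  qed
  with add have "linear m" by (intro linearI) auto
  then show ?thesis using m(2) that by blast
qed


section \<open>Positive functionals on bounded continuous functions\<close>

definition bcont :: "('a::topological_space \<Rightarrow> 'b::metric_space) \<Rightarrow> bool" where
  "bcont f \<longleftrightarrow> continuous_on UNIV f \<and> bounded (range f)"

lemma bcontI:
  fixes f :: "'a::topological_space \<Rightarrow> 'b::real_normed_vector"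
  assumes "continuous_on UNIV f" "\<And>x. norm (f x) \<le> B"
  shows "bcont f"
  using assms unfolding bcont_def bounded_iff by auto

lemma bcont_bound:
  fixes f :: "'a::topological_space \<Rightarrow> 'b::real_normed_vector"
  assumes "bcont f"
  obtains B where "0 \<le> B" "\<And>x. norm (f x) \<le> B"
  using assms unfolding bcont_def bounded_iff
  by (metis (full_types) norm_ge_zero order_trans rangeI)

lemma bcont_const [simp]: "bcont (\<lambda>x. c)"
  unfolding bcont_def by (auto intro: continuous_intros)

lemma bcont_add:
  fixes f g :: "'a::topological_space \<Rightarrow> 'b::real_normed_vector"
  assumes "bcont f" "bcont g" shows "bcont (\<lambda>x. f x + g x)"
  using assms bounded_plus_comp[of f UNIV g] unfolding bcont_def
  by (auto intro: continuous_intros)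

lemma bcont_scaleR:
  fixes g :: "'a::topological_space \<Rightarrow> 'b::real_normed_vector"
  assumes f: "bcont f" and g: "bcont g" shows "bcont (\<lambda>x. f x *\<^sub>R g x)"
proof -
  obtain B C where "0 \<le> B" "\<And>x. norm (f x) \<le> B" "0 \<le> C" "\<And>x. norm (g x) \<le> C"
    using bcont_bound[OF f] bcont_bound[OF g] by metis
  then have "norm (f x *\<^sub>R g x) \<le> B * C" for x
    by (simp add: mult_mono)
  moreover have "continuous_on UNIV (\<lambda>x. f x *\<^sub>R g x)"
    using f g unfolding bcont_def by (auto intro: continuous_intros)
  ultimately show ?thesis by (rule bcontI[rotated])
qed

lemma bcont_mult:
  fixes f g :: "'a::topological_space \<Rightarrow> real"
  assumes "bcont f" "bcont g" shows "bcont (\<lambda>x. f x * g x)"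
  using bcont_scaleR[OF assms] by simp

lemma bcont_cmult:
  fixes f :: "'a::topological_space \<Rightarrow> real"
  assumes "bcont f" shows "bcont (\<lambda>x. c * f x)"
  using bcont_mult[OF bcont_const assms] .

lemma bcont_diff:
  fixes f g :: "'a::topological_space \<Rightarrow> 'b::real_normed_vector"
  assumes "bcont f" "bcont g" shows "bcont (\<lambda>x. f x - g x)"
  using bcont_add[OF assms(1) bcont_scaleR[OF bcont_const[of "-1"] assms(2)]] by simp

lemma bcont_sum:
  fixes f :: "'i \<Rightarrow> 'a::topological_space \<Rightarrow> 'b::real_normed_vector"
  assumes "\<And>i. i \<in> I \<Longrightarrow> bcont (f i)" shows "bcont (\<lambda>x. \<Sum>i\<in>I. f i x)"
  using assms by (induction I rule: infinite_finite_induct) (auto intro: bcont_add)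

lemma bcont_min:
  fixes f g :: "'a::topological_space \<Rightarrow> real"
  assumes f: "bcont f" and g: "bcont g" shows "bcont (\<lambda>x. min (f x) (g x))"
proof -
  obtain B C where "\<And>x. norm (f x) \<le> B" "\<And>x. norm (g x) \<le> C"
    using bcont_bound[OF f] bcont_bound[OF g] by metis
  then have "norm (min (f x) (g x)) \<le> max B C" for x
    by (smt (verit, best) real_norm_def)
  moreover have "continuous_on UNIV (\<lambda>x. min (f x) (g x))"
    using f g unfolding bcont_def by (auto intro: continuous_intros)
  ultimately show ?thesis by (rule bcontI[rotated])
qed

lemma bcont_measurable:
  fixes f :: "'a::topological_space \<Rightarrow> 'b::metric_space"
  assumes "bcont f" shows "f \<in> borel_measurable borel"
  using assms unfolding bcont_def by (auto intro: borel_measurable_continuous_onI)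

lemma integrable_bcont:
  fixes f :: "'a::topological_space \<Rightarrow> 'b::{banach,second_countable_topology}"
  assumes "bcont f" "finite_measure M" "sets M = sets borel"
  shows "integrable M f"
proof -
  interpret finite_measure M by fact
  obtain B where "0 \<le> B" "\<And>x. norm (f x) \<le> B"
    using bcont_bound[OF assms(1)] by metis
  moreover have "f \<in> borel_measurable M"
    using bcont_measurable[OF assms(1)] assms(3) by (simp cong: measurable_cong_sets)
  ultimately show ?thesis by (intro integrable_const_bound[of _ B]) auto
qed

text \<open>
  Daniell's upper integral: the cheapest cover by countably many nonnegative continuous functions.
  Only the values of \<open>T\<close> on bounded continuous functions enter, so \<open>T\<close> may be a functional on all
  functions.
\<close>

definition upper_integral ::
    "(('a::topological_space \<Rightarrow> real) \<Rightarrow> real) \<Rightarrow> ('a \<Rightarrow> ennreal) \<Rightarrow> ennreal" where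
  "upper_integral T g = Inf {(\<Sum>n. ennreal (T (\<phi> n))) | \<phi>.
     (\<forall>n. bcont (\<phi> n) \<and> (\<forall>x. 0 \<le> \<phi> n x)) \<and> (\<forall>x. g x \<le> (\<Sum>n. ennreal (\<phi> n x)))}"

definition Riesz_measure :: "(('a::topological_space \<Rightarrow> real) \<Rightarrow> real) \<Rightarrow> 'a measure" where
  "Riesz_measure T = measure_of UNIV (sets borel) (\<lambda>E. upper_integral T (indicator E))"

locale positive_functional =
  fixes T :: "('a::metric_space \<Rightarrow> real) \<Rightarrow> real"
  assumes add: "bcont \<phi> \<Longrightarrow> bcont \<psi> \<Longrightarrow> T (\<lambda>x. \<phi> x + \<psi> x) = T \<phi> + T \<psi>"
    and cmult: "bcont \<phi> \<Longrightarrow> T (\<lambda>x. c * \<phi> x) = c * T \<phi>"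
    and nonneg: "bcont \<phi> \<Longrightarrow> (\<And>x. 0 \<le> \<phi> x) \<Longrightarrow> 0 \<le> T \<phi>"
begin

lemma zero: "T (\<lambda>x. 0) = 0"
  using cmult[of "\<lambda>x. 0" 0] by simp

lemma diff: "bcont \<phi> \<Longrightarrow> bcont \<psi> \<Longrightarrow> T (\<lambda>x. \<phi> x - \<psi> x) = T \<phi> - T \<psi>"
  using add[of \<phi> "\<lambda>x. -1 * \<psi> x"] cmult[of \<psi> "-1"] bcont_cmult[of \<psi> "-1"] by simp

lemma mono: "bcont \<phi> \<Longrightarrow> bcont \<psi> \<Longrightarrow> (\<And>x. \<phi> x \<le> \<psi> x) \<Longrightarrow> T \<phi> \<le> T \<psi>"
  using nonneg[of "\<lambda>x. \<psi> x - \<phi> x"] diff[of \<psi> \<phi>] bcont_diff[of \<psi> \<phi>] by simp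

lemma sum: "(\<And>i. i \<in> I \<Longrightarrow> bcont (\<phi> i)) \<Longrightarrow> T (\<lambda>x. \<Sum>i\<in>I. \<phi> i x) = (\<Sum>i\<in>I. T (\<phi> i))"
  by (induction I rule: infinite_finite_induct) (auto simp: zero add bcont_sum)

lemma upper_le:
  assumes "\<And>n. bcont (\<phi> n)" "\<And>n x. 0 \<le> \<phi> n x" "\<And>x. g x \<le> (\<Sum>n. ennreal (\<phi> n x))"
  shows "upper_integral T g \<le> (\<Sum>n. ennreal (T (\<phi> n)))"
  unfolding upper_integral_def using assms by (intro Inf_lower) auto

lemma upper_le_T:
  assumes "bcont \<phi>" "\<And>x. 0 \<le> \<phi> x"
  shows "upper_integral T (\<lambda>x. ennreal (\<phi> x)) \<le> ennreal (T \<phi>)"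
proof -
  define \<Phi> where "\<Phi> n = (if n = 0 then \<phi> else (\<lambda>x. 0))" for n :: nat
  have s: "(\<Sum>n. ennreal (\<Phi> n x)) = ennreal (\<phi> x)" for x
    using suminf_finite[of "{0}" "\<lambda>n. ennreal (\<Phi> n x)"] unfolding \<Phi>_def by auto
  have "(\<Sum>n. ennreal (T (\<Phi> n))) = ennreal (T \<phi>)"
    using suminf_finite[of "{0}" "\<lambda>n. ennreal (T (\<Phi> n))"] zero unfolding \<Phi>_def by auto
  moreover have "upper_integral T (\<lambda>x. ennreal (\<phi> x)) \<le> (\<Sum>n. ennreal (T (\<Phi> n)))"
    by (rule upper_le) (use assms in \<open>auto simp: s\<close>, auto simp: \<Phi>_def)
  ultimately show ?thesis by simp
qed

lemma upper_mono: "(\<And>x. g x \<le> h x) \<Longrightarrow> upper_integral T g \<le> upper_integral T h"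
  unfolding upper_integral_def by (rule Inf_superset_mono) (blast intro: order_trans)

lemma upper_zero: "upper_integral T (\<lambda>x. 0) = 0"
  using upper_le_T[of "\<lambda>x. 0"] zero by simp

lemma upper_approx:
  assumes "upper_integral T g < \<infinity>" "0 < (e::real)"
  obtains \<phi> where "\<And>n. bcont (\<phi> n)" "\<And>n x. 0 \<le> \<phi> n x" "\<And>x. g x \<le> (\<Sum>n. ennreal (\<phi> n x))"
    "(\<Sum>n. ennreal (T (\<phi> n))) < upper_integral T g + ennreal e"
proof -
  have "upper_integral T g < upper_integral T g + ennreal e"
    using assms by (simp add: ennreal_add_left_cancel_less[of _ 0, simplified])
  then have "\<exists>a \<in> {(\<Sum>n. ennreal (T (\<phi> n))) | \<phi>.
     (\<forall>n. bcont (\<phi> n) \<and> (\<forall>x. 0 \<le> \<phi> n x)) \<and> (\<forall>x. g x \<le> (\<Sum>n. ennreal (\<phi> n x)))}.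
     a < upper_integral T g + ennreal e"
    unfolding upper_integral_def[of T g] Inf_less_iff .
  then show ?thesis using that by blast
qed

text \<open>
  Covers of the single terms, chosen with errors \<open>e / 2\<^sup>k\<^sup>+\<^sup>1\<close>, are concatenated to one sequence
  by enumerating pairs.
\<close>

lemma upper_suminf_le: "upper_integral T (\<lambda>x. \<Sum>k. g k x) \<le> (\<Sum>k. upper_integral T (g k))"
proof (cases "\<exists>k. upper_integral T (g k) = \<infinity>")
  case True
  then obtain k where "upper_integral T (g k) = \<infinity>" by blast
  moreover have "upper_integral T (g k) \<le> (\<Sum>k. upper_integral T (g k))"
    using sum_le_suminf[of "\<lambda>k. upper_integral T (g k)" "{k}"] by auto
  ultimately show ?thesis by (simp add: top_unique)
next
  case False
  then have fin: "upper_integral T (g k) < \<infinity>" for k by (simp add: less_top)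
  show ?thesis
  proof (rule ennreal_le_epsilon)
    fix e :: real assume "0 < e"
    then have pos: "0 < e * (1/2) ^ Suc k" for k by simp
    have "\<exists>\<phi>. (\<forall>n. bcont (\<phi> n)) \<and> (\<forall>n x. 0 \<le> \<phi> n x) \<and> (\<forall>x. g k x \<le> (\<Sum>n. ennreal (\<phi> n x))) \<and>
        (\<Sum>n. ennreal (T (\<phi> n))) < upper_integral T (g k) + ennreal (e * (1/2) ^ Suc k)" for k
      using upper_approx[OF fin pos] by metis
    then obtain \<phi> where bc: "\<And>k n. bcont (\<phi> k n)" and ge0: "\<And>k n x. 0 \<le> \<phi> k n x"
      and ge: "\<And>k x. g k x \<le> (\<Sum>n. ennreal (\<phi> k n x))"
      and lt: "\<And>k. (\<Sum>n. ennreal (T (\<phi> k n))) < upper_integral T (g k) + ennreal (e * (1/2) ^ Suc k)"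
      by metis
    define \<Phi> where "\<Phi> j = case_prod \<phi> (prod_decode j)" for j
    have "upper_integral T (\<lambda>x. \<Sum>k. g k x) \<le> (\<Sum>j. ennreal (T (\<Phi> j)))"
    proof (rule upper_le)
      show "bcont (\<Phi> n)" for n unfolding \<Phi>_def using bc by (simp split: prod.split)
      show "0 \<le> \<Phi> n x" for n x unfolding \<Phi>_def using ge0 by (simp split: prod.split)
      fix x
      have "(\<Sum>k. g k x) \<le> (\<Sum>k. \<Sum>n. ennreal (\<phi> k n x))"
        using ge by (intro suminf_le) auto
      also have "\<dots> = (\<Sum>j. ennreal (\<Phi> j x))"
        using suminf_ennreal_2dimen[of "\<lambda>k. \<Sum>n. ennreal (\<phi> k n x)" "\<lambda>(k, n). ennreal (\<phi> k n x)"]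
        unfolding \<Phi>_def by (simp add: case_prod_unfold)
      finally show "(\<Sum>k. g k x) \<le> (\<Sum>j. ennreal (\<Phi> j x))" .
    qed
    also have "\<dots> = (\<Sum>k. \<Sum>n. ennreal (T (\<phi> k n)))"
      using suminf_ennreal_2dimen[of "\<lambda>k. \<Sum>n. ennreal (T (\<phi> k n))" "\<lambda>(k, n). ennreal (T (\<phi> k n))"]
      unfolding \<Phi>_def by (simp add: case_prod_unfold)
    also have "\<dots> \<le> (\<Sum>k. upper_integral T (g k) + ennreal (e * (1/2) ^ Suc k))"
      using lt by (intro suminf_le) (auto intro: less_imp_le)
    also have "\<dots> = (\<Sum>k. upper_integral T (g k)) + (\<Sum>k. ennreal (e * (1/2) ^ Suc k))"
      by (rule suminf_add[symmetric]) auto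
    also have "(\<Sum>k. ennreal (e * (1/2) ^ Suc k)) = ennreal e"
      using sums_mult[OF power_half_series, of e] \<open>0 < e\<close>
      by (intro suminf_ennreal_eq) auto
    finally show "upper_integral T (\<lambda>x. \<Sum>k. g k x) \<le> (\<Sum>k. upper_integral T (g k)) + ennreal e" .
  qed
qed

lemma upper_add_le: "upper_integral T (\<lambda>x. g x + h x) \<le> upper_integral T g + upper_integral T h"
proof -
  define G where "G n = (if n = 0 then g else if n = 1 then h else (\<lambda>x. 0))" for n :: nat
  have 1: "(\<Sum>n. G n x) = g x + h x" for x
    using suminf_finite[of "{0,1}" "\<lambda>n. G n x"] unfolding G_def by auto
  have 2: "(\<Sum>n. upper_integral T (G n)) = upper_integral T g + upper_integral T h"
    using suminf_finite[of "{0,1}" "\<lambda>n. upper_integral T (G n)"] upper_zero unfolding G_def by auto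
  show ?thesis using upper_suminf_le[of G] unfolding 1 2 .
qed

text \<open>
  Multiplying a cover of \<open>g\<close> by the members \<open>w i\<close> of a partition of unity covers the parts
  \<open>g w i\<close>, and \<open>T\<close> adds up. This is what makes open sets measurable.
\<close>

lemma upper_split:
  assumes w: "\<And>i. i \<in> I \<Longrightarrow> bcont (w i)" "\<And>i x. i \<in> I \<Longrightarrow> 0 \<le> w i x"
    and I: "\<And>x. (\<Sum>i\<in>I. w i x) \<le> 1"
  shows "(\<Sum>i\<in>I. upper_integral T (\<lambda>x. g x * ennreal (w i x))) \<le> upper_integral T g"
proof (cases "upper_integral T g = \<infinity>")
  case False
  show ?thesis
  proof (rule ennreal_le_epsilon)
    fix e :: real assume "0 < e"
    have fin: "upper_integral T g < \<infinity>" using False by (simp add: less_top[symmetric])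
    obtain \<phi> where \<phi>: "\<And>n. bcont (\<phi> n)" "\<And>n x. 0 \<le> \<phi> n x" "\<And>x. g x \<le> (\<Sum>n. ennreal (\<phi> n x))"
      "(\<Sum>n. ennreal (T (\<phi> n))) < upper_integral T g + ennreal e"
      using upper_approx[OF fin \<open>0 < e\<close>] by metis
    have bc: "bcont (\<lambda>x. \<phi> n x * w i x)" if "i \<in> I" for i n
      using \<phi>(1) w(1)[OF that] by (rule bcont_mult)
    have ge0: "0 \<le> \<phi> n x * w i x" if "i \<in> I" for i n x
      using \<phi>(2) w(2)[OF that] by simp
    have part: "upper_integral T (\<lambda>x. g x * ennreal (w i x)) \<le> (\<Sum>n. ennreal (T (\<lambda>x. \<phi> n x * w i x)))"
      if i: "i \<in> I" for i
    proof (rule upper_le[OF bc[OF i] ge0[OF i]])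
      show "g x * ennreal (w i x) \<le> (\<Sum>n. ennreal (\<phi> n x * w i x))" for x
        using mult_right_mono[OF \<phi>(3)[of x], of "ennreal (w i x)"]
        by (simp only: ennreal_mult[OF \<phi>(2) w(2)[OF i]] ennreal_suminf_multc zero_le)
    qed
    have "(\<Sum>i\<in>I. upper_integral T (\<lambda>x. g x * ennreal (w i x)))
      \<le> (\<Sum>i\<in>I. \<Sum>n. ennreal (T (\<lambda>x. \<phi> n x * w i x)))"
      using part by (rule sum_mono)
    also have "\<dots> = (\<Sum>n. \<Sum>i\<in>I. ennreal (T (\<lambda>x. \<phi> n x * w i x)))"
      by (rule suminf_sum[symmetric]) simp
    also have "\<dots> \<le> (\<Sum>n. ennreal (T (\<phi> n)))"
    proof (rule suminf_le)
      fix n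
      have "(\<Sum>i\<in>I. ennreal (T (\<lambda>x. \<phi> n x * w i x))) = ennreal (\<Sum>i\<in>I. T (\<lambda>x. \<phi> n x * w i x))"
        using nonneg[OF bc ge0] by (intro sum_ennreal) blast
      also have "(\<Sum>i\<in>I. T (\<lambda>x. \<phi> n x * w i x)) = T (\<lambda>x. \<Sum>i\<in>I. \<phi> n x * w i x)"
        by (rule sum[symmetric]) (rule bc)
      also have "\<dots> \<le> T (\<phi> n)"
      proof (rule mono)
        show "(\<Sum>i\<in>I. \<phi> n x * w i x) \<le> \<phi> n x" for x
          using mult_left_mono[OF I[of x] \<phi>(2)[of n x]] by (simp add: sum_distrib_left)
      qed (auto intro!: bcont_sum bc \<phi>)
      finally show "(\<Sum>i\<in>I. ennreal (T (\<lambda>x. \<phi> n x * w i x))) \<le> ennreal (T (\<phi> n))"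
        by (simp add: ennreal_leI)
    qed auto
    finally show "(\<Sum>i\<in>I. upper_integral T (\<lambda>x. g x * ennreal (w i x))) \<le> upper_integral T g + ennreal e"
      using \<phi>(4) by (auto intro: order_trans less_imp_le)
  qed
qed auto

text \<open>
  The functions \<open>min 1 (n dist (x, - U))\<close> increase to the indicator of \<open>U\<close>. Their increments \<open>w k\<close>
  together with the remainder form a partition of unity, to which \<open>upper_split\<close> applies; countable
  subadditivity puts the increments together again.
\<close>

lemma upper_split_open:
  assumes U: "open U"
  shows "upper_integral T (\<lambda>x. g x * indicator U x) + upper_integral T (\<lambda>x. g x * indicator (- U) x)
    \<le> upper_integral T g"
proof (cases "U = UNIV")
  case True then show ?thesis by (simp add: upper_zero)
next
  case False
  define h where "h n x = min 1 (real n * infdist x (- U))" for n x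
  define w where "w n x = h (Suc n) x - h n x" for n x
  have cont: "continuous_on UNIV (h n)" for n
    unfolding h_def by (intro continuous_intros)
  have h01: "0 \<le> h n x" "h n x \<le> 1" for n x
    unfolding h_def by (auto simp: infdist_nonneg)
  have h: "bcont (h n)" for n
    using cont h01 by (intro bcontI[of _ 1]) auto
  have w: "bcont (w n)" for n
    unfolding w_def using h by (intro bcont_diff)
  have w0: "0 \<le> w n x" for n x
    unfolding w_def h_def by (simp add: mult_right_mono infdist_nonneg min.coboundedI2)
  have hU: "h n x = 0" if "x \<notin> U" for n x
    unfolding h_def using that by simp
  have wsum: "(\<Sum>k<n. w k x) = h n x" for n x
    unfolding w_def using sum_lessThan_telescope[of "\<lambda>k. h k x" n] by (simp add: h_def)
  have lim: "(\<lambda>n. h n x) \<longlonglongrightarrow> indicator U x" for x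
  proof (cases "x \<in> U")
    case True
    then have "0 < infdist x (- U)"
      using U False infdist_pos_not_in_closed[of "- U" x] by auto
    then obtain N where N: "1 \<le> real N * infdist x (- U)"
      using reals_Archimedean3[of "infdist x (- U)"] by (metis less_imp_le)
    have "h n x = 1" if "N \<le> n" for n
      unfolding h_def using N that mult_right_mono[of "real N" "real n" "infdist x (- U)"]
      by (simp add: infdist_nonneg)
    then have "\<forall>\<^sub>F n in sequentially. h n x = 1" by (rule eventually_sequentiallyI)
    then show ?thesis using True by (auto intro: tendsto_eventually)
  next
    case False then show ?thesis using hU by simp
  qed
  have "g x * indicator U x = (\<Sum>k. g x * ennreal (w k x))" for x
  proof -
    have "(\<lambda>k. w k x) sums (indicator U x - h 0 x)"
      unfolding w_def by (rule telescope_sums[OF lim])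
    then have "(\<Sum>k. ennreal (w k x)) = ennreal (indicator U x)"
      using w0 by (intro suminf_ennreal_eq) (auto simp: h_def)
    then show ?thesis by (simp add: ennreal_indicator)
  qed
  then have "upper_integral T (\<lambda>x. g x * indicator U x) \<le> (\<Sum>k. upper_integral T (\<lambda>x. g x * ennreal (w k x)))"
    using upper_suminf_le[of "\<lambda>k x. g x * ennreal (w k x)"] by simp
  then have "upper_integral T (\<lambda>x. g x * indicator U x) + upper_integral T (\<lambda>x. g x * indicator (- U) x)
    \<le> (\<Sum>k. upper_integral T (\<lambda>x. g x * ennreal (w k x))) + upper_integral T (\<lambda>x. g x * indicator (- U) x)"
    by (rule add_right_mono)
  also have "\<dots> \<le> upper_integral T g"
  proof (rule LIMSEQ_le_const2)
    show "(\<lambda>n. (\<Sum>k<n. upper_integral T (\<lambda>x. g x * ennreal (w k x))) + upper_integral T (\<lambda>x. g x * indicator (- U) x))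
      \<longlonglongrightarrow> (\<Sum>k. upper_integral T (\<lambda>x. g x * ennreal (w k x))) + upper_integral T (\<lambda>x. g x * indicator (- U) x)"
      by (intro tendsto_add summable_LIMSEQ) auto
    have "(\<Sum>k<n. upper_integral T (\<lambda>x. g x * ennreal (w k x))) + upper_integral T (\<lambda>x. g x * indicator (- U) x)
        \<le> upper_integral T g" for n
    proof -
      \<comment> \<open>the first n increments, and the rest of 1, which is at least the indicator of - U\<close>
      define v where "v k = (if k < n then w k else (\<lambda>x. 1 - h n x))" for k
      have sv: "(\<Sum>k<Suc n. F (v k)) = (\<Sum>k<n. F (w k)) + F (\<lambda>x. 1 - h n x)" for F :: "('a \<Rightarrow> real) \<Rightarrow> 'b::comm_monoid_add"
        unfolding v_def by simp
      have "upper_integral T (\<lambda>x. g x * indicator (- U) x) \<le> upper_integral T (\<lambda>x. g x * ennreal (1 - h n x))"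
        by (rule upper_mono) (auto simp: indicator_def hU)
      then have "(\<Sum>k<n. upper_integral T (\<lambda>x. g x * ennreal (w k x))) + upper_integral T (\<lambda>x. g x * indicator (- U) x)
        \<le> (\<Sum>k<Suc n. upper_integral T (\<lambda>x. g x * ennreal (v k x)))"
        unfolding sv[of "\<lambda>u. upper_integral T (\<lambda>x. g x * ennreal (u x))"] by (rule add_left_mono)
      also have "\<dots> \<le> upper_integral T g"
      proof (rule upper_split)
        show "bcont (v k)" for k unfolding v_def using w h by (auto intro: bcont_diff)
        show "0 \<le> v k x" for k x unfolding v_def using w0 h01 by auto
        show "(\<Sum>k<Suc n. v k x) \<le> 1" for x
          using sv[of "\<lambda>u. u x"] wsum[of x n] by simp
      qed
      finally show ?thesis .
    qed
    then show "\<exists>N. \<forall>n\<ge>N. (\<Sum>k<n. upper_integral T (\<lambda>x. g x * ennreal (w k x))) + upper_integral T (\<lambda>x. g x * indicator (- U) x)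
        \<le> upper_integral T g" by blast
  qed
  finally show ?thesis .
qed

text \<open>
  Caratheodory's construction: the upper integral of indicators is an outer measure, and
  \<open>upper_split_open\<close> says that open sets split every set additively.
\<close>

lemma Riesz_measure_space:
  "measure_space UNIV (sets borel) (\<lambda>E. upper_integral T (indicator E))"
proof -
  let ?f = "\<lambda>E. upper_integral T (indicator E)"
  interpret P: sigma_algebra UNIV "Pow (UNIV :: 'a set)" by (rule sigma_algebra_Pow)
  have "outer_measure_space (Pow UNIV) ?f"
    unfolding outer_measure_space_def positive_def increasing_def countably_subadditive_def
  proof (intro conjI allI impI ballI)
    have "indicator {} = (\<lambda>x::'a. 0::ennreal)" by auto
    then show "?f {} = 0" using upper_zero by simp
    fix A B :: "'a set" assume "A \<subseteq> B"
    then show "?f A \<le> ?f B" by (intro upper_mono indicator_leI) auto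
  next
    fix A :: "nat \<Rightarrow> 'a set" assume d: "disjoint_family A"
    then have "(\<Sum>i. indicator (A i) x) = (indicator (\<Union>i. A i) x :: ennreal)" for x
      by (rule suminf_indicator)
    then show "?f (\<Union>i. A i) \<le> (\<Sum>i. ?f (A i))"
      using upper_suminf_le[of "\<lambda>i. indicator (A i)"] by simp
  qed
  then have ms: "measure_space UNIV (lambda_system UNIV (Pow UNIV) ?f) ?f"
    by (rule P.caratheodory_lemma)
  then interpret L: sigma_algebra UNIV "lambda_system UNIV (Pow UNIV) ?f"
    by (simp add: measure_space_def)
  have "U \<in> lambda_system UNIV (Pow UNIV) ?f" if U: "open U" for U
    unfolding P.lambda_system_eq
  proof (intro CollectI conjI ballI antisym)
    fix E :: "'a set"
    have i: "(\<lambda>x. indicator E x * indicator U x :: ennreal) = indicator (E \<inter> U)"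
      "(\<lambda>x. indicator E x * indicator (- U) x :: ennreal) = indicator (E - U)"
      by (auto simp: fun_eq_iff indicator_def)
    show "?f (E \<inter> U) + ?f (E - U) \<le> ?f E"
      using upper_split_open[OF U, of "indicator E"] unfolding i .
    have "(indicator E :: 'a \<Rightarrow> ennreal) = (\<lambda>x. indicator (E \<inter> U) x + indicator (E - U) x)"
      by (auto simp: fun_eq_iff indicator_def)
    then show "?f E \<le> ?f (E \<inter> U) + ?f (E - U)"
      using upper_add_le[of "indicator (E \<inter> U)" "indicator (E - U)"] by simp
  qed auto
  then have "sets borel \<subseteq> lambda_system UNIV (Pow UNIV) ?f"
    using L.sigma_sets_subset[of "Collect open"] unfolding borel_def by auto
  then show ?thesis
    using ms sets.sigma_algebra_axioms[of "borel :: 'a measure"]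
    unfolding measure_space_def positive_def countably_additive_def by (auto simp: subset_eq)
qed

lemma sets_Riesz [simp, measurable_cong]: "sets (Riesz_measure T) = sets borel"
  unfolding Riesz_measure_def using sets.sigma_sets_eq[of borel] by simp

lemma space_Riesz [simp]: "space (Riesz_measure T) = UNIV"
  unfolding Riesz_measure_def by simp

lemma emeasure_Riesz:
  assumes "E \<in> sets borel"
  shows "emeasure (Riesz_measure T) E = upper_integral T (indicator E)"
  unfolding Riesz_measure_def
  using Riesz_measure_space assms by (intro emeasure_measure_of_sigma) (auto simp: measure_space_def)

end

text \<open>
  Domination of functionals passes to their measures. This yields absolute continuity below.
\<close>

lemma Riesz_measure_mono:
  assumes "positive_functional T" "positive_functional T'" "E \<in> sets borel"
    and le: "\<And>\<phi>. bcont \<phi> \<Longrightarrow> (\<And>x. 0 \<le> \<phi> x) \<Longrightarrow> T \<phi> \<le> T' \<phi>"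
  shows "emeasure (Riesz_measure T) E \<le> emeasure (Riesz_measure T') E"
proof -
  have "upper_integral T (indicator E) \<le> upper_integral T' (indicator E)"
    unfolding upper_integral_def
  proof (rule Inf_mono, safe)
    fix \<phi> :: "nat \<Rightarrow> 'a \<Rightarrow> real"
    assume \<phi>: "\<forall>n. bcont (\<phi> n) \<and> (\<forall>x. 0 \<le> \<phi> n x)" "\<forall>x. indicator E x \<le> (\<Sum>n. ennreal (\<phi> n x))"
    have "(\<Sum>n. ennreal (T (\<phi> n))) \<le> (\<Sum>n. ennreal (T' (\<phi> n)))"
      using \<phi> by (intro suminf_le ennreal_leI le) auto
    then show "\<exists>a\<in>{(\<Sum>n. ennreal (T (\<phi> n))) |\<phi>. (\<forall>n. bcont (\<phi> n) \<and> (\<forall>x. 0 \<le> \<phi> n x)) \<and>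
        (\<forall>x. indicator E x \<le> (\<Sum>n. ennreal (\<phi> n x)))}. a \<le> (\<Sum>n. ennreal (T' (\<phi> n)))"
      using \<phi> by blast
  qed
  then show ?thesis
    using assms(1-3) by (simp add: positive_functional.emeasure_Riesz)
qed

text \<open>
  Tightness is expressed by a continuous majorant \<open>\<eta>\<close> of the indicator of the complement of a compact
  set, because \<open>T\<close> can only be evaluated on continuous functions.
\<close>

locale tight_functional = positive_functional +
  assumes tight: "0 < e \<Longrightarrow> \<exists>K \<eta>. compact K \<and> bcont \<eta> \<and> (\<forall>x. 0 \<le> \<eta> x) \<and> (\<forall>x. x \<notin> K \<longrightarrow> 1 \<le> \<eta> x) \<and> T \<eta> < e"
begin

text \<open>
  No mass is lost: on a compact set finitely many members of a cover of \<open>1\<close> suffice, up to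
  a small constant, and outside of it tightness takes over.
\<close>

lemma T_one_le: "ennreal (T (\<lambda>x. 1)) \<le> upper_integral T (\<lambda>x. 1)"
  unfolding upper_integral_def
proof (rule Inf_greatest, safe, rule ennreal_le_epsilon)
  fix \<phi> :: "nat \<Rightarrow> 'a \<Rightarrow> real" and e :: real
  assume \<phi>: "\<forall>n. bcont (\<phi> n) \<and> (\<forall>x. 0 \<le> \<phi> n x)" "\<forall>x. 1 \<le> (\<Sum>n. ennreal (\<phi> n x))" and e: "0 < e"
  \<comment> \<open>the error d occurs once as a constant, which costs d T(1), and once outside of K\<close>
  define d where "d = e / (T (\<lambda>x. 1) + 1)"
  have T1: "0 \<le> T (\<lambda>x. 1)" by (rule nonneg) auto
  then have d: "0 < d" unfolding d_def using e by simp
  obtain K \<eta> where K: "compact K" "bcont \<eta>" "\<And>x. 0 \<le> \<eta> x" "\<And>x. x \<notin> K \<Longrightarrow> 1 \<le> \<eta> x" "T \<eta> < d"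
    using tight[OF d] by blast
  define V where "V N = {x. 1 - d < (\<Sum>n<N. \<phi> n x)}" for N
  have opn: "open (V N)" for N
    unfolding V_def using \<phi>(1) by (intro open_Collect_less continuous_intros) (auto simp: bcont_def)
  have "\<exists>N. x \<in> V N" for x
  proof (rule ccontr)
    assume "\<nexists>N. x \<in> V N"
    then have le: "(\<Sum>n<N. \<phi> n x) \<le> 1 - d" for N unfolding V_def by (auto simp: not_less)
    have "(\<Sum>n. ennreal (\<phi> n x)) \<le> ennreal (1 - d)"
    proof (rule suminf_le_const)
      show "(\<Sum>n<N. ennreal (\<phi> n x)) \<le> ennreal (1 - d)" for N
        using \<phi>(1) le[of N] by (subst sum_ennreal) (auto intro: ennreal_leI)
    qed auto
    also have "\<dots> < 1" using d by (subst ennreal_1[symmetric], subst ennreal_less_iff) (use le[of 0] in auto)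
    finally show False using \<phi>(2) by (simp add: leD)
  qed
  then have "K \<subseteq> (\<Union>N\<in>UNIV. V N)" by blast
  then obtain C where C: "finite C" "K \<subseteq> (\<Union>N\<in>C. V N)"
    using compactE_image[OF K(1), of UNIV V] opn by metis
  define N where "N = Max C"
  have N: "n \<le> N" if "n \<in> C" for n unfolding N_def using C(1) that by (rule Max_ge)
  have cover: "1 \<le> ((\<Sum>n<N. \<phi> n x) + d * 1) + \<eta> x" for x
  proof (cases "x \<in> K")
    case True
    then obtain M where "M \<in> C" "x \<in> V M" using C(2) by (meson UN_E subsetD)
    moreover have "(\<Sum>n<M. \<phi> n x) \<le> (\<Sum>n<N. \<phi> n x)"
      using N[OF \<open>M \<in> C\<close>] \<phi>(1) by (intro sum_mono2) auto
    ultimately show ?thesis unfolding V_def using K(3)[of x] by auto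
  next
    case False
    have "0 \<le> (\<Sum>n<N. \<phi> n x)" using \<phi>(1) by (intro sum_nonneg) auto
    then show ?thesis using K(4)[OF False] d by simp
  qed
  have bc: "bcont (\<lambda>x. \<Sum>n<N. \<phi> n x)" "bcont (\<lambda>x. (\<Sum>n<N. \<phi> n x) + d * 1)"
    using \<phi>(1) by (auto intro!: bcont_sum bcont_add)
  have "T (\<lambda>x. 1) \<le> T (\<lambda>x. ((\<Sum>n<N. \<phi> n x) + d * 1) + \<eta> x)"
    by (rule mono[OF bcont_const bcont_add[OF bc(2) K(2)] cover])
  also have "\<dots> = (\<Sum>n<N. T (\<phi> n)) + d * T (\<lambda>x. 1) + T \<eta>"
    using add[OF bc(2) K(2)] add[OF bc(1), of "\<lambda>x. d * 1"] cmult[of "\<lambda>x. 1" d] sum[of "{..<N}" \<phi>] \<phi>(1)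
    by simp
  also have "\<dots> \<le> (\<Sum>n<N. T (\<phi> n)) + e"
    using K(5) T1 unfolding d_def by (simp add: field_simps)
  finally have "ennreal (T (\<lambda>x. 1)) \<le> ennreal (\<Sum>n<N. T (\<phi> n)) + ennreal e"
    using e by (subst ennreal_plus[symmetric]) (auto intro!: ennreal_leI sum_nonneg nonneg simp: \<phi>(1))
  also have "ennreal (\<Sum>n<N. T (\<phi> n)) = (\<Sum>n<N. ennreal (T (\<phi> n)))"
    using \<phi>(1) by (intro sum_ennreal[symmetric]) (auto intro: nonneg)
  also have "(\<Sum>n<N. ennreal (T (\<phi> n))) \<le> (\<Sum>n. ennreal (T (\<phi> n)))"
    by (rule sum_le_suminf) auto
  finally show "ennreal (T (\<lambda>x. 1)) \<le> (\<Sum>n. ennreal (T (\<phi> n))) + ennreal e"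
    by (meson add_right_mono order_trans)
qed

lemma emeasure_Riesz_UNIV: "emeasure (Riesz_measure T) UNIV = ennreal (T (\<lambda>x. 1))"
  using T_one_le upper_le_T[of "\<lambda>x. 1"] emeasure_Riesz[of UNIV] by (auto intro: antisym)

lemma finite_measure_Riesz: "finite_measure (Riesz_measure T)"
  by (rule finite_measureI) (simp add: emeasure_Riesz_UNIV)

text \<open>
  Layer cake: \<open>\<phi>\<close> is cut into \<open>N\<close> horizontal slices \<open>u k\<close> of height \<open>1/N\<close>. Each slice
  lies above \<open>1/N\<close> times the indicator of the next superlevel set and below \<open>1/N\<close> times that of its
  own; the shift by one level costs at most the total mass divided by \<open>N\<close>.
\<close>

lemma integral_Riesz_le:
  assumes \<phi>: "bcont \<phi>" "\<And>x. 0 \<le> \<phi> x" "\<And>x. \<phi> x \<le> 1"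
  shows "integral\<^sup>L (Riesz_measure T) \<phi> \<le> T \<phi>"
proof (rule field_le_epsilon)
  fix e :: real assume e: "0 < e"
  let ?M = "Riesz_measure T"
  interpret finite_measure ?M by (rule finite_measure_Riesz)
  define m where "m = measure ?M UNIV"
  obtain N' where "m / e < real N'" using reals_Archimedean2 by blast
  define N where "N = Suc N'"
  have N: "0 < real N" "m / real N \<le> e"
    using \<open>m / e < real N'\<close> e unfolding N_def by (auto simp: field_simps)
  define u where "u k x = min (\<phi> x) (real (Suc k) / N) - min (\<phi> x) (real k / N)" for k x
  define A where "A k = {x. real k / N < \<phi> x}" for k
  have mphi: "\<phi> \<in> borel_measurable borel" using \<phi>(1) by (rule bcont_measurable)
  have A: "A k \<in> sets borel" for k
    unfolding A_def using mphi by measurable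
  have u: "bcont (u k)" for k
    unfolding u_def using \<phi>(1) by (intro bcont_diff bcont_min bcont_const)
  have u0: "0 \<le> u k x" for k x
    unfolding u_def using N(1) by (simp add: field_simps min_def)
  have u_sum: "(\<Sum>k<N. u k x) = \<phi> x" for x
    unfolding u_def using sum_lessThan_telescope[of "\<lambda>k. min (\<phi> x) (real k / N)" N] \<phi>(2,3)[of x] N(1)
    by simp
  have lower: "indicator (A (Suc k)) x \<le> N * u k x" for k x
    unfolding u_def A_def indicator_def using N(1) u0[of k x] u_def
    by (auto simp: field_simps min_def)
  have upper: "u k x \<le> indicator (A k) x / N" for k x
    unfolding u_def A_def indicator_def using N(1) by (auto simp: field_simps min_def)
  have part: "measure ?M (A (Suc k)) \<le> N * T (u k)" for k
  proof -
    have "emeasure ?M (A (Suc k)) \<le> upper_integral T (\<lambda>x. ennreal (N * u k x))"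
      unfolding emeasure_Riesz[OF A] using lower
      by (intro upper_mono) (simp add: ennreal_indicator[symmetric] ennreal_leI del: ennreal_indicator)
    also have "\<dots> \<le> ennreal (T (\<lambda>x. N * u k x))"
      using u u0 N(1) by (intro upper_le_T bcont_cmult) auto
    also have "T (\<lambda>x. N * u k x) = N * T (u k)" using u by (rule cmult)
    finally show ?thesis
      using nonneg[OF u u0] N(1) by (simp add: emeasure_eq_measure)
  qed
  have int_ind: "integrable ?M (\<lambda>x. indicat_real (A k) x)" for k
    using A by (intro integrable_real_indicator) (auto simp: emeasure_eq_measure)
  have "\<phi> x \<le> (1 / N) * (1 + (\<Sum>k<N. indicator (A (Suc k)) x))" for x
  proof -
    have "\<phi> x \<le> (\<Sum>k<N. indicator (A k) x / N)"
      unfolding u_sum[symmetric] by (intro sum_mono upper)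
    also have "\<dots> \<le> (\<Sum>k<Suc N. indicator (A k) x / N)" by simp
    also have "\<dots> = (1 / N) * (indicator (A 0) x + (\<Sum>k<N. indicator (A (Suc k)) x))"
      by (subst sum.lessThan_Suc_shift) (simp add: sum_divide_distrib add_divide_distrib)
    also have "\<dots> \<le> (1 / N) * (1 + (\<Sum>k<N. indicator (A (Suc k)) x))"
      using N(1) by (intro mult_left_mono add_right_mono) (auto simp: indicator_def)
    finally show ?thesis .
  qed
  then have "integral\<^sup>L ?M \<phi> \<le> (\<integral>x. (1 / N) * (1 + (\<Sum>k<N. indicator (A (Suc k)) x)) \<partial>?M)"
    using integrable_bcont[OF \<phi>(1) finite_measure_Riesz] int_ind by (intro integral_mono) auto
  also have "\<dots> = (1 / N) * (m + (\<Sum>k<N. measure ?M (A (Suc k))))"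
    using int_ind A by (simp add: m_def)
  also have "\<dots> \<le> (1 / N) * (m + (\<Sum>k<N. N * T (u k)))"
    using N(1) part by (intro mult_left_mono add_left_mono sum_mono) auto
  also have "\<dots> = m / N + T \<phi>"
    using N(1) sum[of "{..<N}" u] u by (simp add: sum_distrib_left[symmetric] u_sum field_simps)
  finally show "integral\<^sup>L ?M \<phi> \<le> T \<phi> + e" using N(2) by simp
qed

text \<open>
  For \<open>0 \<le> \<phi> \<le> 1\<close> the reverse inequality follows from \<open>integral_Riesz_le\<close> for \<open>1 - \<phi>\<close>, because
  by tightness the total mass is exactly \<open>T 1\<close>. An affine change of the values does the rest.
\<close>

theorem integral_Riesz:
  assumes \<phi>: "bcont \<phi>"
  shows "integral\<^sup>L (Riesz_measure T) \<phi> = T \<phi>"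
proof -
  let ?M = "Riesz_measure T"
  interpret finite_measure ?M by (rule finite_measure_Riesz)
  have m: "measure ?M UNIV = T (\<lambda>x. 1)"
    using emeasure_Riesz_UNIV nonneg[of "\<lambda>x. 1"] by (simp add: emeasure_eq_measure)
  have unit: "integral\<^sup>L ?M \<psi> = T \<psi>" if \<psi>: "bcont \<psi>" "\<And>x. 0 \<le> \<psi> x" "\<And>x. \<psi> x \<le> 1" for \<psi>
  proof (rule antisym)
    show "integral\<^sup>L ?M \<psi> \<le> T \<psi>" using \<psi> by (rule integral_Riesz_le)
    have "(\<integral>x. 1 - \<psi> x \<partial>?M) \<le> T (\<lambda>x. 1 - \<psi> x)"
      using \<psi> by (intro integral_Riesz_le bcont_diff) auto
    moreover have "(\<integral>x. 1 - \<psi> x \<partial>?M) = T (\<lambda>x. 1) - integral\<^sup>L ?M \<psi>"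
      using integrable_bcont[OF \<psi>(1) finite_measure_Riesz] m by simp
    moreover have "T (\<lambda>x. 1 - \<psi> x) = T (\<lambda>x. 1) - T \<psi>"
      using diff[of "\<lambda>x. 1" \<psi>] \<psi>(1) by simp
    ultimately show "T \<psi> \<le> integral\<^sup>L ?M \<psi>" by simp
  qed
  obtain B' where B': "\<And>x. norm (\<phi> x) \<le> B'" using bcont_bound[OF \<phi>] by metis
  define B where "B = \<bar>B'\<bar> + 1"
  have B: "0 < B" "\<And>x. \<bar>\<phi> x\<bar> \<le> B" unfolding B_def using B' by (auto, smt (verit) real_norm_def)
  define \<psi> where "\<psi> x = 1 / (2 * B) * \<phi> x + 1 / 2 * 1" for x
  have b: "bcont (\<lambda>x. 1 / (2 * B) * \<phi> x)" using \<phi> by (rule bcont_cmult)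
  then have "bcont \<psi>" unfolding \<psi>_def by (intro bcont_add) auto
  moreover have "0 \<le> \<psi> x" "\<psi> x \<le> 1" for x
    using B(1) B(2)[of x] unfolding \<psi>_def by (auto simp: field_simps)
  ultimately have "integral\<^sup>L ?M \<psi> = T \<psi>" by (rule unit)
  moreover have "T \<psi> = 1 / (2 * B) * T \<phi> + 1 / 2 * T (\<lambda>x. 1)"
    unfolding \<psi>_def add[OF b bcont_const] cmult[OF \<phi>] cmult[OF bcont_const] ..
  moreover have "integral\<^sup>L ?M \<psi> = 1 / (2 * B) * integral\<^sup>L ?M \<phi> + 1 / 2 * T (\<lambda>x. 1)"
    unfolding \<psi>_def using integrable_bcont[OF \<phi> finite_measure_Riesz] m by simp
  ultimately show ?thesis using B(1) by simp
qed

end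


section \<open>Calculus of test functions\<close>

definition outer :: "real^'n \<Rightarrow> real^'n \<Rightarrow> real^'n^'n" where
  "outer a b = (\<chi> i j. a $ i * b $ j)"

lemma outer_mult_vector: "outer a b *v h = (b \<bullet> h) *\<^sub>R a"
  by (simp add: outer_def vec_eq_iff matrix_vector_mult_def inner_vec_def sum_distrib_right
      sum_distrib_left mult_ac)

lemma norm_outer: "norm (outer a b) = norm a * norm b"
proof -
  have "outer a b $ i = (a $ i) *\<^sub>R b" for i
    by (simp add: outer_def vec_eq_iff)
  then have "norm (outer a b) = L2_set (\<lambda>i. norm (a $ i) * norm b) UNIV"
    by (simp add: norm_vec_def[of "outer a b"])
  also have "\<dots> = norm a * norm b"
    by (simp add: L2_set_left_distrib[symmetric] norm_vec_def[of a])
  finally show ?thesis .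
qed

lemma bounded_bilinear_outer: "bounded_bilinear outer"
proof
  show "\<exists>K. \<forall>a b. norm (outer a b) \<le> norm a * norm b * K"
    by (rule exI[of _ 1]) (simp add: norm_outer)
qed (auto simp: outer_def vec_eq_iff algebra_simps)

lemmas tendsto_outer = bounded_bilinear.tendsto[OF bounded_bilinear_outer]
lemmas continuous_on_outer = bounded_bilinear.continuous_on[OF bounded_bilinear_outer]

lemma norm_matrix_vector_le: "norm ((A :: real^'n^'m) *v x) \<le> norm A * norm x"
proof -
  have "norm (A *v x) = L2_set (\<lambda>i. norm ((A *v x) $ i)) UNIV" by (simp add: norm_vec_def)
  also have "\<dots> \<le> L2_set (\<lambda>i. norm (A $ i) * norm x) UNIV"
  proof (rule L2_set_mono)
    fix i
    have "(A *v x) $ i = A $ i \<bullet> x"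
      by (simp add: matrix_vector_mult_def inner_vec_def)
    then show "norm ((A *v x) $ i) \<le> norm (A $ i) * norm x"
      by (simp add: Cauchy_Schwarz_ineq2)
  qed auto
  also have "\<dots> = norm A * norm x"
    by (simp add: L2_set_left_distrib[symmetric] norm_vec_def[of A])
  finally show ?thesis .
qed

lemma twice_differentiableD:
  assumes "twice_differentiable \<psi>"
  shows "(\<psi> has_derivative (\<lambda>h. grad \<psi> x \<bullet> h)) (at x)"
    and "(grad \<psi> has_derivative (\<lambda>h. hessian \<psi> x *v h)) (at x)"
proof -
  let ?D = "frechet_derivative \<psi> (at x)"
  have D: "(\<psi> has_derivative ?D) (at x)"
    using assms unfolding twice_differentiable_def by (simp add: frechet_derivative_works)
  then have lin: "linear ?D" by (rule has_derivative_linear)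
  have "?D h = grad \<psi> x \<bullet> h" for h
  proof -
    have "?D h = ?D (\<Sum>i\<in>UNIV. (h $ i) *\<^sub>R axis i 1)"
      by (simp add: basis_expansion[of h, unfolded scalar_mult_eq_scaleR])
    also have "\<dots> = (\<Sum>i\<in>UNIV. h $ i * ?D (axis i 1))"
      using lin by (simp add: linear_sum linear_scale)
    finally show ?thesis by (simp add: grad_def inner_vec_def mult.commute)
  qed
  then have "?D = (\<lambda>h. grad \<psi> x \<bullet> h)" by blast
  with D show "(\<psi> has_derivative (\<lambda>h. grad \<psi> x \<bullet> h)) (at x)" by simp
  show "(grad \<psi> has_derivative (\<lambda>h. hessian \<psi> x *v h)) (at x)"
    using assms unfolding twice_differentiable_def hessian_def by (simp add: jacobian_works[symmetric])
qed

lemma hessian_eqI: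
  assumes G: "\<And>x. (\<psi> has_derivative (\<lambda>h. G x \<bullet> h)) (at x)"
    and H: "\<And>x. (G has_derivative (\<lambda>h. H x *v h)) (at x)"
  shows "twice_differentiable \<psi>" "grad \<psi> = G" "hessian \<psi> = H"
proof -
  have "frechet_derivative \<psi> (at x) = (\<lambda>h. G x \<bullet> h)" for x
    using frechet_derivative_at[OF G] by simp
  then have "grad \<psi> x = G x" for x
    by (simp add: grad_def vec_eq_iff inner_axis)
  then show gr: "grad \<psi> = G" by blast
  have "jacobian G (at x) = H x" for x
    unfolding jacobian_def frechet_derivative_at[OF H, symmetric] by (rule matrix_of_matrix_vector_mul)
  then show "hessian \<psi> = H"
    unfolding hessian_def gr by (intro ext)
  show "twice_differentiable \<psi>"
    unfolding twice_differentiable_def gr by (intro conjI allI differentiableI[OF G] differentiableI[OF H])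
qed

lemma Cb2I:
  assumes "\<And>x. (\<psi> has_derivative (\<lambda>h. G x \<bullet> h)) (at x)"
    and "\<And>x. (G has_derivative (\<lambda>h. H x *v h)) (at x)"
    and "continuous_on UNIV H" "\<And>x. norm (H x) \<le> B"
  shows "\<psi> \<in> Cb2"
proof -
  have "bounded (range H)" unfolding bounded_iff using assms(4) by auto
  then show ?thesis
    unfolding Cb2_def mem_Collect_eq hessian_eqI(3)[OF assms(1,2)]
    using hessian_eqI(1)[OF assms(1,2)] assms(3) by blast
qed

lemma Cb2D:
  assumes "\<psi> \<in> Cb2"
  shows "(\<psi> has_derivative (\<lambda>h. grad \<psi> x \<bullet> h)) (at x)"
    and "(grad \<psi> has_derivative (\<lambda>h. hessian \<psi> x *v h)) (at x)"
    and "continuous_on UNIV (hessian \<psi>)" "continuous_on UNIV (grad \<psi>)" "continuous_on UNIV \<psi>"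
proof -
  have td: "twice_differentiable \<psi>" using assms unfolding Cb2_def by simp
  then show "(\<psi> has_derivative (\<lambda>h. grad \<psi> x \<bullet> h)) (at x)"
    and "(grad \<psi> has_derivative (\<lambda>h. hessian \<psi> x *v h)) (at x)" for x
    by (auto intro: twice_differentiableD)
  show "continuous_on UNIV (hessian \<psi>)" using assms unfolding Cb2_def by simp
  show "continuous_on UNIV \<psi>" "continuous_on UNIV (grad \<psi>)"
    using twice_differentiableD[OF td]
    by (auto intro!: has_derivative_continuous_on simp: has_derivative_at_withinI)
qed

lemma Cb2_hessian_bound:
  assumes "\<psi> \<in> Cb2" obtains B where "0 \<le> B" "\<And>x. norm (hessian \<psi> x) \<le> B"
proof -
  obtain B where B: "\<And>x. norm (hessian \<psi> x) \<le> B"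
    using assms unfolding Cb2_def bounded_iff by auto
  then have "0 \<le> B" using norm_ge_zero order_trans by blast
  with B that show ?thesis by blast
qed

lemma Cb2_lincomb:
  assumes "\<psi> \<in> Cb2" "\<phi> \<in> Cb2"
  shows "(\<lambda>x. a * \<psi> x + b * \<phi> x) \<in> Cb2"
    and "hessian (\<lambda>x. a * \<psi> x + b * \<phi> x) x = a *\<^sub>R hessian \<psi> x + b *\<^sub>R hessian \<phi> x"
proof -
  define G where "G x = a *\<^sub>R grad \<psi> x + b *\<^sub>R grad \<phi> x" for x
  define H where "H x = a *\<^sub>R hessian \<psi> x + b *\<^sub>R hessian \<phi> x" for x
  have 1: "((\<lambda>x. a * \<psi> x + b * \<phi> x) has_derivative (\<lambda>h. G x \<bullet> h)) (at x)" for x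
  proof -
    have "((\<lambda>x. a * \<psi> x + b * \<phi> x) has_derivative (\<lambda>h. a * (grad \<psi> x \<bullet> h) + b * (grad \<phi> x \<bullet> h))) (at x)"
      by (intro has_derivative_add has_derivative_mult_right Cb2D(1) assms)
    then show ?thesis by (simp add: G_def inner_simps)
  qed
  have 2: "(G has_derivative (\<lambda>h. H x *v h)) (at x)" for x
  proof -
    have "(G has_derivative (\<lambda>h. a *\<^sub>R (hessian \<psi> x *v h) + b *\<^sub>R (hessian \<phi> x *v h))) (at x)"
      unfolding G_def by (intro has_derivative_add has_derivative_scaleR_right Cb2D(2) assms)
    then show ?thesis
      by (simp add: H_def matrix_vector_mult_add_rdistrib scaleR_matrix_vector_assoc)
  qed
  obtain B where B: "\<And>x. norm (hessian \<psi> x) \<le> B" using Cb2_hessian_bound[OF assms(1)] by blast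
  obtain C where C: "\<And>x. norm (hessian \<phi> x) \<le> C" using Cb2_hessian_bound[OF assms(2)] by blast
  have "norm (H x) \<le> \<bar>a\<bar> * B + \<bar>b\<bar> * C" for x
    unfolding H_def using B[of x] C[of x]
    by (intro order_trans[OF norm_triangle_ineq] add_mono) (simp_all add: mult_left_mono)
  moreover have "continuous_on UNIV H"
    unfolding H_def by (intro continuous_intros Cb2D assms)
  ultimately show "(\<lambda>x. a * \<psi> x + b * \<phi> x) \<in> Cb2"
    using 1 2 by (intro Cb2I[of _ G H])
  show "hessian (\<lambda>x. a * \<psi> x + b * \<phi> x) x = a *\<^sub>R hessian \<psi> x + b *\<^sub>R hessian \<phi> x"
    using hessian_eqI(3)[OF 1 2] by (simp add: H_def)
qed

text \<open>
  A bounded Hessian makes the gradient Lipschitz and \<open>\<psi>\<close> of quadratic growth. This is why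
  measures with finite second moments integrate \<open>\<psi>\<close>.
\<close>

lemma Cb2_growth:
  fixes \<psi> :: "real^'n \<Rightarrow> real"
  assumes "\<psi> \<in> Cb2"
  obtains C where "0 \<le> C" "\<And>x. norm (grad \<psi> x) \<le> C * (1 + norm x)"
    "\<And>x. \<bar>\<psi> x\<bar> \<le> C * (1 + (norm x)\<^sup>2)"
proof -
  obtain B where B: "0 \<le> B" "\<And>x. norm (hessian \<psi> x) \<le> B"
    using Cb2_hessian_bound[OF assms] by metis
  define A where "A = norm (grad \<psi> 0) + B"
  have A: "0 \<le> A" unfolding A_def using B by simp
  have g: "norm (grad \<psi> x) \<le> A * (1 + norm x)" for x
  proof -
    have "norm (grad \<psi> x - grad \<psi> 0) \<le> B * norm (x - 0)"
    proof (rule differentiable_bound)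
      show "(grad \<psi> has_derivative (\<lambda>h. hessian \<psi> y *v h)) (at y within UNIV)" for y
        using Cb2D(2)[OF assms] by simp
      show "onorm (\<lambda>h. hessian \<psi> y *v h) \<le> B" for y
        using B by (intro onorm_bound order_trans[OF norm_matrix_vector_le] mult_right_mono) auto
    qed auto
    then have "norm (grad \<psi> x) \<le> norm (grad \<psi> 0) + B * norm x"
      using norm_triangle_ineq2[of "grad \<psi> x" "grad \<psi> 0"] by simp
    also have "\<dots> \<le> A * (1 + norm x)"
      unfolding A_def using B(1) by (simp add: algebra_simps)
    finally show ?thesis .
  qed
  define C where "C = \<bar>\<psi> 0\<bar> + 2 * A"
  have "\<bar>\<psi> x\<bar> \<le> C * (1 + (norm x)\<^sup>2)" for x
  proof -
    have "norm (\<psi> x - \<psi> 0) \<le> (A * (1 + norm x)) * norm (x - 0)"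
    proof (rule differentiable_bound[where S = "cball 0 (norm x)"])
      show "(\<psi> has_derivative (\<lambda>h. grad \<psi> y \<bullet> h)) (at y within cball 0 (norm x))" for y
        using Cb2D(1)[OF assms] by (rule has_derivative_at_withinI)
      fix y :: "real^'n" assume "y \<in> cball 0 (norm x)"
      then have "norm (grad \<psi> y) \<le> A * (1 + norm x)"
        using A by (intro order_trans[OF g] mult_left_mono) auto
      then show "onorm (\<lambda>h. grad \<psi> y \<bullet> h) \<le> A * (1 + norm x)"
        using A by (intro onorm_bound order_trans[OF Cauchy_Schwarz_ineq2[of "grad \<psi> y", folded real_norm_def]] mult_right_mono) auto
    qed auto
    then have "\<bar>\<psi> x\<bar> \<le> \<bar>\<psi> 0\<bar> + A * (norm x + (norm x)\<^sup>2)"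
      by (simp add: algebra_simps power2_eq_square)
    also have "norm x + (norm x)\<^sup>2 \<le> 2 * (1 + (norm x)\<^sup>2)"
      using zero_le_power2[of "norm x - 1/2"] by (simp add: power2_eq_square algebra_simps)
    also have "\<bar>\<psi> 0\<bar> + A * (2 * (1 + (norm x)\<^sup>2)) \<le> C * (1 + (norm x)\<^sup>2)"
      unfolding C_def by (simp add: algebra_simps)
    finally show ?thesis using A by (simp add: mult_left_mono)
  qed
  moreover have "norm (grad \<psi> x) \<le> C * (1 + norm x)" for x
  proof -
    have "A \<le> C" unfolding C_def using A by simp
    then show ?thesis by (intro order_trans[OF g] mult_right_mono) auto
  qed
  moreover have "0 \<le> C" unfolding C_def using A by simp
  ultimately show ?thesis using that by blast
qed

lemma Cb2_integrable:
  fixes \<psi> :: "real^'n \<Rightarrow> real"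
  assumes "\<psi> \<in> Cb2" "\<mu> \<in> P2" shows "integrable \<mu> \<psi>"
proof -
  interpret prob_space \<mu> using assms(2) unfolding P2_def by simp
  have s: "sets \<mu> = sets borel" using assms(2) unfolding P2_def by simp
  obtain C where C: "0 \<le> C" "\<And>x. \<bar>\<psi> x\<bar> \<le> C * (1 + (norm x)\<^sup>2)" using Cb2_growth[OF assms(1)] by metis
  have "integrable \<mu> (\<lambda>x. C * (1 + (norm x)\<^sup>2))" using assms(2) unfolding P2_def by auto
  then show ?thesis
  proof (rule Bochner_Integration.integrable_bound)
    show "\<psi> \<in> borel_measurable \<mu>"
      using borel_measurable_continuous_onI[OF Cb2D(5)[OF assms(1)]] s by (simp cong: measurable_cong_sets)
    show "AE x in \<mu>. norm (\<psi> x) \<le> norm (C * (1 + (norm x)\<^sup>2))"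
      using C by (intro AE_I2) (auto intro: order_trans)
  qed
qed

lemma radial_derivatives:
  fixes x :: "real^'n"
  assumes h: "\<And>s. 0 \<le> s \<Longrightarrow> (h has_real_derivative h' s) (at s)"
    and h': "\<And>s. 0 \<le> s \<Longrightarrow> (h' has_real_derivative h'' s) (at s)"
  shows "((\<lambda>x. h (x \<bullet> x)) has_derivative (\<lambda>y. ((2 * h' (x \<bullet> x)) *\<^sub>R x) \<bullet> y)) (at x)"
    and "((\<lambda>x. (2 * h' (x \<bullet> x)) *\<^sub>R x) has_derivative
      (\<lambda>y. ((2 * h' (x \<bullet> x)) *\<^sub>R mat 1 + (4 * h'' (x \<bullet> x)) *\<^sub>R outer x x) *v y)) (at x)"
proof -
  have sq: "((\<lambda>x. x \<bullet> x) has_derivative (\<lambda>y. 2 * (x \<bullet> y))) (at x)"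
    using has_derivative_inner[OF has_derivative_ident has_derivative_ident, of x UNIV]
    by (simp add: inner_commute)
  have d: "((\<lambda>x. k (x \<bullet> x)) has_derivative (\<lambda>y. k' * (2 * (x \<bullet> y)))) (at x)"
    if "(k has_real_derivative k') (at (x \<bullet> x))" for k k'
    using has_derivative_compose[OF sq that[unfolded has_field_derivative_def]] by simp
  show "((\<lambda>x. h (x \<bullet> x)) has_derivative (\<lambda>y. ((2 * h' (x \<bullet> x)) *\<^sub>R x) \<bullet> y)) (at x)"
    by (rule has_derivative_eq_rhs[OF d[OF h]]) (auto simp: inner_simps)
  show "((\<lambda>x. (2 * h' (x \<bullet> x)) *\<^sub>R x) has_derivative
      (\<lambda>y. ((2 * h' (x \<bullet> x)) *\<^sub>R mat 1 + (4 * h'' (x \<bullet> x)) *\<^sub>R outer x x) *v y)) (at x)"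
  proof -
    have "((\<lambda>x. (2 * h' (x \<bullet> x)) *\<^sub>R x) has_derivative
      (\<lambda>y. (2 * h' (x \<bullet> x)) *\<^sub>R y + (2 * (h'' (x \<bullet> x) * (2 * (x \<bullet> y)))) *\<^sub>R x)) (at x)"
      by (intro has_derivative_scaleR has_derivative_mult_right d[OF h'] has_derivative_ident) simp
    then show ?thesis
      by (simp add: matrix_vector_mult_add_rdistrib scaleR_matrix_vector_assoc[symmetric] outer_mult_vector mult.assoc
          mult.left_commute)
  qed
qed

lemma square_norm_Cb2:
  shows "(\<lambda>x::real^'n. x \<bullet> x) \<in> Cb2" and "hessian (\<lambda>x::real^'n. x \<bullet> x) x = 2 *\<^sub>R mat 1"
proof -
  note d = radial_derivatives[of "\<lambda>s. s" "\<lambda>s. 1" "\<lambda>s. 0", simplified]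
  have 1: "((\<lambda>x::real^'n. x \<bullet> x) has_derivative (\<lambda>y. (2 *\<^sub>R x) \<bullet> y)) (at x)" for x
    using d(1)[of x] by simp
  have 2: "((\<lambda>x::real^'n. 2 *\<^sub>R x) has_derivative (\<lambda>y. (2 *\<^sub>R mat 1) *v y)) (at x)" for x
    using d(2)[of x] by simp
  show "(\<lambda>x::real^'n. x \<bullet> x) \<in> Cb2"
    by (rule Cb2I[OF 1 2, of "norm (2 *\<^sub>R mat 1 :: real^'n^'n)"]) auto
  show "hessian (\<lambda>x::real^'n. x \<bullet> x) x = 2 *\<^sub>R mat 1"
    using hessian_eqI(3)[OF 1 2] by (simp add: fun_eq_iff)
qed

text \<open>
  A convex function that is close to \<open>0\<close> near the origin and to \<open>|x|\<^sup>2\<close> near infinity: its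
  Hessian detects mass far away from the origin.
\<close>

lemma far_square:
  fixes e :: real
  assumes e: "0 < e"
  defines "\<psi> \<equiv> \<lambda>x::real^'n. e * (x \<bullet> x)\<^sup>2 / (1 + e * (x \<bullet> x))"
  defines "k \<equiv> \<lambda>x::real^'n. 1 - 1 / (1 + e * (x \<bullet> x))\<^sup>2"
  defines "l \<equiv> \<lambda>x::real^'n. 4 * e / (1 + e * (x \<bullet> x))^3"
  shows "\<psi> \<in> Cb2" "(1/2) *\<^sub>R hessian \<psi> x = k x *\<^sub>R mat 1 + l x *\<^sub>R outer x x"
proof -
  define h where "h s = e * s\<^sup>2 / (1 + e * s)" for s
  define h' where "h' s = 1 - 1 / (1 + e * s)\<^sup>2" for s
  define h'' where "h'' s = 2 * e / (1 + e * s)^3" for s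
  have pos: "0 < 1 + e * s" if "0 \<le> s" for s using that e by (simp add: add_pos_nonneg)
  have h: "(h has_real_derivative h' s) (at s)" if "0 \<le> s" for s
  proof -
    have "(h has_real_derivative (2 * e * s * (1 + e * s) - e * s\<^sup>2 * e) / (1 + e * s)\<^sup>2) (at s)"
      unfolding h_def using pos[OF that]
      by (auto intro!: derivative_eq_intros simp: power2_eq_square)
    moreover have "(2 * e * s * (1 + e * s) - e * s\<^sup>2 * e) / (1 + e * s)\<^sup>2 = h' s"
    proof -
      have "2 * e * s * (1 + e * s) - e * s\<^sup>2 * e = (1 + e * s)\<^sup>2 - 1"
        by (simp add: power2_eq_square algebra_simps)
      then show ?thesis unfolding h'_def using pos[OF that] by (simp add: diff_divide_distrib)
    qed
    ultimately show ?thesis by simp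
  qed
  have h': "(h' has_real_derivative h'' s) (at s)" if "0 \<le> s" for s
  proof -
    have "(h' has_real_derivative 0 - (0 * (1 + e * s)\<^sup>2 - 1 * (2 * (1 + e * s) * e)) / ((1 + e * s)\<^sup>2 * (1 + e * s)\<^sup>2)) (at s)"
      unfolding h'_def using pos[OF that]
      by (intro DERIV_diff DERIV_divide) (auto intro!: derivative_eq_intros)
    then have "(h' has_real_derivative (2 * (1 + e * s) * e) / ((1 + e * s)\<^sup>2)\<^sup>2) (at s)"
      by (simp add: power2_eq_square[of "(1 + e * s)\<^sup>2"])
    moreover have "(2 * u * e) / (u\<^sup>2)\<^sup>2 = 2 * e / u^3" if "u = 1 + e * s" "0 < u" for u :: real
      using that(2) by (simp add: field_simps power2_eq_square power3_eq_cube)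
    then have "(2 * (1 + e * s) * e) / ((1 + e * s)\<^sup>2)\<^sup>2 = h'' s"
      unfolding h''_def using pos[OF \<open>0 \<le> s\<close>] by blast
    ultimately show ?thesis by simp
  qed
  define H :: "real^'n \<Rightarrow> real^'n^'n" where "H x = (2 * h' (x \<bullet> x)) *\<^sub>R mat 1 + (4 * h'' (x \<bullet> x)) *\<^sub>R outer x x" for x
  have 1: "(\<psi> has_derivative (\<lambda>y. ((2 * h' (x \<bullet> x)) *\<^sub>R x) \<bullet> y)) (at x)" for x
    unfolding \<psi>_def using radial_derivatives(1)[OF h h', of x] by (simp add: h_def)
  have 2: "((\<lambda>x. (2 * h' (x \<bullet> x)) *\<^sub>R x) has_derivative (\<lambda>y. H x *v y)) (at x)" for x
    unfolding H_def using radial_derivatives(2)[OF h h', of x] by simp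
  have bound: "norm (H x) \<le> 2 * norm (mat 1 :: real^'n^'n) + 8" for x
  proof -
    let ?s = "x \<bullet> x"
    have p: "0 < 1 + e * ?s" using pos by simp
    have "1 \<le> (1 + e * ?s)\<^sup>2" using e by (simp add: one_le_power)
    then have "0 \<le> h' ?s" "h' ?s \<le> 1" unfolding h'_def using p by (auto simp: field_simps)
    moreover have "0 \<le> h'' ?s * ?s" "h'' ?s * ?s \<le> 2"
    proof -
      show "0 \<le> h'' ?s * ?s" unfolding h''_def using e p by simp
      have "e * ?s \<le> (1 + e * ?s)^1" by simp
      also have "\<dots> \<le> (1 + e * ?s)^3" using e by (intro power_increasing) auto
      finally show "h'' ?s * ?s \<le> 2" unfolding h''_def using p by (simp add: field_simps)
    qed
    moreover have "norm (H x) \<le> norm ((2 * h' ?s) *\<^sub>R (mat 1 :: real^'n^'n)) + norm ((4 * h'' ?s) *\<^sub>R outer x x)"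
      unfolding H_def by (rule norm_triangle_ineq)
    moreover have "0 \<le> h'' ?s" unfolding h''_def using e p by simp
    moreover have "h' ?s * norm (mat 1 :: real^'n^'n) \<le> 1 * norm (mat 1 :: real^'n^'n)"
      using \<open>h' ?s \<le> 1\<close> by (intro mult_right_mono) auto
    ultimately show ?thesis
      by (simp add: norm_outer power2_norm_eq_inner[symmetric] power2_eq_square[symmetric] mult.assoc abs_mult)
  qed
  have cont: "continuous_on UNIV H"
    unfolding H_def h'_def h''_def using pos
    by (intro continuous_intros continuous_on_outer) (auto simp: less_imp_neq[symmetric])
  show "\<psi> \<in> Cb2" by (rule Cb2I[OF 1 2 cont bound])
  show "(1/2) *\<^sub>R hessian \<psi> x = k x *\<^sub>R mat 1 + l x *\<^sub>R outer x x"
    unfolding hessian_eqI(3)[OF 1 2] H_def k_def l_def h'_def h''_def by (simp add: scaleR_add_right)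
qed

lemma product_derivatives:
  fixes x :: "real^'n"
  assumes "\<And>x. (\<psi> has_derivative (\<lambda>h. G x \<bullet> h)) (at x)" "\<And>x. (G has_derivative (\<lambda>h. H x *v h)) (at x)"
    and "\<And>x. (q has_derivative (\<lambda>h. G' x \<bullet> h)) (at x)" "\<And>x. (G' has_derivative (\<lambda>h. H' x *v h)) (at x)"
  shows "((\<lambda>x. \<psi> x * q x) has_derivative (\<lambda>h. (q x *\<^sub>R G x + \<psi> x *\<^sub>R G' x) \<bullet> h)) (at x)"
    and "((\<lambda>x. q x *\<^sub>R G x + \<psi> x *\<^sub>R G' x) has_derivative
      (\<lambda>h. (q x *\<^sub>R H x + outer (G x) (G' x) + outer (G' x) (G x) + \<psi> x *\<^sub>R H' x) *v h)) (at x)"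
proof -
  show "((\<lambda>x. \<psi> x * q x) has_derivative (\<lambda>h. (q x *\<^sub>R G x + \<psi> x *\<^sub>R G' x) \<bullet> h)) (at x)"
    using has_derivative_mult[OF assms(1) assms(3)] by (simp add: inner_simps algebra_simps)
  show "((\<lambda>x. q x *\<^sub>R G x + \<psi> x *\<^sub>R G' x) has_derivative
      (\<lambda>h. (q x *\<^sub>R H x + outer (G x) (G' x) + outer (G' x) (G x) + \<psi> x *\<^sub>R H' x) *v h)) (at x)"
    using has_derivative_add[OF has_derivative_scaleR[OF assms(3) assms(2)] has_derivative_scaleR[OF assms(1) assms(4)]]
    by (simp add: matrix_vector_mult_add_rdistrib scaleR_matrix_vector_assoc[symmetric] outer_mult_vector add_ac)
qed

text \<open>
  The bounds are tuned to the growth of a function with bounded Hessian: \<open>\<psi>\<close> gains a factor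
  \<open>1 + |x|\<^sup>2\<close> and its gradient a factor \<open>1 + |x|\<close>, and these are compensated uniformly in \<open>e\<close>.
  All of them come from \<open>e (1 + |x|\<^sup>2) \<le> 1 + e |x|\<^sup>2\<close>, which needs \<open>e \<le> 1\<close>.
\<close>

lemma truncation_factor:
  fixes e :: real
  assumes e: "0 < e" "e \<le> 1"
  defines "q \<equiv> \<lambda>x::real^'n. 1 / (1 + e * (x \<bullet> x))"
  defines "k \<equiv> \<lambda>x::real^'n. - 2 * e / (1 + e * (x \<bullet> x))\<^sup>2"
  defines "l \<equiv> \<lambda>x::real^'n. 8 * e\<^sup>2 / (1 + e * (x \<bullet> x))^3"
  shows "(q has_derivative (\<lambda>y. (k x *\<^sub>R x) \<bullet> y)) (at x)"
    and "((\<lambda>x. k x *\<^sub>R x) has_derivative (\<lambda>y. (k x *\<^sub>R mat 1 + l x *\<^sub>R outer x x) *v y)) (at x)"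
    and "0 \<le> q x" "q x \<le> 1" "(1 + (norm x)\<^sup>2) * q x \<le> 1 / e"
    and "(1 + norm x) * norm (k x *\<^sub>R x) \<le> 4"
    and "(1 + (norm x)\<^sup>2) * norm (k x *\<^sub>R (mat 1 :: real^'n^'n) + l x *\<^sub>R outer x x)
      \<le> 2 * norm (mat 1 :: real^'n^'n) + 8"
    and "continuous_on UNIV k" "continuous_on UNIV l"
proof -
  define h where "h s = 1 / (1 + e * s)" for s
  define h' where "h' s = - e / (1 + e * s)\<^sup>2" for s
  define h'' where "h'' s = 2 * e\<^sup>2 / (1 + e * s)^3" for s
  have pos: "0 < 1 + e * s" if "0 \<le> s" for s using that e by (simp add: add_pos_nonneg)
  have h: "(h has_real_derivative h' s) (at s)" if "0 \<le> s" for s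
    unfolding h_def h'_def using pos[OF that]
    by (auto intro!: derivative_eq_intros simp: power2_eq_square)
  have h': "(h' has_real_derivative h'' s) (at s)" if "0 \<le> s" for s
  proof -
    have "(h' has_real_derivative (0 * (1 + e * s)\<^sup>2 - (- e) * (2 * (1 + e * s) * e)) / ((1 + e * s)\<^sup>2 * (1 + e * s)\<^sup>2)) (at s)"
      unfolding h'_def using pos[OF that]
      by (intro DERIV_divide) (auto intro!: derivative_eq_intros)
    then have "(h' has_real_derivative (e * (2 * (1 + e * s) * e)) / ((1 + e * s)\<^sup>2)\<^sup>2) (at s)"
      by (simp add: power2_eq_square[of "(1 + e * s)\<^sup>2"])
    moreover have "(e * (2 * u * e)) / (u\<^sup>2)\<^sup>2 = 2 * e\<^sup>2 / u^3" if "u = 1 + e * s" "0 < u" for u :: real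
      using that(2) by (simp add: field_simps power2_eq_square power3_eq_cube)
    then have "(e * (2 * (1 + e * s) * e)) / ((1 + e * s)\<^sup>2)\<^sup>2 = h'' s"
      unfolding h''_def using pos[OF \<open>0 \<le> s\<close>] by blast
    ultimately show ?thesis by simp
  qed
  have k: "k x = 2 * h' (x \<bullet> x)" and l: "l x = 4 * h'' (x \<bullet> x)" for x
    unfolding k_def l_def h'_def h''_def by simp_all
  show "(q has_derivative (\<lambda>y. (k x *\<^sub>R x) \<bullet> y)) (at x)"
    unfolding q_def k using radial_derivatives(1)[OF h h', of x] by (simp add: h_def)
  show "((\<lambda>x. k x *\<^sub>R x) has_derivative (\<lambda>y. (k x *\<^sub>R mat 1 + l x *\<^sub>R outer x x) *v y)) (at x)"
    unfolding k l using radial_derivatives(2)[OF h h', of x] by simp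
  show "continuous_on UNIV k" "continuous_on UNIV l"
    unfolding k_def l_def using pos by (auto intro!: continuous_intros simp: less_imp_neq[symmetric])
  define r where "r = norm x"
  define u where "u = 1 + e * r\<^sup>2"
  have xx: "x \<bullet> x = r\<^sup>2" unfolding r_def by (simp add: power2_norm_eq_inner)
  have r: "0 \<le> r" and u: "1 \<le> u" unfolding r_def u_def using e by auto
  have eu: "e * (1 + r\<^sup>2) \<le> u" unfolding u_def using e by (simp add: algebra_simps)
  show "0 \<le> q x" "q x \<le> 1" unfolding q_def xx u_def[symmetric] using u by auto
  show "(1 + (norm x)\<^sup>2) * q x \<le> 1 / e"
    unfolding q_def xx u_def[symmetric] r_def[symmetric] using eu e u by (simp add: field_simps)
  have k': "\<bar>k x\<bar> = 2 * e / u\<^sup>2" unfolding k_def xx u_def[symmetric] using e u by simp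
  have l': "\<bar>l x\<bar> = 8 * e\<^sup>2 / u^3" unfolding l_def xx u_def[symmetric] using e u by simp
  have rr: "(1 + r) * r \<le> 2 * (1 + r\<^sup>2)"
    using zero_le_power2[of "r - 1/2"] by (simp add: power2_eq_square algebra_simps)
  have uu: "u \<le> u\<^sup>2" using u by (simp add: power2_eq_square)
  have "(1 + norm x) * norm (k x *\<^sub>R x) = 2 * (e * ((1 + r) * r)) / u\<^sup>2"
    by (simp add: k' r_def[symmetric])
  also have "\<dots> \<le> 2 * (e * (2 * (1 + r\<^sup>2))) / u\<^sup>2"
    using rr e by (intro divide_right_mono mult_left_mono) auto
  also have "\<dots> \<le> 4 * u\<^sup>2 / u\<^sup>2"
  proof (intro divide_right_mono)
    have "2 * (e * (2 * (1 + r\<^sup>2))) = 4 * (e * (1 + r\<^sup>2))" by simp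
    then show "2 * (e * (2 * (1 + r\<^sup>2))) \<le> 4 * u\<^sup>2" using eu uu by linarith
  qed auto
  finally show "(1 + norm x) * norm (k x *\<^sub>R x) \<le> 4" using u by simp
  have "norm (k x *\<^sub>R (mat 1 :: real^'n^'n) + l x *\<^sub>R outer x x)
      \<le> 2 * e / u\<^sup>2 * norm (mat 1 :: real^'n^'n) + 8 * e\<^sup>2 / u^3 * r\<^sup>2"
    by (rule order_trans[OF norm_triangle_ineq]) (simp add: k' l' norm_outer r_def power2_eq_square)
  then have "(1 + (norm x)\<^sup>2) * norm (k x *\<^sub>R (mat 1 :: real^'n^'n) + l x *\<^sub>R outer x x)
      \<le> (1 + r\<^sup>2) * (2 * e / u\<^sup>2 * norm (mat 1 :: real^'n^'n) + 8 * e\<^sup>2 / u^3 * r\<^sup>2)"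
    unfolding r_def[symmetric] by (intro mult_left_mono) auto
  also have "\<dots> = 2 * (e * (1 + r\<^sup>2) / u\<^sup>2) * norm (mat 1 :: real^'n^'n) + 8 * ((e * (1 + r\<^sup>2)) * (e * r\<^sup>2) / u^3)"
    by (simp add: algebra_simps power2_eq_square add_divide_distrib)
  also have "\<dots> \<le> 2 * 1 * norm (mat 1 :: real^'n^'n) + 8 * 1"
  proof (intro add_mono mult_right_mono mult_left_mono)
    show "e * (1 + r\<^sup>2) / u\<^sup>2 \<le> 1" using eu uu u by (simp add: field_simps)
    have "(e * (1 + r\<^sup>2)) * (e * r\<^sup>2) \<le> u * u"
      using eu e u by (intro mult_mono) (auto simp: u_def)
    also have "\<dots> \<le> u^3" using u by (simp add: power3_eq_cube)
    finally show "(e * (1 + r\<^sup>2)) * (e * r\<^sup>2) / u^3 \<le> 1" using u by simp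
  qed auto
  finally show "(1 + (norm x)\<^sup>2) * norm (k x *\<^sub>R (mat 1 :: real^'n^'n) + l x *\<^sub>R outer x x)
      \<le> 2 * norm (mat 1 :: real^'n^'n) + 8" by simp
qed

text \<open>
  Test functions of quadratic growth are limits of bounded ones. Dividing by \<open>1 + e |x|\<^sup>2\<close>
  costs only a bounded amount in the Hessian because \<open>\<psi>\<close> grows quadratically and its gradient
  linearly.
\<close>

lemma Cb2_truncation:
  fixes \<psi> :: "real^'n \<Rightarrow> real"
  assumes "\<psi> \<in> Cb2"
  obtains \<Psi> B where "\<And>n::nat. \<Psi> n \<in> Cb2" "\<And>n. bounded (range (\<Psi> n))"
    "\<And>n x. norm (hessian (\<Psi> n) x) \<le> B" "\<And>n x. \<bar>\<Psi> n x\<bar> \<le> \<bar>\<psi> x\<bar>"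
    "\<And>x. (\<lambda>n. \<Psi> n x) \<longlonglongrightarrow> \<psi> x" "\<And>x. (\<lambda>n. hessian (\<Psi> n) x) \<longlonglongrightarrow> hessian \<psi> x"
proof -
  obtain C where C: "0 \<le> C" "\<And>x. norm (grad \<psi> x) \<le> C * (1 + norm x)" "\<And>x. \<bar>\<psi> x\<bar> \<le> C * (1 + (norm x)\<^sup>2)"
    using Cb2_growth[OF assms] by metis
  obtain B where B: "0 \<le> B" "\<And>x. norm (hessian \<psi> x) \<le> B"
    using Cb2_hessian_bound[OF assms] by metis
  define e :: "nat \<Rightarrow> real" where "e n = 1 / real (Suc n)" for n
  have e: "0 < e n" "e n \<le> 1" for n unfolding e_def by auto
  have e0: "e \<longlonglongrightarrow> 0" unfolding e_def by (rule LIMSEQ_Suc[OF lim_1_over_n])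
  define q where "q n x = 1 / (1 + e n * (x \<bullet> x))" for n and x :: "real^'n"
  define k where "k n x = - 2 * e n / (1 + e n * (x \<bullet> x))\<^sup>2" for n and x :: "real^'n"
  define l where "l n x = 8 * (e n)\<^sup>2 / (1 + e n * (x \<bullet> x))^3" for n and x :: "real^'n"
  define K where "K n x = k n x *\<^sub>R mat 1 + l n x *\<^sub>R outer x x" for n and x :: "real^'n"
  define \<Psi> where "\<Psi> n x = \<psi> x * q n x" for n x
  have q: "(q n has_derivative (\<lambda>y. (k n x *\<^sub>R x) \<bullet> y)) (at x)"
    "((\<lambda>x. k n x *\<^sub>R x) has_derivative (\<lambda>y. K n x *v y)) (at x)"
    "0 \<le> q n x" "q n x \<le> 1" "(1 + (norm x)\<^sup>2) * q n x \<le> 1 / e n"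
    "(1 + norm x) * norm (k n x *\<^sub>R x) \<le> 4"
    "(1 + (norm x)\<^sup>2) * norm (K n x) \<le> 2 * norm (mat 1 :: real^'n^'n) + 8"
    "continuous_on UNIV (k n)" "continuous_on UNIV (l n)" for n x
    unfolding q_def[abs_def] k_def[abs_def] l_def[abs_def] K_def by (fact truncation_factor[OF e])+
  define H where "H n x = q n x *\<^sub>R hessian \<psi> x + outer (grad \<psi> x) (k n x *\<^sub>R x)
    + outer (k n x *\<^sub>R x) (grad \<psi> x) + \<psi> x *\<^sub>R K n x" for n x
  have d: "(\<Psi> n has_derivative (\<lambda>y. (q n x *\<^sub>R grad \<psi> x + \<psi> x *\<^sub>R (k n x *\<^sub>R x)) \<bullet> y)) (at x)"
    "((\<lambda>x. q n x *\<^sub>R grad \<psi> x + \<psi> x *\<^sub>R (k n x *\<^sub>R x)) has_derivative (\<lambda>y. H n x *v y)) (at x)" for n x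
    unfolding \<Psi>_def[abs_def] H_def[abs_def]
    by (fact product_derivatives[OF Cb2D(1)[OF assms] Cb2D(2)[OF assms] q(1,2)])+
  have contq: "continuous_on UNIV (q n)" for n
    using has_derivative_continuous[OF q(1)] by (intro continuous_at_imp_continuous_on) blast
  have contH: "continuous_on UNIV (H n)" for n
    unfolding H_def K_def using Cb2D[OF assms] q(8,9) contq
    by (intro continuous_intros continuous_on_outer) auto
  define D where "D = B + 8 * C + C * (2 * norm (mat 1 :: real^'n^'n) + 8)"
  have bound: "norm (H n x) \<le> D" for n x
  proof -
    have 1: "norm (q n x *\<^sub>R hessian \<psi> x) \<le> B"
      using mult_mono[OF q(4)[where n = n and x = x] B(2)[of x]] q(3)[where n = n and x = x] by simp
    have "norm (grad \<psi> x) * norm (k n x *\<^sub>R x) \<le> C * ((1 + norm x) * norm (k n x *\<^sub>R x))"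
      using mult_right_mono[OF C(2)[of x], of "norm (k n x *\<^sub>R x)"] by (simp add: mult.assoc)
    also have "\<dots> \<le> C * 4" using q(6)[where n = n and x = x] C(1) by (rule mult_left_mono)
    finally have 2: "norm (outer (grad \<psi> x) (k n x *\<^sub>R x)) \<le> C * 4" "norm (outer (k n x *\<^sub>R x) (grad \<psi> x)) \<le> C * 4"
      by (simp_all only: norm_outer mult.commute)
    have "norm (\<psi> x *\<^sub>R K n x) \<le> C * ((1 + (norm x)\<^sup>2) * norm (K n x))"
      using mult_right_mono[OF C(3)[of x], of "norm (K n x)"] by (simp add: mult.assoc)
    also have "\<dots> \<le> C * (2 * norm (mat 1 :: real^'n^'n) + 8)"
      using q(7)[where n = n and x = x] C(1) by (intro mult_left_mono)
    finally have 3: "norm (\<psi> x *\<^sub>R K n x) \<le> C * (2 * norm (mat 1 :: real^'n^'n) + 8)" .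
    have "norm (H n x) \<le> norm (q n x *\<^sub>R hessian \<psi> x) + norm (outer (grad \<psi> x) (k n x *\<^sub>R x))
      + norm (outer (k n x *\<^sub>R x) (grad \<psi> x)) + norm (\<psi> x *\<^sub>R K n x)"
      unfolding H_def by (intro norm_triangle_le add_right_mono) simp
    then show ?thesis using 1 2 3 unfolding D_def by linarith
  qed
  have P: "\<Psi> n \<in> Cb2" "hessian (\<Psi> n) = H n" for n
    using Cb2I[OF d contH bound] hessian_eqI(3)[OF d] by auto
  moreover have "bounded (range (\<Psi> n))" for n
  proof -
    have "norm (\<Psi> n x) \<le> C * (1 / e n)" for x
    proof -
      have "norm (\<Psi> n x) \<le> (C * (1 + (norm x)\<^sup>2)) * q n x"
        unfolding \<Psi>_def using C(3)[of x] q(3)[where n = n and x = x] by (simp add: abs_mult mult_right_mono)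
      also have "\<dots> \<le> C * (1 / e n)" using q(5)[where n = n and x = x] C(1) by (simp only: mult.assoc mult_left_mono)
      finally show ?thesis .
    qed
    then show ?thesis unfolding bounded_iff by auto
  qed
  moreover have "\<bar>\<Psi> n x\<bar> \<le> \<bar>\<psi> x\<bar>" for n x
    unfolding \<Psi>_def using q(3,4)[where n = n and x = x] by (simp add: abs_mult mult_left_le)
  moreover have ql: "(\<lambda>n. q n x) \<longlonglongrightarrow> 1" for x
    unfolding q_def by (rule tendsto_eq_intros refl e0 | simp)+
  moreover have "(\<lambda>n. \<Psi> n x) \<longlonglongrightarrow> \<psi> x" for x
    unfolding \<Psi>_def using tendsto_mult_left[OF ql[of x], of "\<psi> x"] by simp
  moreover have kl: "(\<lambda>n. k n x) \<longlonglongrightarrow> 0" "(\<lambda>n. l n x) \<longlonglongrightarrow> 0" for x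
    unfolding k_def l_def by (rule tendsto_eq_intros refl e0 | simp)+
  have "(\<lambda>n. H n x) \<longlonglongrightarrow> 1 *\<^sub>R hessian \<psi> x + outer (grad \<psi> x) (0 *\<^sub>R x) + outer (0 *\<^sub>R x) (grad \<psi> x)
      + \<psi> x *\<^sub>R (0 *\<^sub>R mat 1 + 0 *\<^sub>R outer x x)" for x
    unfolding H_def K_def by (intro tendsto_intros tendsto_outer ql kl)
  then have "(\<lambda>n. H n x) \<longlonglongrightarrow> hessian \<psi> x" for x by (simp add: outer_def zero_vec_def[symmetric])
  ultimately show ?thesis using that[of \<Psi> D] bound by simp
qed


section \<open>Positive semidefinite matrices\<close>

lemma inner_matrix: "(A :: real^'n^'m) \<bullet> B = (\<Sum>i\<in>UNIV. \<Sum>j\<in>UNIV. A $ i $ j * B $ i $ j)"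
  by (simp add: inner_vec_def)

lemma trace_eq_inner: "trace (M :: real^'n^'n) = mat 1 \<bullet> M"
  unfolding inner_matrix trace_def mat_def by (simp add: if_distrib if_distribR cong: if_cong)

lemma axis_matrix_axis: "axis i 1 \<bullet> ((M :: real^'n^'n) *v axis j 1) = M $ i $ j"
  by (simp add: inner_axis' matrix_vector_mult_basis column_def)

lemma sym_mats_entry: "M \<in> sym_mats \<Longrightarrow> M $ j $ i = M $ i $ j"
  unfolding sym_mats_def transpose_def by (auto simp: vec_eq_iff)

lemma sym_mats_0 [simp]: "0 \<in> sym_mats"
  unfolding sym_mats_def transpose_def by (simp add: vec_eq_iff)

lemma sym_mats_add: "A \<in> sym_mats \<Longrightarrow> B \<in> sym_mats \<Longrightarrow> A + B \<in> sym_mats"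
  unfolding sym_mats_def transpose_def by (simp add: vec_eq_iff)

lemma sym_mats_scaleR: "A \<in> sym_mats \<Longrightarrow> c *\<^sub>R A \<in> sym_mats"
  unfolding sym_mats_def transpose_def by (simp add: vec_eq_iff)

lemma closed_sym_mats: "closed (sym_mats :: (real^'n^'n) set)"
proof -
  have "sym_mats = {A :: real^'n^'n. \<forall>i j. A $ j $ i = A $ i $ j}"
    unfolding sym_mats_def transpose_def by (auto simp: vec_eq_iff)
  also have "closed \<dots>"
    by (intro closed_Collect_all closed_Collect_eq continuous_intros)
  finally show ?thesis .
qed

lemma psd_sym: "M \<in> psd_mats \<Longrightarrow> M \<in> sym_mats"
  unfolding psd_mats_def by simp

text \<open>
  Test the quadratic form with \<open>e\<^sub>i + e\<^sub>j\<close> and \<open>e\<^sub>i - e\<^sub>j\<close>. Hence the trace, which is linear,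
  controls all of a positive semidefinite matrix.
\<close>

lemma psd_entry_le_trace:
  assumes "M \<in> psd_mats" shows "\<bar>M $ i $ j\<bar> \<le> trace (M :: real^'n^'n)"
proof -
  have q: "0 \<le> x \<bullet> (M *v x)" for x using assms unfolding psd_mats_def by simp
  have diag: "0 \<le> M $ i $ i" for i using q[of "axis i 1"] by (simp add: axis_matrix_axis)
  have le: "M $ i $ i \<le> trace M" for i
    unfolding trace_def by (rule member_le_sum) (auto intro: diag)
  have s: "M $ j $ i = M $ i $ j" by (rule sym_mats_entry[OF psd_sym[OF assms]])
  have "0 \<le> (axis i 1 + axis j 1) \<bullet> (M *v (axis i 1 + axis j 1))" by (rule q)
  moreover have "0 \<le> (axis i 1 - axis j 1) \<bullet> (M *v (axis i 1 - axis j 1))" by (rule q)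
  ultimately show ?thesis
    using le[of i] le[of j] s
    by (simp add: matrix_vector_right_distrib matrix_vector_mult_diff_distrib inner_simps axis_matrix_axis abs_le_iff)
qed

lemma psd_trace_nonneg: "M \<in> psd_mats \<Longrightarrow> 0 \<le> trace (M :: real^'n^'n)"
  using psd_entry_le_trace[of M undefined undefined] by linarith

lemma norm_le_sum_entries: "norm (M :: real^'n^'m) \<le> (\<Sum>i\<in>UNIV. \<Sum>j\<in>UNIV. \<bar>M $ i $ j\<bar>)"
proof -
  have "norm M \<le> (\<Sum>i\<in>UNIV. norm (M $ i))"
    unfolding norm_vec_def[of M] by (rule L2_set_le_sum) simp
  also have "\<dots> \<le> (\<Sum>i\<in>UNIV. \<Sum>j\<in>UNIV. \<bar>M $ i $ j\<bar>)"
    by (intro sum_mono norm_le_l1_cart)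
  finally show ?thesis .
qed

lemma psd_norm_le_trace:
  assumes "M \<in> psd_mats" shows "norm (M :: real^'n^'n) \<le> real (CARD('n) * CARD('n)) * trace M"
proof -
  have "norm M \<le> (\<Sum>i\<in>UNIV. \<Sum>j\<in>UNIV. \<bar>M $ i $ j\<bar>)" by (rule norm_le_sum_entries)
  also have "\<dots> \<le> (\<Sum>i\<in>(UNIV :: 'n set). \<Sum>j\<in>(UNIV :: 'n set). trace M)"
    by (intro sum_mono psd_entry_le_trace assms)
  finally show ?thesis by (simp add: mult.assoc)
qed

section \<open>The cost function as a supremum of linear functions\<close>

text \<open>
  This is the set \<open>K\<close> where the Fenchel conjugate vanishes (see \<open>admissible_iff_conj\<close>), in a form that
  avoids extended real arithmetic.
\<close>

definition admissible :: "(real^'n^'n \<Rightarrow> ennreal) \<Rightarrow> (real^'n^'n) set" where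
  "admissible f = {A. \<forall>M\<in>dom_fun f. A \<bullet> M \<le> enn2real (f M)}"

lemma admissible_le:
  assumes "A \<in> admissible f" "M \<in> sym_mats" shows "ennreal (A \<bullet> M) \<le> f M"
proof (cases "f M < \<infinity>")
  case True
  then have "A \<bullet> M \<le> enn2real (f M)"
    using assms unfolding admissible_def dom_fun_def by blast
  then show ?thesis using True by (metis ennreal_enn2real ennreal_leI infinity_ennreal_def)
qed (simp add: top_unique not_less)

lemma convex_admissible: "convex (admissible f)"
  unfolding convex_def
proof (intro ballI allI impI)
  fix A B and u v :: real assume AB: "A \<in> admissible f" "B \<in> admissible f" and uv: "0 \<le> u" "0 \<le> v" "u + v = 1"
  show "u *\<^sub>R A + v *\<^sub>R B \<in> admissible f"
    unfolding admissible_def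
  proof (intro CollectI ballI)
    fix M assume "M \<in> dom_fun f"
    then have "u * (A \<bullet> M) + v * (B \<bullet> M) \<le> u * enn2real (f M) + v * enn2real (f M)"
      using AB uv unfolding admissible_def by (intro add_mono mult_left_mono) auto
    also have "\<dots> = enn2real (f M)" using uv(3) by (simp add: distrib_right[symmetric])
    finally show "(u *\<^sub>R A + v *\<^sub>R B) \<bullet> M \<le> enn2real (f M)" by (simp add: inner_simps)
  qed
qed

locale cost_function =
  fixes f :: "real^'n^'n \<Rightarrow> ennreal"
  assumes convex: "\<forall>A\<in>sym_mats. \<forall>B\<in>sym_mats. \<forall>u\<in>{0..1}.
      f ((1 - u) *\<^sub>R A + u *\<^sub>R B) \<le> ennreal (1 - u) * f A + ennreal u * f B"
    and homogeneous: "\<forall>A\<in>sym_mats. \<forall>t\<ge>0. f (t *\<^sub>R A) = ennreal t * f A"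
    and lsc: "\<forall>A\<in>sym_mats. f A \<le> Liminf (at A within sym_mats) f"
    and dom_psd: "dom_fun f \<subseteq> psd_mats"
begin

lemma f_0 [simp]: "f 0 = 0"
  using homogeneous[rule_format, of 0 0] by simp

lemma zero_admissible: "0 \<in> admissible f"
  unfolding admissible_def by simp

lemma admissible_iff_conj: "- fenchel_conj f A = 0 \<longleftrightarrow> A \<in> admissible f"
proof -
  have ge: "0 \<le> fenchel_conj f A"
    unfolding fenchel_conj_def by (rule SUP_upper2[of 0]) (simp_all add: zero_ereal_def[symmetric] zero_ennreal.rep_eq)
  have pt: "ereal (A \<bullet> M) - enn2ereal (f M) \<le> 0 \<longleftrightarrow> (f M < \<infinity> \<longrightarrow> A \<bullet> M \<le> enn2real (f M))" for M
  proof (cases "f M")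
    case (real r) then show ?thesis by (simp add: enn2ereal_ennreal)
  qed simp
  have "fenchel_conj f A \<le> 0 \<longleftrightarrow> A \<in> admissible f"
    unfolding fenchel_conj_def SUP_le_iff pt admissible_def dom_fun_def by blast
  moreover have "- fenchel_conj f A = 0 \<longleftrightarrow> fenchel_conj f A = 0"
    by (metis ereal_uminus_uminus ereal_uminus_zero)
  ultimately show ?thesis using ge by (metis antisym order_refl)
qed

definition epigraph :: "((real^'n^'n) \<times> real) set" where
  "epigraph = {(M, s). M \<in> sym_mats \<and> 0 \<le> s \<and> f M \<le> ennreal s}"

text \<open>
  Lower semicontinuity is given by a limit inferior over a punctured neighbourhood; the centre
  itself causes no harm because the bound is also known there.
\<close>

lemma closed_epigraph: "closed epigraph"
  unfolding closed_sequential_limits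
proof (intro allI impI, elim conjE)
  fix x :: "nat \<Rightarrow> (real^'n^'n) \<times> real" and l
  assume x: "\<forall>n. x n \<in> epigraph" and lim: "x \<longlonglongrightarrow> l"
  have fst: "(\<lambda>n. fst (x n)) \<longlonglongrightarrow> fst l" and snd: "(\<lambda>n. snd (x n)) \<longlonglongrightarrow> snd l"
    using lim by (auto intro: tendsto_intros)
  have xs: "fst (x n) \<in> sym_mats" "0 \<le> snd (x n)" "f (fst (x n)) \<le> ennreal (snd (x n))" for n
    using x[rule_format, of n] unfolding epigraph_def by (auto simp: case_prod_unfold)
  have l: "fst l \<in> sym_mats" using closed_sequentially[OF closed_sym_mats xs(1) fst] .
  have l0: "0 \<le> snd l" using LIMSEQ_le_const[OF snd] xs(2) by blast
  have "f (fst l) \<le> ennreal (snd l)"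
  proof (rule ccontr)
    assume "\<not> f (fst l) \<le> ennreal (snd l)"
    then have "ennreal (snd l) < f (fst l)" by simp
    from dense[OF this] obtain r where r: "ennreal (snd l) < r" "r < f (fst l)" by blast
    have "r < Liminf (at (fst l) within sym_mats) f" using lsc l r(2) by (blast intro: less_le_trans)
    then have "\<forall>\<^sub>F M in at (fst l) within sym_mats. r < f M" by (rule less_LiminfD)
    then have "\<forall>\<^sub>F M in nhds (fst l). M \<in> sym_mats \<longrightarrow> r < f M"
      unfolding eventually_at_filter using r(2) by (auto elim!: eventually_mono)
    then have "\<forall>\<^sub>F n in sequentially. fst (x n) \<in> sym_mats \<longrightarrow> r < f (fst (x n))"
      using fst by (rule eventually_compose_filterlim)
    then have "\<forall>\<^sub>F n in sequentially. r \<le> ennreal (snd (x n))"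
      by (rule eventually_mono) (meson xs less_imp_le order_trans)
    moreover have "(\<lambda>n. ennreal (snd (x n))) \<longlonglongrightarrow> ennreal (snd l)"
      using snd by (rule tendsto_ennrealI)
    ultimately have "r \<le> ennreal (snd l)"
      by (metis tendsto_lowerbound trivial_limit_sequentially)
    with r(1) show False by simp
  qed
  then show "l \<in> epigraph" unfolding epigraph_def using l l0 by (auto simp: case_prod_unfold)
qed

lemma epigraph_cone: "x \<in> epigraph \<Longrightarrow> 0 \<le> t \<Longrightarrow> t *\<^sub>R x \<in> epigraph"
  using homogeneous unfolding epigraph_def
  by (auto simp: sym_mats_scaleR ennreal_mult mult_left_mono)

lemma convex_epigraph: "convex epigraph"
  unfolding convex_alt
proof (intro ballI allI impI)
  fix x y and u :: real assume xy: "x \<in> epigraph" "y \<in> epigraph" and u: "0 \<le> u \<and> u \<le> 1"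
  obtain A s B t where xy': "x = (A, s)" "y = (B, t)" by fastforce
  have A: "A \<in> sym_mats" "0 \<le> s" "f A \<le> ennreal s" and B: "B \<in> sym_mats" "0 \<le> t" "f B \<le> ennreal t"
    using xy unfolding xy' epigraph_def by auto
  have "f ((1 - u) *\<^sub>R A + u *\<^sub>R B) \<le> ennreal (1 - u) * f A + ennreal u * f B"
    using convex A B u by auto
  also have "\<dots> \<le> ennreal (1 - u) * ennreal s + ennreal u * ennreal t"
    using A B by (intro add_mono mult_left_mono) auto
  also have "\<dots> = ennreal ((1 - u) * s + u * t)"
    using A B u by (simp add: ennreal_mult)
  finally show "(1 - u) *\<^sub>R x + u *\<^sub>R y \<in> epigraph"
    unfolding xy' epigraph_def using A B u by (auto intro: sym_mats_add sym_mats_scaleR)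
qed

text \<open>
  A point strictly below the epigraph is separated from it by a linear functional because the
  epigraph is a closed convex cone. If the separating functional is vertical, a large multiple
  of it is still admissible because \<open>f\<close> is nonnegative.
\<close>

lemma admissible_above:
  assumes M: "M \<in> sym_mats" and r: "0 \<le> r" "ennreal r < f M"
  obtains A where "A \<in> admissible f" "r < A \<bullet> M"
proof -
  have "(M, r) \<notin> epigraph" unfolding epigraph_def using r by (simp add: not_le)
  then obtain a b where ab: "a \<bullet> (M, r) < b" "\<And>x. x \<in> epigraph \<Longrightarrow> b < a \<bullet> x"
    using separating_hyperplane_closed_point[OF convex_epigraph closed_epigraph] by metis
  have zero: "(0, 0) \<in> epigraph" unfolding epigraph_def by simp
  have b: "b < 0" using ab(2)[OF zero] by (simp add: zero_prod_def[symmetric])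
  have cone: "0 \<le> a \<bullet> x" if "x \<in> epigraph" for x
  proof (rule ccontr)
    assume "\<not> 0 \<le> a \<bullet> x"
    then have "b < (b / (a \<bullet> x)) * (a \<bullet> x)"
      using ab(2)[OF epigraph_cone[OF that, of "b / (a \<bullet> x)"]] b by (simp add: divide_nonpos_neg less_imp_le)
    then show False using \<open>\<not> 0 \<le> a \<bullet> x\<close> by simp
  qed
  obtain B c where a: "a = (B, c)" by fastforce
  have neg: "B \<bullet> M + c * r < 0" using ab(1) b unfolding a by (simp add: inner_prod_def)
  have pos: "0 \<le> B \<bullet> N + c * enn2real (f N)" if "N \<in> dom_fun f" for N
    using cone[of "(N, enn2real (f N))"] that unfolding a epigraph_def dom_fun_def
    by (simp add: inner_prod_def)
  have "(0, 1) \<in> epigraph" unfolding epigraph_def by simp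
  then have c: "0 \<le> c" using cone unfolding a by (force simp: inner_prod_def)
  show ?thesis
  proof (cases "c = 0")
    case False
    with c have c: "0 < c" by simp
    show ?thesis
    proof (rule that[of "- (1/c) *\<^sub>R B"])
      show "- (1/c) *\<^sub>R B \<in> admissible f"
        unfolding admissible_def using pos c by (force simp: field_simps)
      show "r < (- (1/c) *\<^sub>R B) \<bullet> M" using neg c by (simp add: field_simps)
    qed
  next
    case True
    then have neg: "B \<bullet> M < 0" and pos: "\<And>N. N \<in> dom_fun f \<Longrightarrow> 0 \<le> B \<bullet> N" using neg pos by auto
    \<comment> \<open>scaled such that the value at M is r + 1\<close>
    define t where "t = (r + 1) / - (B \<bullet> M)"
    have t: "0 < t" unfolding t_def using neg r(1) by (intro divide_pos_pos) auto
    show ?thesis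
    proof (rule that[of "- t *\<^sub>R B"])
      show "- t *\<^sub>R B \<in> admissible f"
        unfolding admissible_def
      proof (intro CollectI ballI)
        fix N assume "N \<in> dom_fun f"
        then have "0 \<le> t * (B \<bullet> N)" using pos t by simp
        then show "(- t *\<^sub>R B) \<bullet> N \<le> enn2real (f N)"
          using enn2real_nonneg[of "f N"] by (simp only: inner_scaleR_left)
      qed
      have "- t * (B \<bullet> M) = r + 1" unfolding t_def using neg by (simp add: field_simps)
      then show "r < (- t *\<^sub>R B) \<bullet> M" by simp
    qed
  qed
qed

text \<open>
  By \<open>admissible_above\<close>, \<open>f\<close> is the supremum over all admissible matrices, and a countable dense subset
  gives the same supremum. Countability is needed for measurability and for the pointwise selection in
  \<open>nn_integral_SUP_le\<close>.
\<close>

lemma cost_as_supremum: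
  obtains A :: "nat \<Rightarrow> real^'n^'n" where "\<And>n. A n \<in> admissible f"
    "\<And>M. M \<in> sym_mats \<Longrightarrow> f M = (SUP n. ennreal (A n \<bullet> M))"
proof -
  obtain T where T: "countable T" "T \<subseteq> admissible f" "admissible f \<subseteq> closure T"
    using separable by metis
  have "T \<noteq> {}" using T(3) zero_admissible by auto
  then have T': "range (from_nat_into T) = T" using T(1) by (simp add: range_from_nat_into)
  show ?thesis
  proof (rule that[of "from_nat_into T"])
    show A: "from_nat_into T n \<in> admissible f" for n using T(2) T' by blast
    fix M :: "real^'n^'n" assume M: "M \<in> sym_mats"
    show "f M = (SUP n. ennreal (from_nat_into T n \<bullet> M))"
    proof (rule antisym)
      show "(SUP n. ennreal (from_nat_into T n \<bullet> M)) \<le> f M"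
        by (intro SUP_least admissible_le A M)
      show "f M \<le> (SUP n. ennreal (from_nat_into T n \<bullet> M))"
      proof (rule ccontr)
        assume "\<not> f M \<le> (SUP n. ennreal (from_nat_into T n \<bullet> M))"
        then have "(SUP n. ennreal (from_nat_into T n \<bullet> M)) < f M" by simp
        from dense[OF this] obtain s where s: "(SUP n. ennreal (from_nat_into T n \<bullet> M)) < s" "s < f M"
          by blast
        then have "s \<noteq> top" by (metis top.extremum_strict)
        then obtain r where r: "0 \<le> r" "s = ennreal r" by (cases s) auto
        obtain B where B: "B \<in> admissible f" "r < B \<bullet> M"
          using admissible_above[OF M r(1)] s(2) r(2) by auto
        have "open {C. r < C \<bullet> M}" by (intro open_Collect_less continuous_intros)
        moreover have "B \<in> closure T" using B(1) T(3) by blast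
        ultimately obtain C where "C \<in> T" "r < C \<bullet> M"
          using B(2) open_Int_closure_eq_empty[of "{C. r < C \<bullet> M}" T] by blast
        moreover obtain n where "C = from_nat_into T n" using T' \<open>C \<in> T\<close> by (metis rangeE)
        ultimately have "r < from_nat_into T n \<bullet> M" by simp
        then have "s \<le> ennreal (from_nat_into T n \<bullet> M)" unfolding r(2) by (intro ennreal_leI) simp
        also have "\<dots> \<le> (SUP n. ennreal (from_nat_into T n \<bullet> M))" by (rule SUP_upper) simp
        finally show False using s(1) by simp
      qed
    qed
  qed
qed

end


section \<open>Matrix measures with a density\<close>

lemma matrix_expansion:
  "(\<Sum>i\<in>UNIV. \<Sum>j\<in>UNIV. (M $ i $ j) *\<^sub>R axis i (axis j 1)) = (M :: real^'n^'m)"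
proof -
  have "(\<Sum>i\<in>UNIV. \<Sum>j\<in>UNIV. M $ i $ j * (axis i (axis j 1) :: real^'n^'m) $ k $ l) = M $ k $ l" for k l
  proof -
    have "M $ i $ j * (axis i (axis j 1) :: real^'n^'m) $ k $ l = (if i = k then (if j = l then M $ k $ l else 0) else 0)" for i j
      by (auto simp: axis_def)
    then have "(\<Sum>i\<in>UNIV. \<Sum>j\<in>UNIV. M $ i $ j * (axis i (axis j 1) :: real^'n^'m) $ k $ l)
      = (\<Sum>i\<in>UNIV. if i = k then (\<Sum>j\<in>UNIV. if j = l then M $ k $ l else 0) else 0)"
      by (intro sum.cong) auto
    then show ?thesis by simp
  qed
  then show ?thesis by (simp add: vec_eq_iff)
qed

lemma transpose_eq_sym: "transpose (A :: real^'n^'n) + A \<in> sym_mats"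
  unfolding sym_mats_def transpose_def by (simp add: vec_eq_iff add.commute)

lemma bounded_linear_transpose: "bounded_linear (transpose :: real^'n^'m \<Rightarrow> real^'m^'n)"
  by (intro linear_conv_bounded_linear[THEN iffD1] linearI) (auto simp: transpose_def vec_eq_iff)

lemma (in finite_measure) emeasure_less_top: "emeasure M A < top"
  using emeasure_finite[of A] by (metis infinity_ennreal_def top.not_eq_extremum)

lemma finite_density:
  assumes m: "finite_measure m" and N: "finite_measure N" "sets N = sets m"
    and ac: "\<And>E. E \<in> sets m \<Longrightarrow> emeasure m E = 0 \<Longrightarrow> emeasure N E = 0"
  obtains D where "D \<in> borel_measurable m" "\<And>x. 0 \<le> (D x :: real)" "N = density m (\<lambda>x. ennreal (D x))"
    "integrable m D" "\<And>E. E \<in> sets m \<Longrightarrow> measure N E = (LINT x:E|m. D x)"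
proof -
  interpret m: finite_measure m by fact
  interpret N: finite_measure N by fact
  have ac': "absolutely_continuous m N"
    unfolding absolutely_continuous_def null_sets_def using ac N(2) by auto
  obtain D where D: "D \<in> borel_measurable m" "AE x in m. RN_deriv m N x = ennreal (D x)" "\<And>x. 0 \<le> D x"
    using m.real_RN_deriv[OF N(1) ac' N(2)] by metis
  have "N = density m (RN_deriv m N)" using m.density_RN_deriv[OF ac' N(2)] by simp
  also have "\<dots> = density m (\<lambda>x. ennreal (D x))"
    using D by (intro density_cong) auto
  finally have NE: "N = density m (\<lambda>x. ennreal (D x))" .
  have em: "(\<integral>\<^sup>+x\<in>E. ennreal (D x) \<partial>m) = emeasure N E" if "E \<in> sets m" for E
    using that D(1) unfolding NE by (simp add: emeasure_density)
  have int: "integrable m D"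
  proof (rule integrableI_nonneg)
    have "(\<integral>\<^sup>+x. ennreal (D x) \<partial>m) = (\<integral>\<^sup>+x\<in>space m. ennreal (D x) \<partial>m)"
      by (rule nn_integral_cong) simp
    also have "\<dots> < \<infinity>" using em[OF sets.top] N.emeasure_less_top[of "space m"] by simp
    finally show "(\<integral>\<^sup>+x. ennreal (D x) \<partial>m) < \<infinity>" .
  qed (use D in auto)
  have "measure N E = (LINT x:E|m. D x)" if E: "E \<in> sets m" for E
  proof -
    have "ennreal (measure N E) = (\<integral>\<^sup>+x. ennreal (indicator E x * D x) \<partial>m)"
      using em[OF E] by (simp add: N.emeasure_eq_measure mult.commute ennreal_mult'' D(3) ennreal_indicator[symmetric])
    also have "\<dots> = ennreal (\<integral>x. indicator E x * D x \<partial>m)"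
      using integrable_real_mult_indicator[OF E int] D(3) by (intro nn_integral_eq_integral) (auto simp: mult.commute)
    finally show ?thesis
      using D(3) by (simp add: set_lebesgue_integral_def integral_nonneg)
  qed
  then show ?thesis using that D NE int by blast
qed

text \<open>
  For a matrix measure with positive semidefinite values the trace is a finite scalar measure that
  dominates every entry, so it serves as the reference measure for densities.
\<close>

definition trace_measure :: "'a measure \<Rightarrow> ('a set \<Rightarrow> real^'n^'n) \<Rightarrow> 'a measure" where
  "trace_measure M L = measure_of (space M) (sets M) (\<lambda>E. ennreal (trace (L E)))"

text \<open>
  If \<open>L = \<sigma> m\<close>, then the total variation is \<open>|\<sigma>| m\<close> and the polar density is \<open>\<sigma> / |\<sigma>|\<close>.
  Together with homogeneity of the cost this turns all integrals against \<open>L\<close> into integrals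
  with respect to \<open>m\<close>, independently of the choice of \<open>m\<close> and of the version of the polar density.
\<close>

locale density_measure =
  fixes M m :: "'a measure" and L :: "'a set \<Rightarrow> real^'n^'n" and \<sigma> :: "'a \<Rightarrow> real^'n^'n"
  assumes fin: "finite_measure m" and sets_m: "sets m = sets M" and int: "integrable m \<sigma>"
    and L: "\<And>E. E \<in> sets M \<Longrightarrow> L E = (LINT x:E|m. \<sigma> x)"
    and sym: "\<And>x. \<sigma> x \<in> sym_mats"
begin

lemma space_m: "space m = space M" using sets_m by (rule sets_eq_imp_space_eq)

definition variation :: "'a measure" where "variation = density m (\<lambda>x. ennreal (norm (\<sigma> x)))"

lemma meas [measurable]: "\<sigma> \<in> borel_measurable m" using int by simp

lemma sets_variation [simp, measurable_cong]: "sets variation = sets m" and space_variation [simp]: "space variation = space m"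
  unfolding variation_def by simp_all

lemma emeasure_variation: "E \<in> sets m \<Longrightarrow> emeasure variation E = (\<integral>\<^sup>+x\<in>E. ennreal (norm (\<sigma> x)) \<partial>m)"
  unfolding variation_def by (simp add: emeasure_density)

lemma variation_finite: "emeasure variation (space m) < \<infinity>"
proof -
  have "emeasure variation (space m) = (\<integral>\<^sup>+x. ennreal (norm (\<sigma> x)) \<partial>m)"
    by (simp add: emeasure_variation nn_integral_set_ennreal)
  then show ?thesis using int by (simp add: integrable_iff_bounded)
qed

lemma int_E: "E \<in> sets m \<Longrightarrow> integrable m (\<lambda>x. indicator E x *\<^sub>R \<sigma> x)"
  using int by (rule integrable_mult_indicator[rotated])

lemma norm_L_le: assumes "E \<in> sets m" shows "ennreal (norm (L E)) \<le> emeasure variation E"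
proof -
  have "ennreal (norm (L E)) = ennreal (norm (\<integral>x. indicator E x *\<^sub>R \<sigma> x \<partial>m))"
    using assms sets_m by (simp add: L set_lebesgue_integral_def)
  also have "\<dots> \<le> (\<integral>\<^sup>+x. ennreal (norm (indicator E x *\<^sub>R \<sigma> x)) \<partial>m)"
    by (rule integral_norm_bound_ennreal[OF int_E[OF assms]])
  also have "\<dots> = emeasure variation E"
    unfolding emeasure_variation[OF assms] by (intro nn_integral_cong) (auto simp: indicator_def)
  finally show ?thesis .
qed

text \<open>
  A countable partition into sets on which \<open>\<sigma>\<close> is nearly constant makes the sum in the total
  variation as large as the integral of \<open>|\<sigma>|\<close>.
\<close>

lemma variation_lower:
  assumes E: "E \<in> sets m" and e: "0 < e"
  obtains A :: "nat \<Rightarrow> 'a set" where "range A \<subseteq> sets m" "disjoint_family A" "(\<Union>i. A i) = E"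
    "emeasure variation E \<le> (\<Sum>i. ennreal (norm (L (A i)))) + ennreal e"
proof -
  interpret m: finite_measure m by (rule fin)
  \<comment> \<open>on each piece \<sigma> is replaced by a constant twice, with error d each time\<close>
  define d where "d = e / (2 * measure m (space m) + 1)"
  have m0: "0 < 2 * measure m (space m) + 1" using measure_nonneg[of m "space m"] by linarith
  then have d: "0 < d" unfolding d_def using e by simp
  have d2: "2 * d * measure m E \<le> e"
  proof -
    have "2 * d * measure m E \<le> 2 * d * measure m (space m)"
      using m.bounded_measure[of E] d by simp
    also have "\<dots> \<le> e" unfolding d_def using e m0 by (simp add: divide_le_eq algebra_simps)
    finally show ?thesis .
  qed
  obtain Q :: "(real^'n^'n) set" where Q: "countable Q" "UNIV \<subseteq> closure Q"
    using separable[of UNIV] by metis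
  have "Q \<noteq> {}" using Q(2) by auto
  define q where "q = from_nat_into Q"
  have rq: "range q = Q" unfolding q_def using Q(1) \<open>Q \<noteq> {}\<close> by (rule range_from_nat_into[rotated])
  define B where "B k = {x \<in> E. norm (\<sigma> x - q k) < d}" for k
  have Em: "E \<subseteq> space m" using E by (rule sets.sets_into_space)
  have B: "B k \<in> sets m" for k
  proof -
    have "B k = E \<inter> {x \<in> space m. norm (\<sigma> x - q k) < d}" unfolding B_def using Em by auto
    also have "\<dots> \<in> sets m" using E by measurable
    finally show ?thesis .
  qed
  have UB: "(\<Union>k. B k) = E"
  proof (intro subset_antisym subsetI)
    fix x assume x: "x \<in> E"
    have "\<sigma> x \<in> closure Q" using Q(2) by blast
    then obtain y where "y \<in> Q" "dist y (\<sigma> x) < d" using d unfolding closure_approachable by blast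
    then obtain k where "dist (q k) (\<sigma> x) < d" using rq by (metis rangeE)
    then show "x \<in> (\<Union>k. B k)" using x unfolding B_def by (auto simp: dist_norm norm_minus_commute)
  qed (auto simp: B_def)
  define A where "A = disjointed B"
  have rA: "range A \<subseteq> sets m" unfolding A_def using sets.range_disjointed_sets[of B] B by blast
  have A: "A k \<in> sets m" for k using rA by blast
  have dA: "disjoint_family A" unfolding A_def by (rule disjoint_family_disjointed)
  have UA: "(\<Union>k. A k) = E" unfolding A_def UN_disjointed_eq by (rule UB)
  have AB: "A k \<subseteq> B k" for k unfolding A_def by (rule disjointed_subset)
  have part: "emeasure variation (A k) \<le> ennreal (norm (L (A k))) + ennreal (2 * d) * emeasure m (A k)" for k
  proof -
    have close: "norm (\<sigma> x - q k) \<le> d" if "x \<in> A k" for x using AB[of k] that unfolding B_def by auto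
    have iq: "integrable m (\<lambda>x. indicator (A k) x *\<^sub>R q k)"
      using A[of k] m.emeasure_less_top[of "A k"]
      by (intro integrable_scaleR_left integrable_real_indicator) auto
    have "norm ((\<integral>x. indicator (A k) x *\<^sub>R \<sigma> x \<partial>m) - (\<integral>x. indicator (A k) x *\<^sub>R q k \<partial>m))
       = norm (\<integral>x. indicator (A k) x *\<^sub>R \<sigma> x - indicator (A k) x *\<^sub>R q k \<partial>m)"
      using int_E[OF A] iq by simp
    also have "\<dots> \<le> (\<integral>x. norm (indicator (A k) x *\<^sub>R \<sigma> x - indicator (A k) x *\<^sub>R q k) \<partial>m)"
      by (rule integral_norm_bound)
    also have "\<dots> \<le> (\<integral>x. indicator (A k) x * d \<partial>m)"
    proof (rule integral_mono)
      show "integrable m (\<lambda>x. norm (indicator (A k) x *\<^sub>R \<sigma> x - indicator (A k) x *\<^sub>R q k))"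
        by (intro integrable_norm Bochner_Integration.integrable_diff int_E iq A)
      show "integrable m (\<lambda>x. indicator (A k) x * d)"
        using A[of k] m.emeasure_less_top[of "A k"] by (intro integrable_mult_left integrable_real_indicator) auto
      show "norm (indicator (A k) x *\<^sub>R \<sigma> x - indicator (A k) x *\<^sub>R q k) \<le> indicator (A k) x * d" for x
        using close[of x] by (cases "x \<in> A k") auto
    qed
    also have "\<dots> = d * measure m (A k)" using A[of k] by simp
    also have "(\<integral>x. indicator (A k) x *\<^sub>R q k \<partial>m) = (\<integral>x. indicator (A k) x \<partial>m) *\<^sub>R q k"
      using A[of k] m.emeasure_less_top[of "A k"]
      by (intro integral_scaleR_left integrable_real_indicator) auto
    finally have "norm (L (A k) - measure m (A k) *\<^sub>R q k) \<le> d * measure m (A k)"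
      using A[of k] sets_m by (simp add: L set_lebesgue_integral_def)
    then have 1: "measure m (A k) * norm (q k) \<le> norm (L (A k)) + d * measure m (A k)"
      using norm_triangle_ineq2[of "measure m (A k) *\<^sub>R q k" "L (A k)"] by (simp add: norm_minus_commute)
    have "emeasure variation (A k) \<le> (\<integral>\<^sup>+x\<in>A k. ennreal (norm (q k) + d) \<partial>m)"
      unfolding emeasure_variation[OF A]
    proof (rule nn_integral_mono)
      fix x
      have "norm (\<sigma> x) \<le> norm (q k) + d" if "x \<in> A k"
        using close[OF that] norm_triangle_ineq2[of "\<sigma> x" "q k"] by linarith
      then show "ennreal (norm (\<sigma> x)) * indicator (A k) x \<le> ennreal (norm (q k) + d) * indicator (A k) x"
        by (auto simp: indicator_def intro!: ennreal_leI)
    qed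
    also have "\<dots> = ennreal ((norm (q k) + d) * measure m (A k))"
      using A[of k] d by (simp add: nn_integral_cmult_indicator m.emeasure_eq_measure ennreal_mult)
    also have "\<dots> \<le> ennreal (norm (L (A k)) + 2 * d * measure m (A k))"
      using 1 by (intro ennreal_leI) (simp add: algebra_simps)
    also have "\<dots> = ennreal (norm (L (A k))) + ennreal (2 * d) * emeasure m (A k)"
      using d by (simp add: m.emeasure_eq_measure ennreal_mult)
    finally show ?thesis .
  qed
  have "emeasure variation E = (\<Sum>k. emeasure variation (A k))"
    using suminf_emeasure[of A variation] rA dA UA by simp
  also have "\<dots> \<le> (\<Sum>k. ennreal (norm (L (A k))) + ennreal (2 * d) * emeasure m (A k))"
    by (intro suminf_le part) auto
  also have "\<dots> = (\<Sum>k. ennreal (norm (L (A k)))) + ennreal (2 * d) * (\<Sum>k. emeasure m (A k))"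
    by (subst suminf_add[symmetric]) auto
  also have "(\<Sum>k. emeasure m (A k)) = emeasure m E"
    using suminf_emeasure[of A m] rA dA UA by simp
  also have "(\<Sum>k. ennreal (norm (L (A k)))) + ennreal (2 * d) * emeasure m E
    \<le> (\<Sum>k. ennreal (norm (L (A k)))) + ennreal e"
    using d d2 by (intro add_left_mono) (simp add: m.emeasure_eq_measure ennreal_mult[symmetric] ennreal_leI)
  finally show ?thesis by (rule that[OF rA dA UA])
qed

lemma total_variation_eq: "total_variation M L = variation"
proof -
  let ?P = "\<lambda>E. {A::nat \<Rightarrow> 'a set. range A \<subseteq> sets M \<and> disjoint_family A \<and> (\<Union>i. A i) = E}"
  let ?V = "\<lambda>E. SUP A \<in> ?P E. (\<Sum>i. ennreal (norm (L (A i))))"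
  have V: "?V E = emeasure variation E" if E: "E \<in> sets m" for E
  proof (rule antisym)
    show "?V E \<le> emeasure variation E"
    proof (rule SUP_least, safe)
      fix A :: "nat \<Rightarrow> 'a set" assume A: "range A \<subseteq> sets M" "disjoint_family A" "E = (\<Union>i. A i)"
      have "(\<Sum>i. ennreal (norm (L (A i)))) \<le> (\<Sum>i. emeasure variation (A i))"
        using A(1) sets_m by (intro suminf_le norm_L_le) auto
      also have "\<dots> = emeasure variation (\<Union>i. A i)"
        using A sets_m by (intro suminf_emeasure) auto
      finally show "(\<Sum>i. ennreal (norm (L (A i)))) \<le> emeasure variation (\<Union>i. A i)" .
    qed
    show "emeasure variation E \<le> ?V E"
    proof (rule ennreal_le_epsilon)
      fix e :: real assume "0 < e"
      then obtain A :: "nat \<Rightarrow> 'a set" where A: "range A \<subseteq> sets m" "disjoint_family A" "(\<Union>i. A i) = E"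
        "emeasure variation E \<le> (\<Sum>i. ennreal (norm (L (A i)))) + ennreal e"
        using variation_lower[OF E] by metis
      have "(\<Sum>i. ennreal (norm (L (A i)))) \<le> ?V E"
        by (rule SUP_upper) (use A sets_m in auto)
      then show "emeasure variation E \<le> ?V E + ennreal e"
        using A(4) by (meson add_right_mono order_trans)
    qed
  qed
  have "total_variation M L = measure_of (space variation) (sets variation) ?V"
    unfolding total_variation_def by (simp add: sets_m space_m)
  also have "\<dots> = measure_of (space variation) (sets variation) (emeasure variation)"
    using V by (intro measure_of_eq sets.space_closed) (simp add: sets.sigma_sets_eq[of m])
  also have "\<dots> = variation" by (rule measure_of_of_measure)
  finally show ?thesis .
qed

text \<open>
  The polar density is an arbitrary choice among the densities of \<open>L\<close> with respect to \<open>|L|\<close>. That there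
  is one at all is shown by \<open>\<sigma> / |\<sigma>|\<close>, which takes the harmless value \<open>0\<close> where \<open>\<sigma> = 0\<close>.
\<close>

lemma polar_density_spec:
  defines "p \<equiv> polar_density M L"
  shows "integrable variation p" "p x \<in> sym_mats" "\<And>E. E \<in> sets M \<Longrightarrow> L E = (LINT x:E|variation. p x)"
proof -
  let ?S = "\<lambda>s. integrable variation s \<and> (\<forall>x. s x \<in> sym_mats) \<and> (\<forall>E\<in>sets M. L E = (LINT x:E|variation. s x))"
  define s where "s x = (1 / norm (\<sigma> x)) *\<^sub>R \<sigma> x" for x
  have s_m [measurable]: "s \<in> borel_measurable m" unfolding s_def by measurable
  have fin_variation: "finite_measure variation" by (rule finite_measureI) (use variation_finite in auto)
  have "integrable variation s"
    by (rule finite_measure.integrable_const_bound[OF fin_variation, of _ 1]) (auto simp: s_def)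
  moreover have "s x \<in> sym_mats" for x
    using sym[of x] unfolding s_def sym_mats_def transpose_def by (simp add: vec_eq_iff)
  moreover have "L E = (LINT x:E|variation. s x)" if E: "E \<in> sets M" for E
  proof -
    have "(LINT x:E|variation. s x) = (\<integral>x. norm (\<sigma> x) *\<^sub>R (indicator E x *\<^sub>R s x) \<partial>m)"
      unfolding variation_def set_lebesgue_integral_def using E sets_m
      by (intro integral_density) auto
    also have "\<dots> = (\<integral>x. indicator E x *\<^sub>R \<sigma> x \<partial>m)"
      by (intro Bochner_Integration.integral_cong) (auto simp: s_def)
    finally show ?thesis using L[OF E] by (simp add: set_lebesgue_integral_def)
  qed
  ultimately have "?S s" by blast
  then have "?S (SOME s. ?S s)" by (rule someI[of ?S])
  moreover have peq: "(SOME s. ?S s) = p" unfolding p_def polar_density_def total_variation_eq ..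
  ultimately have "?S p" unfolding peq by blast
  then show "integrable variation p" "p x \<in> sym_mats" "\<And>E. E \<in> sets M \<Longrightarrow> L E = (LINT x:E|variation. p x)" by auto
qed

lemma polar_measurable [measurable]: "polar_density M L \<in> borel_measurable m"
  using borel_measurable_integrable[OF polar_density_spec(1)] by (simp cong: measurable_cong_sets)

lemma polar_density_AE: "AE x in m. norm (\<sigma> x) *\<^sub>R polar_density M L x = \<sigma> x"
proof (rule sigma_finite_measure.density_unique_banach)
  show "sigma_finite_measure m" using fin by (simp add: finite_measure_def)
  let ?p = "polar_density M L"
  have "integrable (density m (\<lambda>x. ennreal (norm (\<sigma> x)))) ?p"
    using polar_density_spec(1) unfolding variation_def .
  then show ip: "integrable m (\<lambda>x. norm (\<sigma> x) *\<^sub>R ?p x)"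
    by (subst (asm) integrable_density) auto
  show "integrable m \<sigma>" by (rule int)
  fix E assume E: "E \<in> sets m"
  have "(LINT x:E|variation. ?p x) = (\<integral>x. norm (\<sigma> x) *\<^sub>R (indicator E x *\<^sub>R ?p x) \<partial>m)"
    unfolding variation_def set_lebesgue_integral_def using E by (intro integral_density) auto
  then have "(LINT x:E|m. norm (\<sigma> x) *\<^sub>R ?p x) = (LINT x:E|variation. ?p x)"
    by (simp add: set_lebesgue_integral_def mult.commute)
  also have "\<dots> = (LINT x:E|m. \<sigma> x)"
    using polar_density_spec(3)[of E] L[of E] E sets_m by simp
  finally show "(LINT x:E|m. norm (\<sigma> x) *\<^sub>R ?p x) = (LINT x:E|m. \<sigma> x)" .
qed

lemma matrix_integral_eq:
  assumes [measurable]: "A \<in> borel_measurable m"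
  shows "matrix_integral M L A = (\<integral>x. A x \<bullet> \<sigma> x \<partial>m)"
proof -
  have "matrix_integral M L A = (\<integral>x. norm (\<sigma> x) *\<^sub>R (A x \<bullet> polar_density M L x) \<partial>m)"
    unfolding matrix_integral_def total_variation_eq variation_def by (intro integral_density) auto
  also have "\<dots> = (\<integral>x. A x \<bullet> \<sigma> x \<partial>m)"
  proof (rule integral_cong_AE)
    show "AE x in m. norm (\<sigma> x) *\<^sub>R (A x \<bullet> polar_density M L x) = A x \<bullet> \<sigma> x"
      using polar_density_AE
    proof eventually_elim
      case (elim x)
      have "A x \<bullet> (norm (\<sigma> x) *\<^sub>R polar_density M L x) = A x \<bullet> \<sigma> x" unfolding elim ..
      then show ?case by simp
    qed
  qed auto
  finally show ?thesis .
qed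

text \<open>
  Homogeneity moves the density \<open>|\<sigma>|\<close> of the total variation into the argument of \<open>f\<close>.
\<close>

lemma action_eq:
  assumes f: "(\<lambda>x. f (polar_density M L x)) \<in> borel_measurable m"
    and hom: "\<And>A t. A \<in> sym_mats \<Longrightarrow> 0 \<le> t \<Longrightarrow> f (t *\<^sub>R A) = ennreal t * f A"
  shows "action f M L = (\<integral>\<^sup>+x. f (\<sigma> x) \<partial>m)"
proof -
  have "action f M L = (\<integral>\<^sup>+x. ennreal (norm (\<sigma> x)) * f (polar_density M L x) \<partial>m)"
    unfolding action_def total_variation_eq variation_def using f by (intro nn_integral_density) auto
  also have "\<dots> = (\<integral>\<^sup>+x. f (\<sigma> x) \<partial>m)"
  proof (rule nn_integral_cong_AE)
    show "AE x in m. ennreal (norm (\<sigma> x)) * f (polar_density M L x) = f (\<sigma> x)"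
      using polar_density_AE
    proof eventually_elim
      case (elim x)
      then show ?case
        using hom[OF polar_density_spec(2), of "norm (\<sigma> x)" x] by simp
    qed
  qed
  finally show ?thesis .
qed

end

text \<open>
  Every entry of a positive semidefinite matrix is at most the trace, so adding the trace to an
  entry of \<open>L\<close> gives a measure that is absolutely continuous with respect to the trace of \<open>L\<close>.
\<close>

lemma matrix_measure_has_density:
  fixes L :: "'a set \<Rightarrow> real^'n^'n"
  assumes L: "L \<in> matrix_measures M"
  obtains \<sigma> where "density_measure M (trace_measure M L) L \<sigma>"
    "\<And>E. E \<in> sets M \<Longrightarrow> measure (trace_measure M L) E = trace (L E)"
proof -
  have psd: "L E \<in> psd_mats" if "E \<in> sets M" for E using L that unfolding matrix_measures_def by blast
  have L0: "L {} = 0" using L unfolding matrix_measures_def by blast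
  have L_sums: "(\<lambda>i. L (A i)) sums L (\<Union>i. A i)" if "range A \<subseteq> sets M" "disjoint_family A" for A :: "nat \<Rightarrow> 'a set"
    using L that unfolding matrix_measures_def by blast
  define W where "W l = measure_of (space M) (sets M) (\<lambda>E. ennreal (l (L E)))" for l :: "real^'n^'n \<Rightarrow> real"
  have W: "sets (W l) = sets M" for l
    unfolding W_def using sets.sigma_sets_eq[of M] by (simp add: sets.space_closed)
  have emW: "emeasure (W l) E = ennreal (l (L E))"
    if l: "bounded_linear l" "\<And>E. E \<in> sets M \<Longrightarrow> 0 \<le> l (L E)" and E: "E \<in> sets M" for l E
    unfolding W_def
  proof (rule emeasure_measure_of_sigma)
    interpret bounded_linear l by fact
    show "positive (sets M) (\<lambda>E. ennreal (l (L E)))" unfolding positive_def by (simp add: L0 zero)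
    show "countably_additive (sets M) (\<lambda>E. ennreal (l (L E)))"
      unfolding countably_additive_def
    proof (intro allI impI)
      fix A :: "nat \<Rightarrow> 'a set" assume A: "range A \<subseteq> sets M" "disjoint_family A"
      have "(\<lambda>i. l (L (A i))) sums l (L (\<Union>i. A i))" using L_sums[OF A] by (rule sums)
      then show "(\<Sum>i. ennreal (l (L (A i)))) = ennreal (l (L (\<Union>i. A i)))"
        using A(1) l(2) by (intro suminf_ennreal_eq) auto
    qed
  qed (use E in \<open>auto simp: sets.sigma_algebra_axioms\<close>)
  have finW: "finite_measure (W l)" if l: "bounded_linear l" "\<And>E. E \<in> sets M \<Longrightarrow> 0 \<le> l (L E)" for l
    using emW[OF l, of "space M"] sets_eq_imp_space_eq[OF W] by (intro finite_measureI) simp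
  have bl_tr: "bounded_linear (trace :: real^'n^'n \<Rightarrow> real)"
    by (intro linear_conv_bounded_linear[THEN iffD1] linearI)
      (auto simp: trace_def sum.distrib sum_distrib_left)
  have tr0: "0 \<le> trace (L E)" if "E \<in> sets M" for E using psd_trace_nonneg[OF psd[OF that]] .
  define m where "m = W trace"
  have em: "emeasure m E = ennreal (trace (L E))" if "E \<in> sets M" for E
    unfolding m_def by (rule emW[OF bl_tr _ that]) (rule tr0)
  have fin: "finite_measure m" unfolding m_def by (rule finW[OF bl_tr]) (rule tr0)
  interpret m: finite_measure m by (rule fin)
  have sm: "sets m = sets M" unfolding m_def by (rule W)
  have mm: "measure m E = trace (L E)" if "E \<in> sets M" for E
    using em[OF that] tr0[OF that] by (simp add: m.emeasure_eq_measure)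
  define l where "l i j A = trace A + A $ i $ j" for i j and A :: "real^'n^'n"
  have bl: "bounded_linear (l i j)" for i j
    unfolding l_def by (intro linear_conv_bounded_linear[THEN iffD1] linearI)
      (auto simp: trace_def sum.distrib sum_distrib_left algebra_simps)
  have l0: "0 \<le> l i j (L E)" if "E \<in> sets M" for i j E
    using psd_entry_le_trace[OF psd[OF that], of i j] unfolding l_def by linarith
  have eml: "emeasure (W (l i j)) E = ennreal (l i j (L E))" if "E \<in> sets M" for E i j
    by (rule emW[OF bl _ that]) (rule l0)
  have finl: "finite_measure (W (l i j))" for i j by (rule finW[OF bl]) (rule l0)
  have ac: "emeasure (W (l i j)) E = 0" if "E \<in> sets m" "emeasure m E = 0" for E i j
  proof -
    have E: "E \<in> sets M" using that sm by simp
    have "trace (L E) = 0" using that(2) em[OF E] tr0[OF E] by simp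
    then show ?thesis
      using psd_entry_le_trace[OF psd[OF E], of i j] eml[OF E] by (simp add: l_def)
  qed
  have "\<exists>D. integrable m D \<and> (\<forall>E\<in>sets m. measure (W (l i j)) E = (LINT x:E|m. D x))" for i j
    by (rule finite_density[OF fin finl _ ac]) (auto simp: W sm)
  then obtain D where D: "\<And>i j. integrable m (D i j)"
    "\<And>i j E. E \<in> sets m \<Longrightarrow> measure (W (l i j)) E = (LINT x:E|m. D i j x)"
    by metis
  \<comment> \<open>subtracting 1 removes the trace that was added to make the entries nonnegative\<close>
  define \<sigma>' :: "'a \<Rightarrow> real^'n^'n" where "\<sigma>' x = (\<Sum>i\<in>UNIV. \<Sum>j\<in>UNIV. (D i j x - 1) *\<^sub>R axis i (axis j 1))" for x
  have i\<sigma>': "integrable m \<sigma>'" unfolding \<sigma>'_def using D(1) by simp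
  have D': "(LINT x:E|m. D i j x - 1) = L E $ i $ j" if E: "E \<in> sets M" for E i j
  proof -
    have si: "set_integrable m E (D i j)" "set_integrable m E (\<lambda>x. 1 :: real)"
      unfolding set_integrable_def using E sm D(1)
      by (auto intro!: integrable_mult_indicator simp del: real_scaleR_def)
    have "(LINT x:E|m. D i j x - 1) = (LINT x:E|m. D i j x) - (LINT x:E|m. 1)"
      using si by (rule set_integral_diff)
    also have "\<dots> = measure (W (l i j)) E - measure m E"
      using E sm D(2)[of E i j] by (simp add: set_lebesgue_integral_def)
    also have "measure (W (l i j)) E = l i j (L E)"
      using eml[OF E] l0[OF E] by (simp add: measure_def)
    finally show ?thesis using mm[OF E] by (simp add: l_def)
  qed
  have L\<sigma>': "(LINT x:E|m. \<sigma>' x) = L E" if E: "E \<in> sets M" for E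
  proof -
    have i1: "integrable m (\<lambda>x. indicator E x * (D i j x - 1))" for i j
      using E sm D(1) integrable_mult_indicator[of E m "\<lambda>x. D i j x - 1"] by simp
    have "(LINT x:E|m. \<sigma>' x)
      = (\<integral>x. (\<Sum>i\<in>UNIV. \<Sum>j\<in>UNIV. (indicator E x * (D i j x - 1)) *\<^sub>R axis i (axis j 1)) \<partial>m)"
      unfolding set_lebesgue_integral_def \<sigma>'_def by (simp add: scaleR_sum_right)
    also have "\<dots> = (\<Sum>i\<in>UNIV. \<Sum>j\<in>UNIV. (\<integral>x. indicator E x * (D i j x - 1) \<partial>m) *\<^sub>R axis i (axis j 1))"
      using i1 by (simp add: Bochner_Integration.integral_sum)
    also have "\<dots> = L E"
      using D'[OF E] by (simp add: set_lebesgue_integral_def matrix_expansion)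
    finally show ?thesis .
  qed
  \<comment> \<open>\<sigma>' is symmetric only almost everywhere; symmetrising makes it so at every point\<close>
  define \<sigma> where "\<sigma> x = (1/2) *\<^sub>R (transpose (\<sigma>' x) + \<sigma>' x)" for x
  have it: "integrable m (\<lambda>x. transpose (\<sigma>' x))"
    using i\<sigma>' by (rule integrable_bounded_linear[OF bounded_linear_transpose])
  have "density_measure M m L \<sigma>"
  proof
    show "integrable m \<sigma>" unfolding \<sigma>_def using i\<sigma>' it by simp
    show "\<sigma> x \<in> sym_mats" for x unfolding \<sigma>_def by (intro sym_mats_scaleR transpose_eq_sym)
    fix E assume E: "E \<in> sets M"
    have 1: "integrable m (\<lambda>x. indicator E x *\<^sub>R \<sigma>' x)" using E sm i\<sigma>' by (intro integrable_mult_indicator) auto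
    have 2: "integrable m (\<lambda>x. indicator E x *\<^sub>R transpose (\<sigma>' x))" using E sm it by (intro integrable_mult_indicator) auto
    have "(\<integral>x. indicator E x *\<^sub>R transpose (\<sigma>' x) \<partial>m) = (\<integral>x. transpose (indicator E x *\<^sub>R \<sigma>' x) \<partial>m)"
      by (intro Bochner_Integration.integral_cong) (auto simp: transpose_def vec_eq_iff)
    also have "\<dots> = transpose (\<integral>x. indicator E x *\<^sub>R \<sigma>' x \<partial>m)"
      using 1 by (rule integral_bounded_linear[OF bounded_linear_transpose])
    also have "\<dots> = L E"
      using L\<sigma>'[OF E] psd_sym[OF psd[OF E]] by (simp add: set_lebesgue_integral_def sym_mats_def)
    finally have 3: "(\<integral>x. indicator E x *\<^sub>R transpose (\<sigma>' x) \<partial>m) = L E" .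
    have "(LINT x:E|m. \<sigma> x) = (\<integral>x. (1/2) *\<^sub>R (indicator E x *\<^sub>R transpose (\<sigma>' x) + indicator E x *\<^sub>R \<sigma>' x) \<partial>m)"
      unfolding set_lebesgue_integral_def \<sigma>_def by (simp add: scaleR_add_right mult.commute)
    also have "\<dots> = (1/2) *\<^sub>R (L E + L E)"
      using 1 2 3 L\<sigma>'[OF E] by (simp add: set_lebesgue_integral_def)
    finally show "L E = (LINT x:E|m. \<sigma> x)" by (simp add: scaleR_2[symmetric])
  qed (auto simp: sm fin)
  moreover have "m = trace_measure M L" unfolding m_def W_def trace_measure_def ..
  ultimately show ?thesis using that mm by blast
qed


section \<open>The dual functional\<close>

abbreviation feasible :: "(real^'n^'n \<Rightarrow> ennreal) \<Rightarrow> (real^'n \<Rightarrow> real) \<Rightarrow> bool" where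
  "feasible f \<psi> \<equiv> \<psi> \<in> Cb2 \<and> (\<forall>x. (1/2) *\<^sub>R hessian \<psi> x \<in> admissible f)"

definition gain :: "(real^'n) measure \<Rightarrow> (real^'n) measure \<Rightarrow> (real^'n \<Rightarrow> real) \<Rightarrow> real" where
  "gain \<mu> \<nu> \<psi> = (LINT x|\<nu>. \<psi> x) - (LINT x|\<mu>. \<psi> x)"

lemma gain_lincomb:
  assumes "\<mu> \<in> P2" "\<nu> \<in> P2" "\<psi> \<in> Cb2" "\<phi> \<in> Cb2"
  shows "gain \<mu> \<nu> (\<lambda>x. a * \<psi> x + b * \<phi> x) = a * gain \<mu> \<nu> \<psi> + b * gain \<mu> \<nu> \<phi>"
  using Cb2_integrable[OF assms(3) assms(1)] Cb2_integrable[OF assms(3) assms(2)]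
    Cb2_integrable[OF assms(4) assms(1)] Cb2_integrable[OF assms(4) assms(2)]
  unfolding gain_def by (simp add: algebra_simps)

lemma Cb2_zero: "(\<lambda>x::real^'n. 0) \<in> Cb2" "hessian (\<lambda>x::real^'n. 0) x = 0"
  using Cb2_lincomb[OF square_norm_Cb2(1) square_norm_Cb2(1), of 0 0] by simp_all

lemma Cb2_cmult:
  assumes "\<psi> \<in> Cb2"
  shows "(\<lambda>x. a * \<psi> x) \<in> Cb2" "hessian (\<lambda>x. a * \<psi> x) x = a *\<^sub>R hessian \<psi> x"
  using Cb2_lincomb[OF assms assms, of a 0] by simp_all

lemma bcont_hessian:
  fixes \<psi> :: "real^'n \<Rightarrow> real"
  assumes "\<psi> \<in> Cb2" shows "bcont (\<lambda>x. (1/2) *\<^sub>R hessian \<psi> x)"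
proof -
  obtain B where B: "\<And>x. norm (hessian \<psi> x) \<le> B" using Cb2_hessian_bound[OF assms] by blast
  show ?thesis by (intro bcont_scaleR bcont_const bcontI[OF Cb2D(3)[OF assms] B])
qed

text \<open>
  Here \<open>S\<close> is any upper bound of the gains of feasible functions. In the main argument it is their
  supremum.
\<close>

locale dual_bound = cost_function +
  fixes \<mu> \<nu> :: "(real^'a) measure" and S :: real
  assumes mu: "\<mu> \<in> P2" and nu: "\<nu> \<in> P2"
    and bound: "feasible f \<psi> \<Longrightarrow> gain \<mu> \<nu> \<psi> \<le> S"
begin

lemma gain_cmult: "\<psi> \<in> Cb2 \<Longrightarrow> gain \<mu> \<nu> (\<lambda>x. a * \<psi> x) = a * gain \<mu> \<nu> \<psi>"
  using gain_lincomb[OF mu nu, of \<psi> \<psi> a 0] by simp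

lemma gain_zero [simp]: "gain \<mu> \<nu> (\<lambda>x. 0) = 0"
  unfolding gain_def by simp

lemma S_nonneg: "0 \<le> S"
  using bound[of "\<lambda>x. 0"] by (simp add: Cb2_zero zero_admissible)

text \<open>
  The sublinear functional that is fed into the Hahn-Banach theorem is \<open>p \<Phi> = Inf (bounds \<Phi>)\<close>, the
  infimum of \<open>s S + gain \<psi>\<close> over all \<open>s > 0\<close> and \<open>\<psi>\<close> with \<open>\<Phi> - (1/2) \<nabla>\<^sup>2\<psi>\<close> in \<open>s K\<close>. A linear functional
  with \<open>l = gain\<close> on Hessians and \<open>l \<le> S\<close> on \<open>K\<close> cannot be larger than \<open>p\<close>. The type of bounded continuous
  functions provides the vector space.
\<close>

definition above :: "real \<Rightarrow> (real^'a \<Rightarrow> real) \<Rightarrow> ((real^'a) \<Rightarrow>\<^sub>C (real^'a^'a)) \<Rightarrow> bool" where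
  "above s \<psi> \<Phi> \<longleftrightarrow> 0 < s \<and> \<psi> \<in> Cb2 \<and>
     (\<forall>x. \<forall>M\<in>dom_fun f. (\<Phi> x - (1/2) *\<^sub>R hessian \<psi> x) \<bullet> M \<le> s * enn2real (f M))"

definition bounds :: "((real^'a) \<Rightarrow>\<^sub>C (real^'a^'a)) \<Rightarrow> real set" where
  "bounds \<Phi> = {s * S + gain \<mu> \<nu> \<psi> | s \<psi>. above s \<psi> \<Phi>}"

lemma above_add:
  assumes "above s \<psi> \<Phi>" "above s' \<psi>' \<Phi>'"
  shows "above (s + s') (\<lambda>x. 1 * \<psi> x + 1 * \<psi>' x) (\<Phi> + \<Phi>')"
proof -
  have \<psi>: "\<psi> \<in> Cb2" "\<psi>' \<in> Cb2" using assms unfolding above_def by auto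
  show ?thesis
    unfolding above_def Cb2_lincomb(2)[OF \<psi>]
  proof (intro conjI allI ballI Cb2_lincomb \<psi>)
    fix x M assume M: "M \<in> dom_fun f"
    have "(\<Phi> x - (1/2) *\<^sub>R hessian \<psi> x) \<bullet> M + (\<Phi>' x - (1/2) *\<^sub>R hessian \<psi>' x) \<bullet> M
      \<le> s * enn2real (f M) + s' * enn2real (f M)"
      using assms M unfolding above_def by (intro add_mono) auto
    then show "((\<Phi> + \<Phi>') x - (1/2) *\<^sub>R (1 *\<^sub>R hessian \<psi> x + 1 *\<^sub>R hessian \<psi>' x)) \<bullet> M \<le> (s + s') * enn2real (f M)"
      by (simp add: plus_bcontfun.rep_eq algebra_simps inner_simps)
  qed (use assms in \<open>auto simp: above_def\<close>)
qed

lemma above_scale: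
  assumes "above s \<psi> \<Phi>" "0 < c"
  shows "above (c * s) (\<lambda>x. c * \<psi> x) (c *\<^sub>R \<Phi>)"
proof -
  have \<psi>: "\<psi> \<in> Cb2" using assms unfolding above_def by auto
  show ?thesis
    unfolding above_def Cb2_cmult(2)[OF \<psi>]
  proof (intro conjI allI ballI Cb2_cmult \<psi>)
    fix x M assume M: "M \<in> dom_fun f"
    have "c * ((\<Phi> x - (1/2) *\<^sub>R hessian \<psi> x) \<bullet> M) \<le> c * (s * enn2real (f M))"
      using assms M unfolding above_def by (intro mult_left_mono) auto
    then show "((c *\<^sub>R \<Phi>) x - (1/2) *\<^sub>R (c *\<^sub>R hessian \<psi> x)) \<bullet> M \<le> (c * s) * enn2real (f M)"
      by (simp add: scaleR_bcontfun.rep_eq algebra_simps inner_simps)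
  qed (use assms in \<open>auto simp: above_def\<close>)
qed

text \<open>
  If \<open>- (1/2) \<nabla>\<^sup>2\<psi>\<close> lies in \<open>s K\<close>, then \<open>- \<psi> / s\<close> is feasible. Here the bound on the gains enters; it keeps
  \<open>p\<close> finite.
\<close>

lemma above_zero: assumes "above s \<psi> 0" shows "0 \<le> s * S + gain \<mu> \<nu> \<psi>"
proof -
  have s: "0 < s" and \<psi>: "\<psi> \<in> Cb2" using assms unfolding above_def by auto
  have "feasible f (\<lambda>x. (- 1 / s) * \<psi> x)"
    unfolding Cb2_cmult(2)[OF \<psi>] admissible_def
  proof (intro conjI allI CollectI ballI Cb2_cmult \<psi>)
    fix x M assume "M \<in> dom_fun f"
    then have "((1/2) *\<^sub>R - hessian \<psi> x) \<bullet> M \<le> s * enn2real (f M)"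
      using assms unfolding above_def by (auto simp: zero_bcontfun.rep_eq)
    then show "((1/2) *\<^sub>R (- 1 / s) *\<^sub>R hessian \<psi> x) \<bullet> M \<le> enn2real (f M)"
      using s by (simp add: field_simps)
  qed
  then have "(- 1 / s) * gain \<mu> \<nu> \<psi> \<le> S"
    using bound gain_cmult[OF \<psi>, of "- 1 / s"] by metis
  then show ?thesis using s by (simp add: field_simps)
qed

text \<open>
  Multiples of \<open>|x|\<^sup>2\<close> dominate every bounded matrix field, because \<open>f\<close> is finite only on positive
  semidefinite matrices and these are bounded by their trace.
\<close>

lemma above_exists: obtains s \<psi> where "above s \<psi> \<Phi>"
proof -
  define C where "C = real (CARD('a) * CARD('a)) * norm \<Phi>"
  have "above 1 (\<lambda>x. C * (x \<bullet> x)) \<Phi>"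
    unfolding above_def Cb2_cmult(2)[OF square_norm_Cb2(1)] square_norm_Cb2(2)
  proof (intro conjI allI ballI Cb2_cmult square_norm_Cb2)
    fix x M assume M: "M \<in> dom_fun f"
    then have psd: "M \<in> psd_mats" using dom_psd by blast
    have "\<Phi> x \<bullet> M \<le> norm (\<Phi> x) * norm M" by (rule norm_cauchy_schwarz)
    also have "\<dots> \<le> norm \<Phi> * (real (CARD('a) * CARD('a)) * trace M)"
      using psd_norm_le_trace[OF psd] by (intro mult_mono norm_bounded) auto
    also have "\<dots> = C * (mat 1 \<bullet> M)" unfolding C_def by (simp add: trace_eq_inner)
    finally have "(\<Phi> x - (1/2) *\<^sub>R C *\<^sub>R 2 *\<^sub>R mat 1) \<bullet> M \<le> 0"
      by (simp add: inner_diff_left)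
    also have "0 \<le> 1 * enn2real (f M)" by simp
    finally show "(\<Phi> x - (1/2) *\<^sub>R C *\<^sub>R 2 *\<^sub>R mat 1) \<bullet> M \<le> 1 * enn2real (f M)" .
  qed simp
  then show ?thesis by (rule that)
qed

lemma bounds_nonempty: "bounds \<Phi> \<noteq> {}"
  using above_exists[of \<Phi>] unfolding bounds_def by blast

lemma bdd_below_bounds: "bdd_below (bounds \<Phi>)"
proof -
  \<comment> \<open>a bound for \<Phi> and one for - \<Phi> add up to a bound for 0\<close>
  obtain s0 \<psi>0 where 0: "above s0 \<psi>0 (- \<Phi>)" by (rule above_exists)
  have "- (s0 * S + gain \<mu> \<nu> \<psi>0) \<le> a" if a: "a \<in> bounds \<Phi>" for a
  proof -
    obtain s \<psi> where s: "above s \<psi> \<Phi>" "a = s * S + gain \<mu> \<nu> \<psi>" using a unfolding bounds_def by blast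
    have \<psi>: "\<psi> \<in> Cb2" "\<psi>0 \<in> Cb2" using s 0 unfolding above_def by auto
    have "above (s + s0) (\<lambda>x. 1 * \<psi> x + 1 * \<psi>0 x) 0" using above_add[OF s(1) 0] by simp
    from above_zero[OF this] show ?thesis
      unfolding gain_lincomb[OF mu nu \<psi>] s(2) by (simp add: algebra_simps)
  qed
  then show ?thesis by (rule bdd_belowI)
qed

lemma Inf_bounds_le: "above s \<psi> \<Phi> \<Longrightarrow> Inf (bounds \<Phi>) \<le> s * S + gain \<mu> \<nu> \<psi>"
  by (rule cInf_lower[OF _ bdd_below_bounds]) (auto simp: bounds_def)

lemma sublinear_bounds: "sublinear (\<lambda>\<Phi>. Inf (bounds \<Phi>))"
  unfolding sublinear_def
proof (intro conjI allI impI)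
  fix \<Phi> \<Phi>'
  have key: "Inf (bounds (\<Phi> + \<Phi>')) \<le> a + b" if "a \<in> bounds \<Phi>" "b \<in> bounds \<Phi>'" for a b
  proof -
    obtain s \<psi> s' \<psi>' where *: "above s \<psi> \<Phi>" "a = s * S + gain \<mu> \<nu> \<psi>" "above s' \<psi>' \<Phi>'" "b = s' * S + gain \<mu> \<nu> \<psi>'"
      using \<open>a \<in> bounds \<Phi>\<close> \<open>b \<in> bounds \<Phi>'\<close> unfolding bounds_def by blast
    then have \<psi>: "\<psi> \<in> Cb2" "\<psi>' \<in> Cb2" unfolding above_def by auto
    show ?thesis
      using Inf_bounds_le[OF above_add[OF *(1) *(3)]] unfolding *(2,4) gain_lincomb[OF mu nu \<psi>]
      by (simp add: algebra_simps)
  qed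
  have "Inf (bounds (\<Phi> + \<Phi>')) - a \<le> Inf (bounds \<Phi>')" if "a \<in> bounds \<Phi>" for a
    using key[OF that] by (intro cInf_greatest bounds_nonempty) (simp add: algebra_simps)
  then have "Inf (bounds (\<Phi> + \<Phi>')) - Inf (bounds \<Phi>') \<le> Inf (bounds \<Phi>)"
    by (intro cInf_greatest bounds_nonempty) (simp add: algebra_simps)
  then show "Inf (bounds (\<Phi> + \<Phi>')) \<le> Inf (bounds \<Phi>) + Inf (bounds \<Phi>')" by linarith
next
  have le: "Inf (bounds (c *\<^sub>R \<Phi>)) \<le> c * Inf (bounds \<Phi>)" if c: "0 < c" for c \<Phi>
  proof -
    have "Inf (bounds (c *\<^sub>R \<Phi>)) / c \<le> a" if a: "a \<in> bounds \<Phi>" for a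
    proof -
      obtain s \<psi> where s: "above s \<psi> \<Phi>" "a = s * S + gain \<mu> \<nu> \<psi>" using a unfolding bounds_def by blast
      then have "\<psi> \<in> Cb2" unfolding above_def by auto
      then have "Inf (bounds (c *\<^sub>R \<Phi>)) \<le> c * a"
        using Inf_bounds_le[OF above_scale[OF s(1) c]] s(2) by (simp add: gain_cmult algebra_simps)
      then show ?thesis using c by (simp add: divide_le_eq mult.commute)
    qed
    then have "Inf (bounds (c *\<^sub>R \<Phi>)) / c \<le> Inf (bounds \<Phi>)"
      by (rule cInf_greatest[OF bounds_nonempty])
    then show ?thesis using c by (simp add: divide_le_eq mult.commute)
  qed
  fix c :: real and \<Phi> assume c: "0 < c"
  have "Inf (bounds ((1/c) *\<^sub>R (c *\<^sub>R \<Phi>))) \<le> (1/c) * Inf (bounds (c *\<^sub>R \<Phi>))"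
    using c by (intro le) simp
  then have "c * Inf (bounds \<Phi>) \<le> Inf (bounds (c *\<^sub>R \<Phi>))" using c by (simp add: field_simps)
  with le[OF c, of \<Phi>] show "Inf (bounds (c *\<^sub>R \<Phi>)) = c * Inf (bounds \<Phi>)" by linarith
qed

text \<open>
  Every linear functional below \<open>p\<close> has the required properties. On Hessians it is at most the gain, because
  \<open>s\<close> can be taken arbitrarily small, and replacing \<open>\<psi>\<close> by \<open>- \<psi>\<close> gives equality; the choice \<open>s = 1\<close>, \<open>\<psi> = 0\<close> bounds
  it by \<open>S\<close> on \<open>K\<close>-valued fields; and \<open>\<psi> = 0\<close> with small \<open>s\<close> makes it nonpositive on fields that pair
  nonpositively with the domain of \<open>f\<close>. The result speaks of plain functions, of which only
  the bounded continuous ones matter, to fit the Riesz theorem.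
\<close>

lemma extended_functional:
  obtains l :: "(real^'a \<Rightarrow> real^'a^'a) \<Rightarrow> real" where
    "\<And>\<Phi> \<Psi>. bcont \<Phi> \<Longrightarrow> bcont \<Psi> \<Longrightarrow> l (\<lambda>x. \<Phi> x + \<Psi> x) = l \<Phi> + l \<Psi>"
    "\<And>c \<Phi>. bcont \<Phi> \<Longrightarrow> l (\<lambda>x. c *\<^sub>R \<Phi> x) = c * l \<Phi>"
    "\<And>\<psi>. \<psi> \<in> Cb2 \<Longrightarrow> l (\<lambda>x. (1/2) *\<^sub>R hessian \<psi> x) = gain \<mu> \<nu> \<psi>"
    "\<And>\<Phi>. bcont \<Phi> \<Longrightarrow> (\<And>x. \<Phi> x \<in> admissible f) \<Longrightarrow> l \<Phi> \<le> S"
    "\<And>\<Phi>. bcont \<Phi> \<Longrightarrow> (\<And>x M. M \<in> dom_fun f \<Longrightarrow> 0 \<le> \<Phi> x \<bullet> M) \<Longrightarrow> 0 \<le> l \<Phi>"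
proof -
  obtain L where lin: "linear L" and le: "\<And>\<Phi>. L \<Phi> \<le> Inf (bounds \<Phi>)"
    using Hahn_Banach_dominated[OF sublinear_bounds] by blast
  define l where "l \<Phi> = L (Bcontfun \<Phi>)" for \<Phi>
  have inv: "apply_bcontfun (Bcontfun \<Phi>) = \<Phi>" if "bcont \<Phi>" for \<Phi> :: "real^'a \<Rightarrow> real^'a^'a"
    using that by (intro Bcontfun_inverse) (simp add: bcontfun_def bcont_def)
  have scale: "l (\<lambda>x. c *\<^sub>R \<Phi> x) = c * l \<Phi>" if \<Phi>: "bcont \<Phi>" for c \<Phi>
  proof -
    have "bcont (\<lambda>x. c *\<^sub>R \<Phi> x)" using \<Phi> by (intro bcont_scaleR bcont_const)
    then have "Bcontfun (\<lambda>x. c *\<^sub>R \<Phi> x) = c *\<^sub>R Bcontfun \<Phi>"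
      using \<Phi> by (intro bcontfun_eqI) (simp add: inv scaleR_bcontfun.rep_eq)
    then show ?thesis unfolding l_def using lin by (simp add: linear_scale)
  qed
  have neg: "l \<Phi> \<le> 0" if \<Phi>: "bcont \<Phi>" "\<And>x M. M \<in> dom_fun f \<Longrightarrow> \<Phi> x \<bullet> M \<le> 0" for \<Phi>
  proof (rule field_le_epsilon)
    fix e :: real assume e: "0 < e"
    define s where "s = e / (S + 1)"
    have s: "0 < s" "s * S \<le> e" unfolding s_def using e S_nonneg by (auto simp: field_simps)
    have "above s (\<lambda>x. 0) (Bcontfun \<Phi>)"
      unfolding above_def inv[OF \<Phi>(1)]
    proof (intro conjI allI ballI s(1) Cb2_zero)
      fix x M assume "M \<in> dom_fun f"
      then have "\<Phi> x \<bullet> M \<le> 0" by (rule \<Phi>(2))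
      also have "0 \<le> s * enn2real (f M)" using s(1) by simp
      finally show "(\<Phi> x - (1/2) *\<^sub>R hessian (\<lambda>x. 0) x) \<bullet> M \<le> s * enn2real (f M)"
        by (simp add: Cb2_zero)
    qed
    from order_trans[OF le Inf_bounds_le[OF this]] show "l \<Phi> \<le> 0 + e"
      using s unfolding l_def by simp
  qed
  have hess_le: "l (\<lambda>x. (1/2) *\<^sub>R hessian \<psi> x) \<le> gain \<mu> \<nu> \<psi>" if \<psi>: "\<psi> \<in> Cb2" for \<psi>
  proof (rule field_le_epsilon)
    fix e :: real assume e: "0 < e"
    define s where "s = e / (S + 1)"
    have s: "0 < s" "s * S \<le> e" unfolding s_def using e S_nonneg by (auto simp: field_simps)
    have bc: "bcont (\<lambda>x. (1/2) *\<^sub>R hessian \<psi> x)" by (rule bcont_hessian[OF \<psi>])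
    have "above s \<psi> (Bcontfun (\<lambda>x. (1/2) *\<^sub>R hessian \<psi> x))"
      unfolding above_def inv[OF bc] using s(1) \<psi> by simp
    from order_trans[OF le Inf_bounds_le[OF this]] show "l (\<lambda>x. (1/2) *\<^sub>R hessian \<psi> x) \<le> gain \<mu> \<nu> \<psi> + e"
      using s unfolding l_def by simp
  qed
  show ?thesis
  proof (rule that[of l])
    show "l (\<lambda>x. \<Phi> x + \<Psi> x) = l \<Phi> + l \<Psi>" if *: "bcont \<Phi>" "bcont \<Psi>" for \<Phi> \<Psi>
    proof -
      have "Bcontfun (\<lambda>x. \<Phi> x + \<Psi> x) = Bcontfun \<Phi> + Bcontfun \<Psi>"
        using * bcont_add[OF *] by (intro bcontfun_eqI) (simp add: inv plus_bcontfun.rep_eq)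
      then show ?thesis unfolding l_def using lin by (simp add: linear_add)
    qed
    show "l (\<lambda>x. c *\<^sub>R \<Phi> x) = c * l \<Phi>" if "bcont \<Phi>" for c \<Phi> by (rule scale[OF that])
    show "l (\<lambda>x. (1/2) *\<^sub>R hessian \<psi> x) = gain \<mu> \<nu> \<psi>" if \<psi>: "\<psi> \<in> Cb2" for \<psi>
    proof -
      have bc: "bcont (\<lambda>x. (1/2) *\<^sub>R hessian \<psi> x)" by (rule bcont_hessian[OF \<psi>])
      have "- l (\<lambda>x. (1/2) *\<^sub>R hessian \<psi> x) \<le> - gain \<mu> \<nu> \<psi>"
        using hess_le[OF Cb2_cmult(1)[OF \<psi>, of "-1"]] scale[OF bc, of "-1"] gain_cmult[OF \<psi>, of "-1"]
        by (simp add: Cb2_cmult(2)[OF \<psi>, of "-1", simplified])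
      with hess_le[OF \<psi>] show ?thesis by linarith
    qed
    show "l \<Phi> \<le> S" if \<Phi>: "bcont \<Phi>" "\<And>x. \<Phi> x \<in> admissible f" for \<Phi>
    proof -
      have "above 1 (\<lambda>x. 0) (Bcontfun \<Phi>)"
        unfolding above_def inv[OF \<Phi>(1)] using \<Phi>(2) by (simp add: Cb2_zero admissible_def)
      from order_trans[OF le Inf_bounds_le[OF this]] show ?thesis unfolding l_def by simp
    qed
    show "0 \<le> l \<Phi>" if \<Phi>: "bcont \<Phi>" "\<And>x M. M \<in> dom_fun f \<Longrightarrow> 0 \<le> \<Phi> x \<bullet> M" for \<Phi>
      using neg[of "\<lambda>x. (-1) *\<^sub>R \<Phi> x"] scale[OF \<Phi>(1), of "-1"] \<Phi> bcont_scaleR[OF bcont_const[of "-1"] \<Phi>(1)]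
      by simp
  qed
qed

end


section \<open>Representation of the functional by a matrix measure\<close>

text \<open>
  Dominated convergence: the functions tend to \<open>0\<close> pointwise and are at most \<open>|x|\<^sup>2\<close>, which both measures
  integrate.
\<close>

lemma (in dual_bound) far_square_gain:
  "(\<lambda>n. gain \<mu> \<nu> (\<lambda>x. (1 / real (Suc n)) * (x \<bullet> x)\<^sup>2 / (1 + (1 / real (Suc n)) * (x \<bullet> x)))) \<longlonglongrightarrow> 0"
proof -
  define \<psi> where "\<psi> n x = (1 / real (Suc n)) * (x \<bullet> x)\<^sup>2 / (1 + (1 / real (Suc n)) * (x \<bullet> x))" for n :: nat and x :: "real^'a"
  have lim: "(\<lambda>n. \<psi> n x) \<longlonglongrightarrow> 0" for x
    unfolding \<psi>_def
    by (rule tendsto_eq_intros refl LIMSEQ_Suc[OF lim_1_over_n] | simp)+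
  have bnd: "\<bar>\<psi> n x\<bar> \<le> (norm x)\<^sup>2" for n x
  proof -
    let ?s = "x \<bullet> x" and ?e = "1 / real (Suc n)"
    have p: "0 < 1 + ?e * ?s" by (intro add_pos_nonneg mult_nonneg_nonneg) auto
    have "?e * ?s\<^sup>2 \<le> ?s * (1 + ?e * ?s)" by (simp add: power2_eq_square algebra_simps)
    then have "\<psi> n x \<le> ?s" unfolding \<psi>_def using p by (simp only: pos_divide_le_eq)
    moreover have "0 \<le> \<psi> n x" unfolding \<psi>_def using p by (intro divide_nonneg_pos) auto
    ultimately show ?thesis by (simp add: power2_norm_eq_inner)
  qed
  have "(\<lambda>n. LINT x|\<kappa>. \<psi> n x) \<longlonglongrightarrow> (LINT x|\<kappa>. 0)" if \<kappa>: "\<kappa> \<in> P2" for \<kappa>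
  proof (rule integral_dominated_convergence)
    show "integrable \<kappa> (\<lambda>x. (norm x)\<^sup>2)" using \<kappa> unfolding P2_def by simp
    have "\<psi> n \<in> Cb2" for n
      unfolding \<psi>_def[abs_def] by (rule far_square(1)) simp
    then have "\<psi> n \<in> borel_measurable borel" for n
      by (intro borel_measurable_continuous_onI Cb2D(5))
    then show "\<psi> n \<in> borel_measurable \<kappa>" for n using \<kappa> unfolding P2_def by (simp cong: measurable_cong_sets)
  qed (use lim bnd in auto)
  from tendsto_diff[OF this[OF nu] this[OF mu]] show ?thesis
    unfolding gain_def \<psi>_def by simp
qed

lemma integrable_inner_bounded:
  fixes \<Phi> \<sigma> :: "'a \<Rightarrow> 'b::euclidean_space"
  assumes "integrable m \<sigma>" "\<Phi> \<in> borel_measurable m" "\<And>x. norm (\<Phi> x) \<le> B"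
  shows "integrable m (\<lambda>x. \<Phi> x \<bullet> \<sigma> x)"
proof (rule Bochner_Integration.integrable_bound)
  show "integrable m (\<lambda>x. B * norm (\<sigma> x))" using assms(1) by simp
  show "AE x in m. norm (\<Phi> x \<bullet> \<sigma> x) \<le> norm (B * norm (\<sigma> x))"
  proof (rule AE_I2)
    fix x
    have "0 \<le> B" using assms(3) norm_ge_zero order_trans by blast
    then show "norm (\<Phi> x \<bullet> \<sigma> x) \<le> norm (B * norm (\<sigma> x))"
      using Cauchy_Schwarz_ineq2[of "\<Phi> x" "\<sigma> x"] mult_right_mono[OF assms(3)[of x], of "norm (\<sigma> x)"]
      by simp
  qed
qed (use assms in measurable)

lemma inner_unit_matrix: "(axis i (axis j 1) :: real^'n^'n) \<bullet> M = M $ i $ j"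
  by (simp add: inner_axis')

lemma inner_transpose: "transpose (A :: real^'n^'n) \<bullet> B = A \<bullet> transpose B"
  unfolding inner_matrix transpose_def by (subst sum.swap) simp

text \<open>
  The functional \<open>\<phi> \<mapsto> l (\<phi> I)\<close>, which becomes the trace of the matrix measure, is positive, and it is tight
  because \<open>l\<close> is known on the Hessian of \<open>e |x|\<^sup>4 / (1 + e |x|\<^sup>2)\<close>. The entries of \<open>l\<close> are not positive, but
  those of \<open>I + E\<^sub>i\<^sub>j\<close> are and lie below twice the trace, where \<open>E\<^sub>i\<^sub>j\<close> is the matrix unit. So
  they are tight as well and have densities with respect to the trace.
\<close>

lemma (in dual_bound) density_representation:
  fixes l :: "(real^'a \<Rightarrow> real^'a^'a) \<Rightarrow> real"
  assumes add: "\<And>\<Phi> \<Psi>. bcont \<Phi> \<Longrightarrow> bcont \<Psi> \<Longrightarrow> l (\<lambda>x. \<Phi> x + \<Psi> x) = l \<Phi> + l \<Psi>"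
    and scale: "\<And>c \<Phi>. bcont \<Phi> \<Longrightarrow> l (\<lambda>x. c *\<^sub>R \<Phi> x) = c * l \<Phi>"
    and hess: "\<And>\<psi>. \<psi> \<in> Cb2 \<Longrightarrow> l (\<lambda>x. (1/2) *\<^sub>R hessian \<psi> x) = gain \<mu> \<nu> \<psi>"
    and nonneg: "\<And>\<Phi>. bcont \<Phi> \<Longrightarrow> (\<And>x M. M \<in> dom_fun f \<Longrightarrow> 0 \<le> \<Phi> x \<bullet> M) \<Longrightarrow> 0 \<le> l \<Phi>"
  obtains m \<sigma> where "finite_measure m" "sets m = sets borel" "integrable m \<sigma>" "\<And>x. \<sigma> x \<in> sym_mats"
    "\<And>\<Phi>. bcont \<Phi> \<Longrightarrow> l \<Phi> = (\<integral>x. \<Phi> x \<bullet> \<sigma> x \<partial>m)"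
proof -
  define T where "T A \<phi> = l (\<lambda>x. \<phi> x *\<^sub>R A)" for A and \<phi> :: "real^'a \<Rightarrow> real"
  have bA: "bcont (\<lambda>x. \<phi> x *\<^sub>R A)" if "bcont \<phi>" for \<phi> :: "real^'a \<Rightarrow> real" and A :: "real^'a^'a"
    using that by (intro bcont_scaleR bcont_const)
  have diff: "l (\<lambda>x. \<Phi> x - \<Psi> x) = l \<Phi> - l \<Psi>" if "bcont \<Phi>" "bcont \<Psi>" for \<Phi> \<Psi>
    using add[OF that(1) bcont_scaleR[OF bcont_const[of "-1"] that(2)]] scale[OF that(2), of "-1"] by simp
  have sum: "l (\<lambda>x. \<Sum>i\<in>I. \<Phi> i x) = (\<Sum>i\<in>I. l (\<Phi> i))" if "\<And>i. i \<in> I \<Longrightarrow> bcont (\<Phi> i)"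
    for I :: "'i set" and \<Phi>
    using that
  proof (induction I rule: infinite_finite_induct)
    case (insert i I)
    then show ?case using add[OF insert.prems[of i] bcont_sum[of I \<Phi>]] by simp
  qed (use scale[OF bcont_const[of 0], of 0] in simp_all)
  have mono: "l \<Phi> \<le> l \<Psi>" if "bcont \<Phi>" "bcont \<Psi>" "\<And>x M. M \<in> psd_mats \<Longrightarrow> \<Phi> x \<bullet> M \<le> \<Psi> x \<bullet> M" for \<Phi> \<Psi>
    using nonneg[OF bcont_diff[OF that(2,1)]] diff[OF that(2,1)] that(3) dom_psd
    by (force simp: inner_diff_left)
  have pos: "positive_functional (T A)" if A: "\<And>M. M \<in> psd_mats \<Longrightarrow> 0 \<le> A \<bullet> M" for A
  proof
    show "T A (\<lambda>x. \<phi> x + \<psi> x) = T A \<phi> + T A \<psi>" if "bcont \<phi>" "bcont \<psi>" for \<phi> \<psi>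
      unfolding T_def scaleR_add_left by (rule add[OF bA[OF that(1)] bA[OF that(2)]])
    show "T A (\<lambda>x. c * \<phi> x) = c * T A \<phi>" if "bcont \<phi>" for c \<phi>
      unfolding T_def scaleR_scaleR[symmetric] by (rule scale[OF bA[OF that]])
    show "0 \<le> T A \<phi>" if "bcont \<phi>" "\<And>x. 0 \<le> \<phi> x" for \<phi>
      unfolding T_def using A dom_psd that(2) by (intro nonneg bA that) auto
  qed
  define J where "J i j = (mat 1 :: real^'a^'a) + axis i (axis j 1)" for i j
  have J0: "0 \<le> J i j \<bullet> M" and J2: "J i j \<bullet> M \<le> 2 * (mat 1 \<bullet> M)" if "M \<in> psd_mats" for i j M
    using psd_entry_le_trace[OF that, of i j]
    unfolding J_def inner_add_left inner_unit_matrix trace_eq_inner[symmetric] by linarith+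
  have I0: "0 \<le> mat 1 \<bullet> M" if "M \<in> psd_mats" for M :: "real^'a^'a"
    using psd_trace_nonneg[OF that] by (simp add: trace_eq_inner)
  have tight: "\<exists>K \<eta>. compact K \<and> bcont \<eta> \<and> (\<forall>x. 0 \<le> \<eta> x) \<and> (\<forall>x. x \<notin> K \<longrightarrow> 1 \<le> \<eta> x) \<and> T (mat 1) \<eta> < e"
    if e: "0 < e" for e
  proof -
    have "\<forall>\<^sub>F n in sequentially. gain \<mu> \<nu> (\<lambda>x. (1 / real (Suc n)) * (x \<bullet> x)\<^sup>2 / (1 + (1 / real (Suc n)) * (x \<bullet> x))) < e / 2"
      using order_tendstoD(2)[OF far_square_gain, of "e / 2"] e by simp
    then obtain n where n: "gain \<mu> \<nu> (\<lambda>x. (1 / real (Suc n)) * (x \<bullet> x)\<^sup>2 / (1 + (1 / real (Suc n)) * (x \<bullet> x))) < e / 2"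
      by (auto simp: eventually_sequentially)
    \<comment> \<open>with this d, the coefficient k of the identity is at least 3/4 outside of the ball of radius n + 1\<close>
    define d where "d = 1 / real (Suc n)"
    have d: "0 < d" unfolding d_def by simp
    define \<psi> where "\<psi> x = d * (x \<bullet> x)\<^sup>2 / (1 + d * (x \<bullet> x))" for x :: "real^'a"
    define k where "k x = 1 - 1 / (1 + d * (x \<bullet> x))\<^sup>2" for x :: "real^'a"
    define r where "r x = 4 * d / (1 + d * (x \<bullet> x))^3" for x :: "real^'a"
    have \<psi>: "\<psi> \<in> Cb2" "(1/2) *\<^sub>R hessian \<psi> x = k x *\<^sub>R mat 1 + r x *\<^sub>R outer x x" for x
      unfolding \<psi>_def[abs_def] k_def r_def using far_square[OF d] by auto
    have p: "1 \<le> 1 + d * (x \<bullet> x)" for x :: "real^'a" using d by simp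
    have p2: "1 \<le> (1 + d * (x \<bullet> x))\<^sup>2" for x :: "real^'a" by (rule one_le_power[OF p])
    have k: "0 \<le> k x" "k x \<le> 1" for x unfolding k_def using p2[of x] by (auto simp: divide_le_eq)
    have bk: "bcont k"
    proof (rule bcontI)
      have "1 + d * (x \<bullet> x) \<noteq> 0" for x :: "real^'a" using p[of x] by linarith
      then show "continuous_on UNIV k" unfolding k_def by (intro continuous_intros) auto
      show "norm (k x) \<le> 1" for x using k[of x] by simp
    qed
    have "T (mat 1) k \<le> l (\<lambda>x. (1/2) *\<^sub>R hessian \<psi> x)"
      unfolding T_def
    proof (rule mono[OF bA[OF bk]])
      show "bcont (\<lambda>x. (1/2) *\<^sub>R hessian \<psi> x)" by (rule bcont_hessian[OF \<psi>(1)])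
      fix x and M :: "real^'a^'a" assume M: "M \<in> psd_mats"
      have "outer x x \<bullet> M = x \<bullet> (M *v x)"
        unfolding inner_matrix outer_def
        by (simp add: inner_vec_def matrix_vector_mult_def sum_distrib_left mult_ac)
      then have "0 \<le> r x * (outer x x \<bullet> M)"
        using M d p[of x] unfolding psd_mats_def r_def by simp
      then show "(k x *\<^sub>R mat 1) \<bullet> M \<le> ((1/2) *\<^sub>R hessian \<psi> x) \<bullet> M"
        unfolding \<psi>(2) by (simp add: inner_add_left)
    qed
    also have "\<dots> = gain \<mu> \<nu> \<psi>" by (rule hess[OF \<psi>(1)])
    also have "\<dots> < e / 2" using n unfolding \<psi>_def d_def .
    finally have Tk: "T (mat 1) (\<lambda>x. 4/3 * k x) < e"
      using positive_functional.cmult[OF pos[OF I0] bk, of "4/3"] e by simp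
    have out: "1 \<le> 4/3 * k x" if "x \<notin> cball 0 (real (Suc n))" for x
    proof -
      have "real (Suc n) * real (Suc n) \<le> norm x * norm x"
        using that by (intro mult_mono) auto
      then have "1 * real (Suc n) \<le> x \<bullet> x"
        by (auto simp: power2_norm_eq_inner[symmetric] power2_eq_square intro: order_trans[rotated])
      then have "1 \<le> d * (x \<bullet> x)" unfolding d_def by (simp add: field_simps)
      then have "2\<^sup>2 \<le> (1 + d * (x \<bullet> x))\<^sup>2" by (intro power_mono) auto
      then have "1 / (1 + d * (x \<bullet> x))\<^sup>2 \<le> 1 / 4" by (intro divide_left_mono) auto
      then show ?thesis unfolding k_def by simp
    qed
    show ?thesis
      by (intro exI[of _ "cball 0 (real (Suc n))"] exI[of _ "\<lambda>x. 4/3 * k x"] conjI allI impI compact_cball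
          bcont_cmult bk out Tk) (use k in auto)
  qed
  have tI: "tight_functional (T (mat 1))"
    by (intro tight_functional.intro tight_functional_axioms.intro pos[OF I0] tight)
  interpret I: tight_functional "T (mat 1)" by (rule tI)
  have le2: "T (J i j) \<phi> \<le> 2 * T (mat 1) \<phi>" if \<phi>: "bcont \<phi>" "\<And>x. 0 \<le> \<phi> x" for i j \<phi>
  proof -
    have "T (J i j) \<phi> \<le> T (mat 1) (\<lambda>x. 2 * \<phi> x)"
      unfolding T_def
    proof (rule mono[OF bA[OF \<phi>(1)] bA[OF bcont_cmult[OF \<phi>(1)]]])
      fix x and M :: "real^'a^'a" assume "M \<in> psd_mats"
      from mult_left_mono[OF J2[OF this, of i j] \<phi>(2)[of x]]
      show "(\<phi> x *\<^sub>R J i j) \<bullet> M \<le> ((2 * \<phi> x) *\<^sub>R mat 1) \<bullet> M" by (simp add: mult_ac)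
    qed
    then show ?thesis using I.cmult[OF \<phi>(1), of 2] by simp
  qed
  have tJ: "tight_functional (T (J i j))" for i j
  proof (intro tight_functional.intro tight_functional_axioms.intro pos[OF J0])
    fix e :: real assume "0 < e"
    then have "0 < e / 2" by simp
    from tight[OF this] obtain K \<eta>
      where K: "compact K" "bcont \<eta>" "\<forall>x. 0 \<le> \<eta> x" "\<forall>x. x \<notin> K \<longrightarrow> 1 \<le> \<eta> x" "T (mat 1) \<eta> < e / 2"
      by blast
    then have "T (J i j) \<eta> < e" using le2[of \<eta> i j] by simp
    with K show "\<exists>K \<eta>. compact K \<and> bcont \<eta> \<and> (\<forall>x. 0 \<le> \<eta> x) \<and> (\<forall>x. x \<notin> K \<longrightarrow> 1 \<le> \<eta> x) \<and> T (J i j) \<eta> < e"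
      by blast
  qed
  define m where "m = Riesz_measure (T (mat 1))"
  have fm: "finite_measure m" unfolding m_def by (rule I.finite_measure_Riesz)
  have sm: "sets m = sets borel" unfolding m_def by simp
  define \<pi> where "\<pi> i j = Riesz_measure (T (J i j))" for i j
  have f\<pi>: "finite_measure (\<pi> i j)" and s\<pi>: "sets (\<pi> i j) = sets borel" for i j
    unfolding \<pi>_def using tight_functional.finite_measure_Riesz[OF tJ]
    by (auto simp: positive_functional.sets_Riesz[OF pos[OF J0]])
  have ac: "emeasure (\<pi> i j) E = 0" if E: "E \<in> sets m" "emeasure m E = 0" for i j E
  proof -
    have pf: "positive_functional (\<lambda>\<phi>. 2 * T (mat 1) \<phi>)"
      using I.add I.cmult I.nonneg by unfold_locales (auto simp: algebra_simps)
    have "emeasure (\<pi> i j) E \<le> emeasure (Riesz_measure (\<lambda>\<phi>. 2 * T (mat 1) \<phi>)) E"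
      unfolding \<pi>_def using E(1) sm le2 by (intro Riesz_measure_mono[OF pos[OF J0] pf]) auto
    also have "\<dots> = upper_integral (\<lambda>\<phi>. 2 * T (mat 1) \<phi>) (indicator E)"
      using positive_functional.emeasure_Riesz[OF pf] E(1) sm by simp
    also have "\<dots> = 0"
    proof (rule antisym)
      have "upper_integral (\<lambda>\<phi>. 2 * T (mat 1) \<phi>) (indicator E) \<le> 0 + ennreal e" if e: "0 < e" for e
      proof -
        have u0: "upper_integral (T (mat 1)) (indicator E) = 0"
          using I.emeasure_Riesz E sm unfolding m_def by simp
        then have lt: "upper_integral (T (mat 1)) (indicator E) < \<infinity>" "0 < e / 2" using e by simp_all
        obtain \<phi> where \<phi>: "\<And>n. bcont (\<phi> n)" "\<And>n x. 0 \<le> \<phi> n x" "\<And>x. indicator E x \<le> (\<Sum>n::nat. ennreal (\<phi> n x))"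
          "(\<Sum>n. ennreal (T (mat 1) (\<phi> n))) < upper_integral (T (mat 1)) (indicator E) + ennreal (e / 2)"
          using I.upper_approx[OF lt] by metis
        have "upper_integral (\<lambda>\<phi>. 2 * T (mat 1) \<phi>) (indicator E) \<le> (\<Sum>n. ennreal (2 * T (mat 1) (\<phi> n)))"
          by (rule positive_functional.upper_le[OF pf \<phi>(1-3)])
        also have "\<dots> = 2 * (\<Sum>n. ennreal (T (mat 1) (\<phi> n)))"
          using I.nonneg[OF \<phi>(1,2)] by (simp add: ennreal_mult)
        also have "\<dots> \<le> 2 * ennreal (e / 2)"
          using \<phi>(4) u0 by (intro mult_left_mono) (auto intro: less_imp_le)
        also have "\<dots> = ennreal e" using e by (simp add: ennreal_mult[symmetric, of 2, simplified])
        finally show ?thesis by simp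
      qed
      then show "upper_integral (\<lambda>\<phi>. 2 * T (mat 1) \<phi>) (indicator E) \<le> 0" by (rule ennreal_le_epsilon)
    qed simp
    finally show ?thesis by simp
  qed
  have "\<exists>D. D \<in> borel_measurable m \<and> (\<forall>x. 0 \<le> D x) \<and> integrable m D \<and> \<pi> i j = density m (\<lambda>x. ennreal (D x))" for i j
    by (rule finite_density[OF fm f\<pi>[of i j] _ ac[of _ i j]]) (auto simp: sm s\<pi>)
  then obtain D where D: "\<And>i j. D i j \<in> borel_measurable m" "\<And>i j x. 0 \<le> D i j x" "\<And>i j. integrable m (D i j)"
    "\<And>i j. \<pi> i j = density m (\<lambda>x. ennreal (D i j x))"
    by metis
  \<comment> \<open>subtracting 1 removes the identity from I + E_ij\<close>
  define \<sigma>' :: "real^'a \<Rightarrow> real^'a^'a" where "\<sigma>' x = (\<Sum>i\<in>UNIV. \<Sum>j\<in>UNIV. (D i j x - 1) *\<^sub>R axis i (axis j 1))" for x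
  interpret m: finite_measure m by (rule fm)
  have i\<sigma>': "integrable m \<sigma>'" unfolding \<sigma>'_def using D(3) by simp
  have entry: "l (\<lambda>x. \<phi> x *\<^sub>R axis i (axis j 1)) = (\<integral>x. \<phi> x * (D i j x - 1) \<partial>m)" if \<phi>: "bcont \<phi>" for i j \<phi>
  proof -
    obtain B where B: "\<And>x. norm (\<phi> x) \<le> B" using bcont_bound[OF \<phi>] by blast
    have \<phi>m [measurable]: "\<phi> \<in> borel_measurable m" using bcont_measurable[OF \<phi>] sm by (simp cong: measurable_cong_sets)
    have i1: "integrable m (\<lambda>x. D i j x * \<phi> x)"
      using integrable_inner_bounded[OF D(3) \<phi>m B, of i j] by (simp add: mult.commute)
    have i2: "integrable m \<phi>" using \<phi> fm sm by (rule integrable_bcont)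
    have "T (J i j) \<phi> = T (mat 1) \<phi> + l (\<lambda>x. \<phi> x *\<^sub>R axis i (axis j 1))"
      unfolding T_def J_def scaleR_add_right by (rule add[OF bA[OF \<phi>] bA[OF \<phi>]])
    moreover have "T (J i j) \<phi> = (\<integral>x. D i j x * \<phi> x \<partial>m)"
    proof -
      have "T (J i j) \<phi> = integral\<^sup>L (\<pi> i j) \<phi>"
        unfolding \<pi>_def using tight_functional.integral_Riesz[OF tJ \<phi>] by simp
      also have "\<dots> = (\<integral>x. D i j x *\<^sub>R \<phi> x \<partial>m)"
        unfolding D(4) using D(1,2) by (intro integral_density) auto
      finally show ?thesis by simp
    qed
    moreover have "T (mat 1) \<phi> = (\<integral>x. \<phi> x \<partial>m)" unfolding m_def using I.integral_Riesz[OF \<phi>] by simp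
    ultimately have "l (\<lambda>x. \<phi> x *\<^sub>R axis i (axis j 1)) = (\<integral>x. D i j x * \<phi> x - \<phi> x \<partial>m)"
      using i1 i2 by simp
    then show ?thesis by (simp add: algebra_simps)
  qed
  have rep: "l \<Phi> = (\<integral>x. \<Phi> x \<bullet> \<sigma>' x \<partial>m)" if \<Phi>: "bcont \<Phi>" for \<Phi>
  proof -
    have b: "bcont (\<lambda>x. \<Phi> x $ i $ j)" for i j
    proof -
      obtain B where B: "\<And>x. norm (\<Phi> x) \<le> B" using bcont_bound[OF \<Phi>] by blast
      have "norm (\<Phi> x $ i $ j) \<le> B" for x
        using order_trans[OF Finite_Cartesian_Product.norm_nth_le Finite_Cartesian_Product.norm_nth_le] B order_trans by blast
      moreover have "continuous_on UNIV (\<lambda>x. \<Phi> x $ i $ j)"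
        using \<Phi> unfolding bcont_def by (intro continuous_intros) auto
      ultimately show ?thesis by (rule bcontI[rotated])
    qed
    have "l \<Phi> = l (\<lambda>x. \<Sum>i\<in>UNIV. \<Sum>j\<in>UNIV. (\<Phi> x $ i $ j) *\<^sub>R axis i (axis j 1))"
      by (simp add: matrix_expansion)
    also have "\<dots> = (\<Sum>i\<in>UNIV. \<Sum>j\<in>UNIV. l (\<lambda>x. (\<Phi> x $ i $ j) *\<^sub>R axis i (axis j 1)))"
      by (simp add: sum bcont_sum bA b)
    also have "\<dots> = (\<Sum>i\<in>UNIV. \<Sum>j\<in>UNIV. (\<integral>x. \<Phi> x $ i $ j * (D i j x - 1) \<partial>m))"
      by (simp add: entry b)
    also have "\<dots> = (\<integral>x. (\<Sum>i\<in>UNIV. \<Sum>j\<in>UNIV. \<Phi> x $ i $ j * (D i j x - 1)) \<partial>m)"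
    proof -
      have "integrable m (\<lambda>x. \<Phi> x $ i $ j * (D i j x - 1))" for i j
      proof -
        obtain B where B: "\<And>x. norm (\<Phi> x $ i $ j) \<le> B" using bcont_bound[OF b] by blast
        have "(\<lambda>x. \<Phi> x $ i $ j) \<in> borel_measurable m" using bcont_measurable[OF b] sm by (simp cong: measurable_cong_sets)
        from integrable_inner_bounded[OF _ this B, of "\<lambda>x. D i j x - 1"] show ?thesis using D(3) by simp
      qed
      then show ?thesis by (simp add: Bochner_Integration.integral_sum)
    qed
    also have "\<dots> = (\<integral>x. \<Phi> x \<bullet> \<sigma>' x \<partial>m)"
      unfolding \<sigma>'_def inner_sum_right inner_scaleR_right
      by (simp add: inner_commute[of _ "axis _ _"] inner_unit_matrix mult.commute)
    finally show ?thesis .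
  qed
  define \<sigma> where "\<sigma> x = (1/2) *\<^sub>R (transpose (\<sigma>' x) + \<sigma>' x)" for x
  have it: "integrable m (\<lambda>x. transpose (\<sigma>' x))"
    using i\<sigma>' by (rule integrable_bounded_linear[OF bounded_linear_transpose])
  have "l \<Phi> = (\<integral>x. \<Phi> x \<bullet> \<sigma> x \<partial>m)" if \<Phi>: "bcont \<Phi>" for \<Phi>
  proof -
    obtain B where B: "\<And>x. norm (\<Phi> x) \<le> B" using bcont_bound[OF \<Phi>] by blast
    have \<Phi>m: "\<Phi> \<in> borel_measurable m" using bcont_measurable[OF \<Phi>] sm by (simp cong: measurable_cong_sets)
    have bT: "bcont (\<lambda>x. transpose (\<Phi> x))"
    proof -
      obtain C where C: "\<And>A :: real^'a^'a. norm (transpose A) \<le> norm A * C"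
        using bounded_linear.bounded[OF bounded_linear_transpose] by blast
      have "norm (transpose (\<Phi> x)) \<le> B * \<bar>C\<bar>" for x
      proof -
        have "norm (\<Phi> x) * C \<le> norm (\<Phi> x) * \<bar>C\<bar>" by (intro mult_left_mono) auto
        also have "\<dots> \<le> B * \<bar>C\<bar>" using B by (intro mult_right_mono) auto
        finally show ?thesis using C[of "\<Phi> x"] by linarith
      qed
      moreover have "continuous_on UNIV (\<lambda>x. transpose (\<Phi> x))"
        using bounded_linear.continuous_on[OF bounded_linear_transpose] \<Phi> unfolding bcont_def by blast
      ultimately show ?thesis by (rule bcontI[rotated])
    qed
    have tr: "transpose A \<bullet> M = A \<bullet> M" if "M \<in> psd_mats" for A M :: "real^'a^'a"
      unfolding inner_transpose using psd_sym[OF that] by (simp add: sym_mats_def)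
    \<comment> \<open>l ignores antisymmetric parts because the domain of f is symmetric; so \<sigma>' may be symmetrised\<close>
    have "l (\<lambda>x. transpose (\<Phi> x)) = l \<Phi>"
      using mono[OF bT \<Phi>] mono[OF \<Phi> bT] tr by (simp add: antisym)
    then have "(\<integral>x. \<Phi> x \<bullet> transpose (\<sigma>' x) \<partial>m) = l \<Phi>"
      unfolding rep[OF bT] inner_transpose .
    then have "(\<integral>x. \<Phi> x \<bullet> transpose (\<sigma>' x) + \<Phi> x \<bullet> \<sigma>' x \<partial>m) = 2 * l \<Phi>"
      using integrable_inner_bounded[OF i\<sigma>' \<Phi>m B] integrable_inner_bounded[OF it \<Phi>m B] rep[OF \<Phi>] by simp
    then show ?thesis unfolding \<sigma>_def by (simp add: inner_add_right)
  qed
  moreover have "integrable m \<sigma>" unfolding \<sigma>_def using i\<sigma>' it by simp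
  moreover have "\<sigma> x \<in> sym_mats" for x unfolding \<sigma>_def by (intro sym_mats_scaleR transpose_eq_sym)
  ultimately show ?thesis using that fm sm by blast
qed


section \<open>From continuous to measurable admissible fields\<close>

text \<open>
  Inner regularity, outer regularity and Urysohn's lemma: the function is \<open>1\<close> on a compact subset and \<open>0\<close> outside of
  an open superset of almost the same measure.
\<close>

lemma indicator_L1_approx:
  fixes \<beta> :: "'a::euclidean_space measure"
  assumes fin: "finite_measure \<beta>" and s: "sets \<beta> = sets borel" and B: "B \<in> sets borel" and e: "0 < e"
  obtains w :: "'a \<Rightarrow> real" where "bcont w" "\<And>x. 0 \<le> w x" "\<And>x. w x \<le> 1" "(\<integral>x. \<bar>w x - indicator B x\<bar> \<partial>\<beta>) < e"
proof -
  interpret finite_measure \<beta> by (rule fin)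
  have fs: "emeasure \<beta> (space \<beta>) \<noteq> \<infinity>" by simp
  obtain K where K: "K \<subseteq> B" "compact K" "measure \<beta> B - e / 2 < measure \<beta> K"
  proof (cases "measure \<beta> B < e / 2")
    case True
    then show ?thesis by (intro that[of "{}"]) auto
  next
    case False
    then have "ennreal (measure \<beta> B - e / 2) < ennreal (measure \<beta> B)" using e by (simp add: ennreal_less_iff)
    also have "\<dots> = (SUP K \<in> {K. K \<subseteq> B \<and> compact K}. emeasure \<beta> K)"
      using inner_regular[OF s fs B] by (simp add: emeasure_eq_measure)
    finally obtain K where "K \<subseteq> B" "compact K" "ennreal (measure \<beta> B - e / 2) < emeasure \<beta> K"
      unfolding less_SUP_iff by blast
    then show ?thesis using False by (intro that[of K]) (auto simp: emeasure_eq_measure ennreal_less_iff)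
  qed
  have "(INF U \<in> {U. B \<subseteq> U \<and> open U}. emeasure \<beta> U) < ennreal (measure \<beta> B + e / 2)"
    unfolding outer_regular[OF s fs B, symmetric] using e by (simp add: emeasure_eq_measure ennreal_less_iff)
  then obtain U where U: "B \<subseteq> U" "open U" "emeasure \<beta> U < ennreal (measure \<beta> B + e / 2)"
    unfolding INF_less_iff by blast
  then have mU: "measure \<beta> U < measure \<beta> B + e / 2"
    by (simp add: emeasure_eq_measure ennreal_less_iff)
  have "closed K" "closed (- U)" "K \<inter> - U = {}"
    using K U compact_imp_closed by auto
  then obtain w :: "'a \<Rightarrow> real" where w: "continuous_on UNIV w" "\<And>x. w x \<in> closed_segment 1 0"
    "\<And>x. x \<in> K \<Longrightarrow> w x = 1" "\<And>x. x \<in> - U \<Longrightarrow> w x = 0"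
    using Urysohn[of K "- U" 1 0] by metis
  have w01: "0 \<le> w x" "w x \<le> 1" for x
    using w(2)[of x] by (auto simp: closed_segment_eq_real_ivl split: if_splits)
  have bw: "bcont w" using w(1) w01 by (intro bcontI[of _ 1]) auto
  have sets: "U \<in> sets \<beta>" "K \<in> sets \<beta>" "B \<in> sets \<beta>"
    using U(2) K(2) B s by (auto intro: borel_closed compact_imp_closed)
  have "\<bar>w x - indicator B x\<bar> \<le> indicator (U - K) x" for x
    using w01[of x] w(3,4)[of x] K(1) U(1) by (auto simp: indicator_def)
  moreover have "integrable \<beta> (\<lambda>x. \<bar>w x - indicator B x\<bar>)"
    using integrable_bcont[OF bw fin s] sets(3)
    by (intro integrable_abs Bochner_Integration.integrable_diff integrable_real_indicator) (auto simp: emeasure_less_top)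
  moreover have "integrable \<beta> (indicat_real (U - K))"
    using sets by (intro integrable_real_indicator) (auto simp: emeasure_less_top)
  ultimately have "(\<integral>x. \<bar>w x - indicator B x\<bar> \<partial>\<beta>) \<le> (\<integral>x. indicator (U - K) x \<partial>\<beta>)"
    by (intro integral_mono)
  also have "\<dots> = measure \<beta> (U - K)" using sets by simp
  also have "\<dots> = measure \<beta> U - measure \<beta> K"
    using sets K(1) U(1) by (intro finite_measure_Diff) auto
  also have "\<dots> < e" using K(3) mU by linarith
  finally show ?thesis using that[OF bw w01] by blast
qed

text \<open>
  The situation after the representation of the functional: \<open>K\<close> will be the set of admissible matrices, and the
  bound is known for continuous fields. The aim is the same bound for Borel fields.
\<close>

locale field_bound =
  fixes m :: "'a::euclidean_space measure" and \<sigma> :: "'a \<Rightarrow> 'b::euclidean_space" and K :: "'b set" and S :: real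
  assumes fin: "finite_measure m" and sets_m [measurable_cong]: "sets m = sets borel" and int: "integrable m \<sigma>"
    and conv: "convex K" and zero: "0 \<in> K"
    and bound: "\<And>\<Psi>. bcont \<Psi> \<Longrightarrow> (\<And>x. \<Psi> x \<in> K) \<Longrightarrow> (\<integral>x. \<Psi> x \<bullet> \<sigma> x \<partial>m) \<le> S"
begin

definition weighted :: "'a measure" where "weighted = density m (\<lambda>x. ennreal (norm (\<sigma> x)))"

lemma \<sigma>_measurable [measurable]: "\<sigma> \<in> borel_measurable m" using int by simp

lemma sets_weighted: "sets weighted = sets borel" unfolding weighted_def by (simp add: sets_m)

lemma finite_weighted: "finite_measure weighted"
proof (rule finite_measureI)
  have "emeasure weighted (space weighted) = (\<integral>\<^sup>+x. ennreal (norm (\<sigma> x)) \<partial>m)"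
    unfolding weighted_def by (simp add: emeasure_density nn_integral_set_ennreal)
  also have "\<dots> < \<infinity>" using int by (simp add: integrable_iff_bounded)
  finally show "emeasure weighted (space weighted) \<noteq> \<infinity>" by simp
qed

text \<open>
  Approximation in \<open>L\<^sup>1(|\<sigma>| m)\<close> is just what makes the pairing with \<open>\<sigma>\<close> converge.
\<close>

definition approximable :: "('a \<Rightarrow> 'b) \<Rightarrow> bool" where
  "approximable \<Phi> \<longleftrightarrow> \<Phi> \<in> borel_measurable borel \<and> (\<exists>B. \<forall>x. norm (\<Phi> x) \<le> B) \<and>
     (\<forall>e>0. \<exists>\<Psi>. bcont \<Psi> \<and> (\<forall>x. \<Psi> x \<in> K) \<and> (\<integral>x. norm (\<Phi> x - \<Psi> x) \<partial>weighted) < e)"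

lemma integrable_weighted:
  fixes \<Phi> :: "'a \<Rightarrow> 'c::euclidean_space"
  assumes "\<Phi> \<in> borel_measurable borel" "\<And>x. norm (\<Phi> x) \<le> B" shows "integrable weighted \<Phi>"
  using assms sets_weighted
  by (intro finite_measure.integrable_const_bound[OF finite_weighted, of _ B]) (auto cong: measurable_cong_sets)

lemma approximable_bound:
  assumes "approximable \<Phi>" shows "(\<integral>x. \<Phi> x \<bullet> \<sigma> x \<partial>m) \<le> S"
proof (rule field_le_epsilon)
  fix e :: real assume "0 < e"
  then obtain \<Psi> where \<Psi>: "bcont \<Psi>" "\<And>x. \<Psi> x \<in> K" "(\<integral>x. norm (\<Phi> x - \<Psi> x) \<partial>weighted) < e"
    using assms unfolding approximable_def by blast
  obtain B where B: "\<And>x. norm (\<Phi> x) \<le> B" using assms unfolding approximable_def by blast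
  obtain C where C: "\<And>x. norm (\<Psi> x) \<le> C" using bcont_bound[OF \<Psi>(1)] by blast
  have \<Phi>m [measurable]: "\<Phi> \<in> borel_measurable borel" using assms unfolding approximable_def by blast
  have \<Psi>m [measurable]: "\<Psi> \<in> borel_measurable borel" using \<Psi>(1) by (rule bcont_measurable)
  have i: "integrable m (\<lambda>x. \<Phi> x \<bullet> \<sigma> x)" "integrable m (\<lambda>x. \<Psi> x \<bullet> \<sigma> x)"
    by (rule integrable_inner_bounded[OF int _ B] integrable_inner_bounded[OF int _ C]; measurable)+
  have "integrable m (\<lambda>x. norm (\<sigma> x) * norm (\<Phi> x - \<Psi> x))"
  proof -
    have "norm (\<Phi> x - \<Psi> x) \<le> B + C" for x
      using norm_triangle_ineq4[of "\<Phi> x" "\<Psi> x"] B[of x] C[of x] by linarith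
    then have "integrable weighted (\<lambda>x. norm (\<Phi> x - \<Psi> x))"
      by (intro integrable_weighted[of _ "B + C"]) auto
    then show ?thesis unfolding weighted_def by (subst (asm) integrable_density) auto
  qed
  have "(\<integral>x. (\<Phi> x - \<Psi> x) \<bullet> \<sigma> x \<partial>m) \<le> (\<integral>x. norm (\<sigma> x) * norm (\<Phi> x - \<Psi> x) \<partial>m)"
  proof (rule integral_mono)
    show "integrable m (\<lambda>x. norm (\<sigma> x) * norm (\<Phi> x - \<Psi> x))" by fact
    show "integrable m (\<lambda>x. (\<Phi> x - \<Psi> x) \<bullet> \<sigma> x)" using i by (simp add: inner_diff_left)
    show "(\<Phi> x - \<Psi> x) \<bullet> \<sigma> x \<le> norm (\<sigma> x) * norm (\<Phi> x - \<Psi> x)" for x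
      using norm_cauchy_schwarz[of "\<Phi> x - \<Psi> x" "\<sigma> x"] by (simp only: mult.commute)
  qed
  also have "\<dots> = (\<integral>x. norm (\<Phi> x - \<Psi> x) \<partial>weighted)"
    unfolding weighted_def by (subst integral_density) auto
  finally show "(\<integral>x. \<Phi> x \<bullet> \<sigma> x \<partial>m) \<le> S + e"
    using \<Psi>(3) bound[OF \<Psi>(1,2)] i by (simp add: inner_diff_left)
qed

lemma approximable_const: assumes "A \<in> K" shows "approximable (\<lambda>x. A)"
  unfolding approximable_def
proof (intro conjI allI impI)
  fix e :: real assume "0 < e"
  then show "\<exists>\<Psi>. bcont \<Psi> \<and> (\<forall>x. \<Psi> x \<in> K) \<and> (\<integral>x. norm (A - \<Psi> x) \<partial>weighted) < e"
    using assms by (intro exI[of _ "\<lambda>x. A"]) simp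
qed auto

text \<open>
  Gluing two fields along a Borel set: the continuous approximations are interpolated by a
  continuous function close to the indicator, which stays in \<open>K\<close> by convexity.
\<close>

lemma approximable_if:
  assumes 1: "approximable \<Phi>" and 2: "approximable \<Phi>'" and B: "B \<in> sets borel"
  shows "approximable (\<lambda>x. if x \<in> B then \<Phi>' x else \<Phi> x)"
  unfolding approximable_def
proof (intro conjI allI impI)
  have m1 [measurable]: "\<Phi> \<in> borel_measurable borel" and m2 [measurable]: "\<Phi>' \<in> borel_measurable borel"
    using 1 2 unfolding approximable_def by auto
  obtain b b' where b: "\<And>x. norm (\<Phi> x) \<le> b" "\<And>x. norm (\<Phi>' x) \<le> b'"
    using 1 2 unfolding approximable_def by blast
  show "(\<lambda>x. if x \<in> B then \<Phi>' x else \<Phi> x) \<in> borel_measurable borel" using B by measurable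
  show "\<exists>C. \<forall>x. norm (if x \<in> B then \<Phi>' x else \<Phi> x) \<le> C"
    using b by (intro exI[of _ "max b b'"]) (auto intro: max.coboundedI1 max.coboundedI2)
  fix e :: real assume "0 < e"
  then have e3: "0 < e / 3" by simp
  obtain \<Psi> where \<Psi>: "bcont \<Psi>" "\<And>x. \<Psi> x \<in> K" "(\<integral>x. norm (\<Phi> x - \<Psi> x) \<partial>weighted) < e / 3"
    using 1 e3 unfolding approximable_def by blast
  obtain \<Psi>' where \<Psi>': "bcont \<Psi>'" "\<And>x. \<Psi>' x \<in> K" "(\<integral>x. norm (\<Phi>' x - \<Psi>' x) \<partial>weighted) < e / 3"
    using 2 e3 unfolding approximable_def by blast
  obtain c where c: "0 \<le> c" "\<And>x. norm (\<Psi> x) \<le> c" using bcont_bound[OF \<Psi>(1)] by blast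
  obtain c' where c': "0 \<le> c'" "\<And>x. norm (\<Psi>' x) \<le> c'" using bcont_bound[OF \<Psi>'(1)] by blast
  \<comment> \<open>c + c' bounds the distance of the two approximations, which counts where w differs from the indicator\<close>
  define d where "d = e / (3 * (c + c' + 1))"
  have d: "0 < d" "d * (c + c') \<le> e / 3" unfolding d_def using \<open>0 < e\<close> c(1) c'(1)
    by (auto simp: field_simps)
  obtain w where w: "bcont w" "\<And>x. 0 \<le> w x" "\<And>x. w x \<le> 1" "(\<integral>x. \<bar>w x - indicator B x\<bar> \<partial>weighted) < d"
    using indicator_L1_approx[OF finite_weighted sets_weighted B d(1)] by blast
  define \<Psi>'' where "\<Psi>'' x = (1 - w x) *\<^sub>R \<Psi> x + w x *\<^sub>R \<Psi>' x" for x
  have b'': "bcont \<Psi>''"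
    unfolding \<Psi>''_def using w(1) \<Psi>(1) \<Psi>'(1)
    by (intro bcont_add bcont_scaleR bcont_diff bcont_const)
  have K'': "\<Psi>'' x \<in> K" for x
    unfolding \<Psi>''_def using convexD_alt[OF conv \<Psi>(2) \<Psi>'(2) w(2,3)] by simp
  have [measurable]: "\<Psi> \<in> borel_measurable borel" "\<Psi>' \<in> borel_measurable borel" "\<Psi>'' \<in> borel_measurable borel"
    "w \<in> borel_measurable borel"
    using \<Psi>(1) \<Psi>'(1) b'' w(1) by (auto intro: bcont_measurable)
  have n: "norm (\<Psi> x - \<Psi>' x) \<le> c + c'" for x
    using norm_triangle_ineq4[of "\<Psi> x" "\<Psi>' x"] c(2)[of x] c'(2)[of x] by linarith
  have pt: "norm ((if x \<in> B then \<Phi>' x else \<Phi> x) - \<Psi>'' x)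
    \<le> norm (\<Phi> x - \<Psi> x) + norm (\<Phi>' x - \<Psi>' x) + \<bar>w x - indicator B x\<bar> * (c + c')" for x
  proof (cases "x \<in> B")
    case True
    have eq: "\<Phi>' x - \<Psi>'' x = (\<Phi>' x - \<Psi>' x) - (1 - w x) *\<^sub>R (\<Psi> x - \<Psi>' x)"
      unfolding \<Psi>''_def by (simp add: algebra_simps)
    have "norm (\<Phi>' x - \<Psi>'' x) \<le> norm (\<Phi>' x - \<Psi>' x) + (1 - w x) * norm (\<Psi> x - \<Psi>' x)"
      unfolding eq using norm_triangle_ineq4[of "\<Phi>' x - \<Psi>' x" "(1 - w x) *\<^sub>R (\<Psi> x - \<Psi>' x)"] w(3)[of x] by simp
    also have "\<dots> \<le> norm (\<Phi>' x - \<Psi>' x) + (1 - w x) * (c + c')"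
      using n[of x] w(3)[of x] by (intro add_left_mono mult_left_mono) auto
    finally have le: "norm (\<Phi>' x - \<Psi>'' x) \<le> norm (\<Phi>' x - \<Psi>' x) + (1 - w x) * (c + c')" .
    have ind: "\<bar>w x - indicator B x\<bar> = 1 - w x" using True w(3)[of x] by (simp add: indicator_def)
    show ?thesis unfolding if_P[OF True] ind using le norm_ge_zero[of "\<Phi> x - \<Psi> x"] by linarith
  next
    case False
    have eq: "\<Phi> x - \<Psi>'' x = (\<Phi> x - \<Psi> x) + w x *\<^sub>R (\<Psi> x - \<Psi>' x)"
      unfolding \<Psi>''_def by (simp add: algebra_simps)
    have "norm (\<Phi> x - \<Psi>'' x) \<le> norm (\<Phi> x - \<Psi> x) + w x * norm (\<Psi> x - \<Psi>' x)"
      unfolding eq using norm_triangle_ineq[of "\<Phi> x - \<Psi> x" "w x *\<^sub>R (\<Psi> x - \<Psi>' x)"] w(2)[of x] by simp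
    also have "\<dots> \<le> norm (\<Phi> x - \<Psi> x) + w x * (c + c')"
      using n[of x] w(2)[of x] by (intro add_left_mono mult_left_mono) auto
    finally have le: "norm (\<Phi> x - \<Psi>'' x) \<le> norm (\<Phi> x - \<Psi> x) + w x * (c + c')" .
    have ind: "\<bar>w x - indicator B x\<bar> = w x" using False w(2)[of x] by (simp add: indicator_def)
    show ?thesis unfolding if_not_P[OF False] ind using le norm_ge_zero[of "\<Phi>' x - \<Psi>' x"] by linarith
  qed
  have i1: "integrable weighted (\<lambda>x. norm (\<Phi> x - \<Psi> x))"
  proof (rule integrable_weighted[of _ "b + c"])
    show "norm (norm (\<Phi> x - \<Psi> x)) \<le> b + c" for x
      using norm_triangle_ineq4[of "\<Phi> x" "\<Psi> x"] b(1)[of x] c(2)[of x] by simp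
  qed measurable
  have i2: "integrable weighted (\<lambda>x. norm (\<Phi>' x - \<Psi>' x))"
  proof (rule integrable_weighted[of _ "b' + c'"])
    show "norm (norm (\<Phi>' x - \<Psi>' x)) \<le> b' + c'" for x
      using norm_triangle_ineq4[of "\<Phi>' x" "\<Psi>' x"] b(2)[of x] c'(2)[of x] by simp
  qed measurable
  have i3: "integrable weighted (\<lambda>x. \<bar>w x - indicator B x\<bar>)"
  proof (rule integrable_weighted[of _ 1])
    show "norm \<bar>w x - indicator B x\<bar> \<le> 1" for x
      using w(2,3)[of x] by (auto simp: indicator_def)
    show "(\<lambda>x. \<bar>w x - indicator B x\<bar>) \<in> borel_measurable borel" using B by measurable
  qed
  note i12 = Bochner_Integration.integrable_add[OF i1 i2]
  have i3': "integrable weighted (\<lambda>x. \<bar>w x - indicator B x\<bar> * (c + c'))"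
    using i3 by (rule integrable_mult_left)
  note i123 = Bochner_Integration.integrable_add[OF i12 i3']
  have "(\<integral>x. norm ((if x \<in> B then \<Phi>' x else \<Phi> x) - \<Psi>'' x) \<partial>weighted)
    \<le> (\<integral>x. norm (\<Phi> x - \<Psi> x) + norm (\<Phi>' x - \<Psi>' x) + \<bar>w x - indicator B x\<bar> * (c + c') \<partial>weighted)"
  proof (rule integral_mono')
    show "integrable weighted (\<lambda>x. norm (\<Phi> x - \<Psi> x) + norm (\<Phi>' x - \<Psi>' x) + \<bar>w x - indicator B x\<bar> * (c + c'))"
      by (rule i123)
    show "norm ((if x \<in> B then \<Phi>' x else \<Phi> x) - \<Psi>'' x)
      \<le> norm (\<Phi> x - \<Psi> x) + norm (\<Phi>' x - \<Psi>' x) + \<bar>w x - indicator B x\<bar> * (c + c')" for x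
      by (rule pt)
    show "0 \<le> norm (\<Phi> x - \<Psi> x) + norm (\<Phi>' x - \<Psi>' x) + \<bar>w x - indicator B x\<bar> * (c + c')" for x
      using c(1) c'(1) by (intro add_nonneg_nonneg mult_nonneg_nonneg) auto
  qed
  also have "\<dots> = (\<integral>x. norm (\<Phi> x - \<Psi> x) \<partial>weighted) + (\<integral>x. norm (\<Phi>' x - \<Psi>' x) \<partial>weighted)
    + (\<integral>x. \<bar>w x - indicator B x\<bar> \<partial>weighted) * (c + c')"
    by (simp only: Bochner_Integration.integral_add[OF i12 i3'] Bochner_Integration.integral_add[OF i1 i2]
        integral_mult_left_zero)
  also have "\<dots> < e / 3 + e / 3 + e / 3"
  proof -
    have "(\<integral>x. \<bar>w x - indicator B x\<bar> \<partial>weighted) * (c + c') \<le> d * (c + c')"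
      using w(4) c(1) c'(1) by (intro mult_right_mono) auto
    then show ?thesis using \<Psi>(3) \<Psi>'(3) d(2) by linarith
  qed
  finally show "\<exists>\<Psi>. bcont \<Psi> \<and> (\<forall>x. \<Psi> x \<in> K) \<and>
      (\<integral>x. norm ((if x \<in> B then \<Phi>' x else \<Phi> x) - \<Psi> x) \<partial>weighted) < e"
    using b'' K'' by (intro exI[of _ \<Psi>'']) simp
qed

text \<open>
  The field \<open>\<Phi> n\<close> takes at each point the best of \<open>0\<close> and the first \<open>n\<close> matrices, switching to \<open>A n\<close> where this is
  better. Only finitely many glueings are needed, so it is approximable, and \<open>\<Phi> n x \<bullet> \<sigma> x\<close> increases to
  the positive part of the supremum.
\<close>

lemma nn_integral_SUP_le:
  assumes A: "\<And>n::nat. A n \<in> K"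
  shows "(\<integral>\<^sup>+x. (SUP n. ennreal (A n \<bullet> \<sigma> x)) \<partial>m) \<le> ennreal S"
proof -
  define \<Phi> :: "nat \<Rightarrow> 'a \<Rightarrow> 'b" where
    "\<Phi> = rec_nat (\<lambda>x. 0) (\<lambda>n \<Phi> x. if x \<in> {x. \<Phi> x \<bullet> \<sigma> x < A n \<bullet> \<sigma> x} then A n else \<Phi> x)"
  have \<Phi>0: "\<Phi> 0 = (\<lambda>x. 0)"
    and \<Phi>S: "\<Phi> (Suc n) = (\<lambda>x. if x \<in> {x. \<Phi> n x \<bullet> \<sigma> x < A n \<bullet> \<sigma> x} then A n else \<Phi> n x)" for n
    unfolding \<Phi>_def by (simp_all del: mem_Collect_eq)
  have \<sigma>b [measurable]: "\<sigma> \<in> borel_measurable borel" using \<sigma>_measurable by simp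
  have app: "approximable (\<Phi> n)" for n
  proof (induction n)
    case 0 then show ?case unfolding \<Phi>0 by (rule approximable_const[OF zero])
  next
    case (Suc n)
    then have [measurable]: "\<Phi> n \<in> borel_measurable borel" unfolding approximable_def by simp
    have "{x. \<Phi> n x \<bullet> \<sigma> x < A n \<bullet> \<sigma> x} \<in> sets borel" by measurable
    then show ?case unfolding \<Phi>S by (intro approximable_if Suc approximable_const A)
  qed
  have inc: "\<Phi> n x \<bullet> \<sigma> x \<le> \<Phi> (Suc n) x \<bullet> \<sigma> x" "A n \<bullet> \<sigma> x \<le> \<Phi> (Suc n) x \<bullet> \<sigma> x" for n x
    unfolding \<Phi>S by auto
  have ge0: "0 \<le> \<Phi> n x \<bullet> \<sigma> x" for n x
  proof (induction n)
    case (Suc n)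
    then show ?case using inc(1)[of n x] by linarith
  qed (simp add: \<Phi>0)
  have incseq: "incseq (\<lambda>n x. ennreal (\<Phi> n x \<bullet> \<sigma> x))"
    unfolding incseq_Suc_iff le_fun_def using inc(1) by (simp add: ennreal_leI)
  have "(\<integral>\<^sup>+x. (SUP n. ennreal (A n \<bullet> \<sigma> x)) \<partial>m) \<le> (\<integral>\<^sup>+x. (SUP n. ennreal (\<Phi> n x \<bullet> \<sigma> x)) \<partial>m)"
  proof (intro nn_integral_mono SUP_least)
    fix x n
    show "ennreal (A n \<bullet> \<sigma> x) \<le> (SUP n. ennreal (\<Phi> n x \<bullet> \<sigma> x))"
      using inc(2) by (intro SUP_upper2[of "Suc n"]) (auto intro: ennreal_leI)
  qed
  also have "\<dots> = (SUP n. \<integral>\<^sup>+x. ennreal (\<Phi> n x \<bullet> \<sigma> x) \<partial>m)"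
  proof (rule nn_integral_monotone_convergence_SUP[OF incseq])
    fix n
    have [measurable]: "\<Phi> n \<in> borel_measurable borel" using app unfolding approximable_def by simp
    show "(\<lambda>x. ennreal (\<Phi> n x \<bullet> \<sigma> x)) \<in> borel_measurable m" by measurable
  qed
  also have "\<dots> \<le> ennreal S"
  proof (rule SUP_least)
    fix n
    have [measurable]: "\<Phi> n \<in> borel_measurable borel" using app unfolding approximable_def by simp
    obtain B where B: "\<And>x. norm (\<Phi> n x) \<le> B" using app[of n] unfolding approximable_def by blast
    have "integrable m (\<lambda>x. \<Phi> n x \<bullet> \<sigma> x)"
      by (rule integrable_inner_bounded[OF int _ B]) measurable
    then have "(\<integral>\<^sup>+x. ennreal (\<Phi> n x \<bullet> \<sigma> x) \<partial>m) = ennreal (\<integral>x. \<Phi> n x \<bullet> \<sigma> x \<partial>m)"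
      using ge0 by (intro nn_integral_eq_integral) auto
    also have "\<dots> \<le> ennreal S" by (intro ennreal_leI approximable_bound app)
    finally show "(\<integral>\<^sup>+x. ennreal (\<Phi> n x \<bullet> \<sigma> x) \<partial>m) \<le> ennreal S" .
  qed
  finally show ?thesis .
qed

end

section \<open>Optimal static competitors\<close>

lemma set_integral_sums:
  fixes \<sigma> :: "'a \<Rightarrow> 'b::{banach,second_countable_topology}"
  assumes int: "integrable m \<sigma>" and A: "range A \<subseteq> sets m" and d: "disjoint_family A"
  shows "(\<lambda>i::nat. LINT x:A i|m. \<sigma> x) sums (LINT x:(\<Union>i. A i)|m. \<sigma> x)"
proof -
  have Am: "A i \<in> sets m" for i using A by auto
  have meas: "\<sigma> \<in> borel_measurable m" using int by simp
  have "(\<lambda>n. \<integral>x. indicator (\<Union>i<n. A i) x *\<^sub>R \<sigma> x \<partial>m) \<longlonglongrightarrow> (\<integral>x. indicator (\<Union>i. A i) x *\<^sub>R \<sigma> x \<partial>m)"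
  proof (rule integral_dominated_convergence)
    show "integrable m (\<lambda>x. norm (\<sigma> x))" using int by simp
    show "AE x in m. (\<lambda>n. indicator (\<Union>i<n. A i) x *\<^sub>R \<sigma> x) \<longlonglongrightarrow> indicator (\<Union>i. A i) x *\<^sub>R \<sigma> x"
      by (intro AE_I2 tendsto_scaleR tendsto_const LIMSEQ_indicator_UN)
    show "AE x in m. norm (indicator (\<Union>i<n. A i) x *\<^sub>R \<sigma> x) \<le> norm (\<sigma> x)" for n
      by (auto simp: indicator_def)
  qed (use Am meas in measurable)
  moreover have "(\<integral>x. indicator (\<Union>i<n. A i) x *\<^sub>R \<sigma> x \<partial>m) = (\<Sum>i<n. LINT x:A i|m. \<sigma> x)" for n
  proof -
    have "indicator (\<Union>i<n. A i) x = (\<Sum>i<n. indicat_real (A i) x)" for x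
      using d by (intro indicator_UN_disjoint) (auto simp: disjoint_family_on_def)
    then have "(\<integral>x. indicator (\<Union>i<n. A i) x *\<^sub>R \<sigma> x \<partial>m) = (\<integral>x. (\<Sum>i<n. indicator (A i) x *\<^sub>R \<sigma> x) \<partial>m)"
      by (simp add: scaleR_sum_left)
    also have "\<dots> = (\<Sum>i<n. LINT x:A i|m. \<sigma> x)"
      unfolding set_lebesgue_integral_def using Am int
      by (intro Bochner_Integration.integral_sum integrable_mult_indicator)
    finally show ?thesis .
  qed
  ultimately show ?thesis
    unfolding sums_def set_lebesgue_integral_def by simp
qed

lemma matrix_measure_of_density:
  fixes \<sigma> :: "'a \<Rightarrow> real^'n^'n"
  assumes s: "sets m = sets M" and int: "integrable m \<sigma>" and sym: "\<And>x. \<sigma> x \<in> sym_mats"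
    and psd: "AE x in m. \<sigma> x \<in> psd_mats"
  shows "(\<lambda>E. LINT x:E|m. \<sigma> x) \<in> matrix_measures M"
  unfolding matrix_measures_def
proof (intro CollectI conjI ballI allI impI)
  have iE: "integrable m (\<lambda>x. indicator E x *\<^sub>R \<sigma> x)" if "E \<in> sets M" for E
    using that s int by (intro integrable_mult_indicator) auto
  fix E assume E: "E \<in> sets M"
  have "transpose (LINT x:E|m. \<sigma> x) = (\<integral>x. transpose (indicator E x *\<^sub>R \<sigma> x) \<partial>m)"
    unfolding set_lebesgue_integral_def
    by (rule integral_bounded_linear[OF bounded_linear_transpose iE[OF E], symmetric])
  also have "\<dots> = (LINT x:E|m. \<sigma> x)"
    unfolding set_lebesgue_integral_def
    using sym_mats_scaleR[OF sym] unfolding sym_mats_def by (intro Bochner_Integration.integral_cong) auto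
  finally have 1: "(LINT x:E|m. \<sigma> x) \<in> sym_mats" unfolding sym_mats_def by simp
  have "0 \<le> v \<bullet> ((LINT x:E|m. \<sigma> x) *v v)" for v
  proof -
    have bl: "bounded_linear (\<lambda>A :: real^'n^'n. v \<bullet> (A *v v))"
      by (intro linear_conv_bounded_linear[THEN iffD1] linearI)
        (auto simp: matrix_vector_mult_add_rdistrib scaleR_matrix_vector_assoc[symmetric] inner_add_right)
    have "v \<bullet> ((LINT x:E|m. \<sigma> x) *v v) = (\<integral>x. v \<bullet> ((indicator E x *\<^sub>R \<sigma> x) *v v) \<partial>m)"
      unfolding set_lebesgue_integral_def
      by (rule integral_bounded_linear[OF bl iE[OF E], symmetric])
    also have "0 \<le> \<dots>"
      using psd by (intro integral_nonneg_AE) (auto simp: psd_mats_def indicator_def elim: eventually_mono)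
    finally show ?thesis .
  qed
  with 1 show "(LINT x:E|m. \<sigma> x) \<in> psd_mats" unfolding psd_mats_def by simp
next
  show "(LINT x:{}|m. \<sigma> x) = 0" by (simp add: set_lebesgue_integral_def)
next
  fix A :: "nat \<Rightarrow> 'a set" assume A: "range A \<subseteq> sets M" and d: "disjoint_family A"
  then show "(\<lambda>i. LINT x:A i|m. \<sigma> x) sums (LINT x:(\<Union>i. A i)|m. \<sigma> x)"
    using int s by (intro set_integral_sums) auto
qed

lemma (in cost_function) cost_measurable:
  assumes "\<sigma> \<in> borel_measurable m" "\<And>x. \<sigma> x \<in> sym_mats"
  shows "(\<lambda>x. f (\<sigma> x)) \<in> borel_measurable m"
proof -
  obtain A :: "nat \<Rightarrow> real^'n^'n" where A: "\<And>M. M \<in> sym_mats \<Longrightarrow> f M = (SUP n. ennreal (A n \<bullet> M))"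
    using cost_as_supremum by metis
  have "(\<lambda>x. f (\<sigma> x)) = (\<lambda>x. SUP n. ennreal (A n \<bullet> \<sigma> x))" by (intro ext A assms(2))
  also have "\<dots> \<in> borel_measurable m" using assms(1) by measurable
  finally show ?thesis .
qed

text \<open>
  The density represents \<open>l\<close>, which is the gain on Hessians; this is the static equation. That the
  matrix measure is positive semidefinite comes from the cost: where \<open>f \<sigma>\<close> is finite, \<open>\<sigma>\<close> lies in the
  domain of \<open>f\<close>.
\<close>

lemma (in dual_bound) static_solution:
  obtains L where "static_competitor \<mu> \<nu> L" "action f borel L \<le> ennreal S"
proof -
  obtain l where l: "\<And>\<Phi> \<Psi>. bcont \<Phi> \<Longrightarrow> bcont \<Psi> \<Longrightarrow> l (\<lambda>x. \<Phi> x + \<Psi> x) = l \<Phi> + l \<Psi>"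
    "\<And>c \<Phi>. bcont \<Phi> \<Longrightarrow> l (\<lambda>x. c *\<^sub>R \<Phi> x) = c * l \<Phi>"
    "\<And>\<psi>. \<psi> \<in> Cb2 \<Longrightarrow> l (\<lambda>x. (1/2) *\<^sub>R hessian \<psi> x) = gain \<mu> \<nu> \<psi>"
    "\<And>\<Phi>. bcont \<Phi> \<Longrightarrow> (\<And>x. \<Phi> x \<in> admissible f) \<Longrightarrow> l \<Phi> \<le> S"
    "\<And>\<Phi>. bcont \<Phi> \<Longrightarrow> (\<And>x M. M \<in> dom_fun f \<Longrightarrow> 0 \<le> \<Phi> x \<bullet> M) \<Longrightarrow> 0 \<le> l \<Phi>"
    by (rule extended_functional) blast
  have "\<exists>m \<sigma>. finite_measure m \<and> sets m = sets borel \<and> integrable m \<sigma> \<and> (\<forall>x. \<sigma> x \<in> sym_mats) \<and>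
      (\<forall>\<Phi>. bcont \<Phi> \<longrightarrow> l \<Phi> = (\<integral>x. \<Phi> x \<bullet> \<sigma> x \<partial>m))"
  proof (rule density_representation[OF l(1,2,3,5)])
    fix m \<sigma>
    assume "finite_measure m" "sets m = sets borel" "integrable m \<sigma>" "\<And>x. \<sigma> x \<in> sym_mats"
      "\<And>\<Phi>. bcont \<Phi> \<Longrightarrow> l \<Phi> = (\<integral>x. \<Phi> x \<bullet> \<sigma> x \<partial>m)"
    then show ?thesis by (intro exI[of _ m] exI[of _ \<sigma>]) simp
  qed
  then obtain m \<sigma> where m: "finite_measure m" "sets m = sets borel" and \<sigma>: "integrable m \<sigma>" "\<And>x. \<sigma> x \<in> sym_mats"
    and rep: "\<And>\<Phi>. bcont \<Phi> \<Longrightarrow> l \<Phi> = (\<integral>x. \<Phi> x \<bullet> \<sigma> x \<partial>m)"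
    by blast
  interpret field_bound m \<sigma> "admissible f" S
  proof (rule field_bound.intro)
    show "(\<integral>x. \<Psi> x \<bullet> \<sigma> x \<partial>m) \<le> S" if "bcont \<Psi>" "\<And>x. \<Psi> x \<in> admissible f" for \<Psi>
      using l(4)[OF that] unfolding rep[OF that(1)] .
  qed (fact m \<sigma>(1) convex_admissible zero_admissible)+
  obtain A where A: "\<And>n::nat. A n \<in> admissible f" "\<And>M. M \<in> sym_mats \<Longrightarrow> f M = (SUP n. ennreal (A n \<bullet> M))"
    using cost_as_supremum by metis
  have cost: "(\<integral>\<^sup>+x. f (\<sigma> x) \<partial>m) \<le> ennreal S"
    using nn_integral_SUP_le[OF A(1)] A(2)[OF \<sigma>(2)] by simp
  have fm: "(\<lambda>x. f (\<sigma> x)) \<in> borel_measurable m" using \<sigma> by (intro cost_measurable) auto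
  have "(\<integral>\<^sup>+x. f (\<sigma> x) \<partial>m) \<noteq> \<infinity>" using cost by (auto simp: top_unique)
  then have "AE x in m. f (\<sigma> x) \<noteq> \<infinity>" using fm by (intro nn_integral_noteq_infinite)
  then have psd: "AE x in m. \<sigma> x \<in> psd_mats"
  proof eventually_elim
    case (elim x)
    then have "f (\<sigma> x) < \<infinity>" by (metis infinity_ennreal_def top.not_eq_extremum)
    then have "\<sigma> x \<in> dom_fun f" using \<sigma>(2) unfolding dom_fun_def by simp
    then show ?case using dom_psd by blast
  qed
  define L where "L E = (LINT x:E|m. \<sigma> x)" for E
  have Lm: "L \<in> matrix_measures borel"
    unfolding L_def[abs_def] using m(2) \<sigma> psd by (intro matrix_measure_of_density) auto
  interpret D: density_measure borel m L \<sigma>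
    by (intro density_measure.intro m \<sigma> L_def)
  show ?thesis
  proof (rule that)
    show "static_competitor \<mu> \<nu> L"
      unfolding static_competitor_def
    proof (intro conjI ballI Lm)
      show "emeasure (total_variation borel L) UNIV < \<infinity>"
        unfolding D.total_variation_eq using D.variation_finite D.space_m by simp
      fix \<psi> :: "real^'a \<Rightarrow> real" assume \<psi>: "\<psi> \<in> Cb2"
      have "(\<lambda>x. (1/2) *\<^sub>R hessian \<psi> x) \<in> borel_measurable m"
        using bcont_measurable[OF bcont_hessian[OF \<psi>]] m(2) by (simp cong: measurable_cong_sets)
      then have "matrix_integral borel L (\<lambda>x. (1/2) *\<^sub>R hessian \<psi> x) = l (\<lambda>x. (1/2) *\<^sub>R hessian \<psi> x)"
        using D.matrix_integral_eq rep[OF bcont_hessian[OF \<psi>]] by simp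
      then show "matrix_integral borel L (\<lambda>x. (1/2) *\<^sub>R hessian \<psi> x) = (LINT x|\<nu>. \<psi> x) - (LINT x|\<mu>. \<psi> x)"
        using l(3)[OF \<psi>] by (simp add: gain_def)
    qed
    have "action f borel L = (\<integral>\<^sup>+x. f (\<sigma> x) \<partial>m)"
      by (rule D.action_eq[OF cost_measurable[OF D.polar_measurable D.polar_density_spec(2)]])
        (use homogeneous in auto)
    with cost show "action f borel L \<le> ennreal S" by simp
  qed
qed


section \<open>Weak duality\<close>

text \<open>
  This holds without integrability because the Bochner integral of a function that is not integrable
  is \<open>0\<close>. In the weak duality it spares a discussion of integrability.
\<close>

lemma ennreal_integral_le_nn_integral: "ennreal (integral\<^sup>L M h) \<le> (\<integral>\<^sup>+x. ennreal (h x) \<partial>M)" for h :: "'a \<Rightarrow> real"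
proof (cases "integrable M h")
  case True
  have "ennreal (integral\<^sup>L M h) \<le> ennreal (enn2real (\<integral>\<^sup>+x. ennreal (h x) \<partial>M))"
    unfolding real_lebesgue_integral_def[OF True] by (intro ennreal_leI) simp
  also have "\<dots> \<le> (\<integral>\<^sup>+x. ennreal (h x) \<partial>M)" by (simp add: ennreal_enn2real_if)
  finally show ?thesis .
qed (simp add: not_integrable_integral_eq)

lemma polar_density_sym:
  assumes "L \<in> matrix_measures M" shows "polar_density M L x \<in> sym_mats"
proof -
  obtain \<sigma> where "density_measure M (trace_measure M L) L \<sigma>"
    using matrix_measure_has_density[OF assms] by metis
  then show ?thesis by (rule density_measure.polar_density_spec(2))
qed

text \<open>
  Weak duality at a single point, \<open>A \<bullet> M \<le> f M\<close>, integrated.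
\<close>

lemma (in cost_function) matrix_integral_le_action:
  assumes "L \<in> matrix_measures M" "\<And>x. A x \<in> admissible f"
  shows "ennreal (matrix_integral M L A) \<le> action f M L"
proof -
  have "ennreal (matrix_integral M L A) \<le> (\<integral>\<^sup>+x. ennreal (A x \<bullet> polar_density M L x) \<partial>total_variation M L)"
    unfolding matrix_integral_def by (rule ennreal_integral_le_nn_integral)
  also have "\<dots> \<le> action f M L"
    unfolding action_def by (intro nn_integral_mono admissible_le assms polar_density_sym)
  finally show ?thesis .
qed

lemma (in cost_function) static_weak_duality:
  assumes "static_competitor \<mu> \<nu> L" "feasible f \<psi>"
  shows "ennreal (gain \<mu> \<nu> \<psi>) \<le> action f borel L"
proof -
  have "gain \<mu> \<nu> \<psi> = matrix_integral borel L (\<lambda>x. (1/2) *\<^sub>R hessian \<psi> x)"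
    using assms unfolding static_competitor_def gain_def by auto
  then show ?thesis
    using matrix_integral_le_action[of L borel "\<lambda>x. (1/2) *\<^sub>R hessian \<psi> x"] assms
    unfolding static_competitor_def by auto
qed

text \<open>
  For positive semidefinite values the total variation is comparable to the trace, which is additive. So the
  trace of the total mass, a single number that is integrable in time for a disintegration, bounds all integrals
  against \<open>L\<close>.
\<close>

lemma (in density_measure) variation_le_trace:
  assumes L: "L \<in> matrix_measures M"
  shows "(\<integral>x. norm (\<sigma> x) \<partial>m) \<le> real (CARD('n) * CARD('n)) * trace (L (space M))"
proof -
  let ?c = "real (CARD('n) * CARD('n))"
  have psd: "L E \<in> psd_mats" if "E \<in> sets M" for E using L that unfolding matrix_measures_def by blast
  have tr0: "0 \<le> trace (L E)" if "E \<in> sets M" for E by (rule psd_trace_nonneg[OF psd[OF that]])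
  have "emeasure variation (space m) \<le> ennreal (?c * trace (L (space M)))"
  proof (rule ennreal_le_epsilon)
    fix e :: real assume e: "0 < e"
    obtain A :: "nat \<Rightarrow> 'a set" where A: "range A \<subseteq> sets m" "disjoint_family A" "(\<Union>i. A i) = space m"
      "emeasure variation (space m) \<le> (\<Sum>i. ennreal (norm (L (A i)))) + ennreal e"
      using variation_lower[OF sets.top e] by metis
    have Am: "A i \<in> sets M" for i using A(1) sets_m by auto
    have "(\<lambda>i. L (A i)) sums L (space M)"
      using L A(1-3) sets_m space_m unfolding matrix_measures_def by (metis (mono_tags, lifting) mem_Collect_eq)
    then have "(\<lambda>i. mat 1 \<bullet> L (A i)) sums (mat 1 \<bullet> L (space M))"
      by (rule bounded_linear.sums[OF bounded_linear_inner_right])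
    then have "(\<lambda>i. ?c * trace (L (A i))) sums (?c * trace (L (space M)))"
      unfolding trace_eq_inner by (rule sums_mult)
    then have "(\<Sum>i. ennreal (?c * trace (L (A i)))) = ennreal (?c * trace (L (space M)))"
      using tr0[OF Am] by (intro suminf_ennreal_eq) auto
    moreover have "(\<Sum>i. ennreal (norm (L (A i)))) \<le> (\<Sum>i. ennreal (?c * trace (L (A i))))"
      using psd_norm_le_trace[OF psd[OF Am]] by (intro suminf_le ennreal_leI) auto
    ultimately show "emeasure variation (space m) \<le> ennreal (?c * trace (L (space M))) + ennreal e"
      using A(4) by (metis add_right_mono order_trans)
  qed
  moreover have "emeasure variation (space m) = ennreal (\<integral>x. norm (\<sigma> x) \<partial>m)"
    using int by (simp add: emeasure_variation nn_integral_set_ennreal nn_integral_eq_integral)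
  ultimately show ?thesis
    using tr0[of "space M"] by (simp add: ennreal_le_iff)
qed

lemma matrix_integral_bound:
  fixes L :: "'a set \<Rightarrow> real^'n^'n"
  assumes Lm: "L \<in> matrix_measures M" and A: "A \<in> borel_measurable M" "\<And>x. norm (A x) \<le> B"
  shows "\<bar>matrix_integral M L A\<bar> \<le> B * (real (CARD('n) * CARD('n)) * trace (L (space M)))"
proof -
  obtain \<sigma> where d: "density_measure M (trace_measure M L) L \<sigma>"
    using matrix_measure_has_density[OF Lm] by metis
  interpret density_measure M "trace_measure M L" L \<sigma> by (rule d)
  have Am: "A \<in> borel_measurable (trace_measure M L)" using A(1) sets_m by (simp cong: measurable_cong_sets)
  have B: "0 \<le> B" using A(2) norm_ge_zero order_trans by blast
  have "\<bar>matrix_integral M L A\<bar> = norm (\<integral>x. A x \<bullet> \<sigma> x \<partial>trace_measure M L)"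
    by (simp add: matrix_integral_eq[OF Am])
  also have "\<dots> \<le> (\<integral>x. norm (A x \<bullet> \<sigma> x) \<partial>trace_measure M L)" by (rule integral_norm_bound)
  also have "\<dots> \<le> (\<integral>x. B * norm (\<sigma> x) \<partial>trace_measure M L)"
  proof (rule integral_mono)
    show "integrable (trace_measure M L) (\<lambda>x. norm (A x \<bullet> \<sigma> x))"
      by (intro integrable_norm integrable_inner_bounded[OF int Am A(2)])
    show "integrable (trace_measure M L) (\<lambda>x. B * norm (\<sigma> x))" using int by simp
    fix x
    show "norm (A x \<bullet> \<sigma> x) \<le> B * norm (\<sigma> x)"
      using Cauchy_Schwarz_ineq2[of "A x" "\<sigma> x"] mult_right_mono[OF A(2)[of x], of "norm (\<sigma> x)"] by simp
  qed
  also have "\<dots> = B * (\<integral>x. norm (\<sigma> x) \<partial>trace_measure M L)" by simp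
  also have "\<dots> \<le> B * (real (CARD('n) * CARD('n)) * trace (L (space M)))"
    using variation_le_trace[OF Lm] B by (intro mult_left_mono)
  finally show ?thesis .
qed

lemma matrix_integral_dominated:
  fixes L :: "'a set \<Rightarrow> real^'n^'n"
  assumes Lm: "L \<in> matrix_measures M" and A: "\<And>k. A k \<in> borel_measurable M" "A' \<in> borel_measurable M"
    and B: "\<And>k x. norm (A k x) \<le> B" and lim: "\<And>x. x \<in> space M \<Longrightarrow> (\<lambda>k. A k x) \<longlonglongrightarrow> A' x"
  shows "(\<lambda>k. matrix_integral M L (A k)) \<longlonglongrightarrow> matrix_integral M L A'"
proof -
  obtain \<sigma> where d: "density_measure M (trace_measure M L) L \<sigma>"
    using matrix_measure_has_density[OF Lm] by metis
  interpret density_measure M "trace_measure M L" L \<sigma> by (rule d)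
  have Am [measurable]: "A k \<in> borel_measurable (trace_measure M L)" "A' \<in> borel_measurable (trace_measure M L)" for k
    using A sets_m by (simp_all cong: measurable_cong_sets)
  have "(\<lambda>k. \<integral>x. A k x \<bullet> \<sigma> x \<partial>trace_measure M L) \<longlonglongrightarrow> (\<integral>x. A' x \<bullet> \<sigma> x \<partial>trace_measure M L)"
  proof (rule integral_dominated_convergence)
    show "integrable (trace_measure M L) (\<lambda>x. B * norm (\<sigma> x))" using int by simp
    show "AE x in trace_measure M L. (\<lambda>k. A k x \<bullet> \<sigma> x) \<longlonglongrightarrow> A' x \<bullet> \<sigma> x"
      using lim space_m by (intro AE_I2 tendsto_inner tendsto_const) auto
    show "AE x in trace_measure M L. norm (A k x \<bullet> \<sigma> x) \<le> B * norm (\<sigma> x)" for k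
    proof (rule AE_I2)
      fix x
      show "norm (A k x \<bullet> \<sigma> x) \<le> B * norm (\<sigma> x)"
        using Cauchy_Schwarz_ineq2[of "A k x" "\<sigma> x"] mult_right_mono[OF B[of k x], of "norm (\<sigma> x)"] by simp
    qed
  qed measurable
  then show ?thesis by (simp add: matrix_integral_eq)
qed

lemma matrix_integral_simple:
  fixes L :: "'a set \<Rightarrow> real^'n^'n"
  assumes Lm: "L \<in> matrix_measures M" and s: "simple_function M s"
  shows "matrix_integral M L s = (\<Sum>y\<in>s ` space M. y \<bullet> L (s -` {y} \<inter> space M))"
proof -
  obtain \<sigma> where d: "density_measure M (trace_measure M L) L \<sigma>"
    using matrix_measure_has_density[OF Lm] by metis
  interpret density_measure M "trace_measure M L" L \<sigma> by (rule d)
  have fin: "finite (s ` space M)" and meas: "\<And>y. s -` {y} \<inter> space M \<in> sets M"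
    using s by (auto simp: simple_function_def intro: simple_functionD)
  have "s \<in> borel_measurable M" using s by (rule borel_measurable_simple_function)
  then have sm: "s \<in> borel_measurable (trace_measure M L)" using sets_m by (simp cong: measurable_cong_sets)
  have "(\<integral>x. s x \<bullet> \<sigma> x \<partial>trace_measure M L)
    = (\<integral>x. (\<Sum>y\<in>s ` space M. y \<bullet> (indicator (s -` {y} \<inter> space M) x *\<^sub>R \<sigma> x)) \<partial>trace_measure M L)"
  proof (rule Bochner_Integration.integral_cong[OF refl])
    fix x assume "x \<in> space (trace_measure M L)"
    then have x: "x \<in> space M" by (simp add: space_m)
    have "(\<Sum>y\<in>s ` space M. y \<bullet> (indicator (s -` {y} \<inter> space M) x *\<^sub>R \<sigma> x))
      = (\<Sum>y\<in>s ` space M. if y = s x then s x \<bullet> \<sigma> x else 0)"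
      using x by (intro sum.cong) (auto simp: indicator_def)
    then show "s x \<bullet> \<sigma> x = (\<Sum>y\<in>s ` space M. y \<bullet> (indicator (s -` {y} \<inter> space M) x *\<^sub>R \<sigma> x))"
      using fin x by simp
  qed
  also have "\<dots> = (\<Sum>y\<in>s ` space M. \<integral>x. y \<bullet> (indicator (s -` {y} \<inter> space M) x *\<^sub>R \<sigma> x) \<partial>trace_measure M L)"
    using meas sets_m by (intro Bochner_Integration.integral_sum integrable_inner_right int_E) auto
  also have "\<dots> = (\<Sum>y\<in>s ` space M. y \<bullet> L (s -` {y} \<inter> space M))"
  proof (rule sum.cong[OF refl])
    fix y
    have "(\<integral>x. y \<bullet> (indicator (s -` {y} \<inter> space M) x *\<^sub>R \<sigma> x) \<partial>trace_measure M L)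
      = y \<bullet> (\<integral>x. indicator (s -` {y} \<inter> space M) x *\<^sub>R \<sigma> x \<partial>trace_measure M L)"
      using meas sets_m by (intro integral_inner_right int_E) auto
    then show "(\<integral>x. y \<bullet> (indicator (s -` {y} \<inter> space M) x *\<^sub>R \<sigma> x) \<partial>trace_measure M L) = y \<bullet> L (s -` {y} \<inter> space M)"
      using L[OF meas] by (simp add: set_lebesgue_integral_def)
  qed
  finally show ?thesis by (simp add: matrix_integral_eq[OF sm])
qed

subsection \<open>Integrals against the fibres of a disintegration\<close>

lemma fibre_measurable:
  assumes "matrix_disintegration L Lt" "B \<in> sets borel"
  shows "(\<lambda>t. Lt t B) \<in> borel_measurable time" "integrable time (\<lambda>t. Lt t B)"
proof -
  have "{0<..<1::real} \<times> B \<in> sets borel"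
    using assms(2) by (intro borel_Times) auto
  then have "{0<..<1::real} \<times> B \<in> sets spacetime"
    by (subst sets_restrict_space_iff) (auto simp: open_Times)
  then have "has_bochner_integral time (\<lambda>t. Lt t (Pair t -` ({0<..<1} \<times> B))) (L ({0<..<1} \<times> B))"
    using assms(1) unfolding matrix_disintegration_def by blast
  then have i: "integrable time (\<lambda>t. Lt t (Pair t -` ({0<..<1} \<times> B)))" by (simp add: has_bochner_integral_iff)
  have "Pair t -` ({0<..<1} \<times> B) = B" if "t \<in> space time" for t
    using that by (auto simp: space_restrict_space)
  then show i': "integrable time (\<lambda>t. Lt t B)"
    using i by (subst Bochner_Integration.integrable_cong[OF refl, of _ _ "\<lambda>t. Lt t (Pair t -` ({0<..<1} \<times> B))"]) auto
  then show "(\<lambda>t. Lt t B) \<in> borel_measurable time" by simp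
qed

text \<open>
  A disintegration provides measurability of \<open>t \<mapsto> \<lambda>\<^sub>t B\<close> for sets \<open>B\<close> only. It passes to integrals of
  simple functions, and by dominated convergence on each fibre to bounded Borel fields.
\<close>

lemma fibre_integral_measurable:
  fixes A :: "real^'n \<Rightarrow> real^'n^'n"
  assumes dis: "matrix_disintegration L Lt" and A: "A \<in> borel_measurable borel" "\<And>x. norm (A x) \<le> B"
  shows "(\<lambda>t. matrix_integral borel (Lt t) A) \<in> borel_measurable time"
proof -
  have Lt: "Lt t \<in> matrix_measures borel" if "t \<in> space time" for t
    using dis that unfolding matrix_disintegration_def by (simp add: space_restrict_space)
  obtain s where s: "\<And>k::nat. simple_function borel (s k)" "\<And>x. (\<lambda>k. s k x) \<longlonglongrightarrow> A x"
    "\<And>k x. norm (s k x) \<le> 2 * norm (A x)"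
    using borel_measurable_implies_sequence_metric[OF A(1), of 0] by (auto simp: dist_norm)
  have sB: "norm (s k x) \<le> 2 * B" for k x using s(3)[of k x] A(2)[of x] by linarith
  have sm: "s k \<in> borel_measurable borel" for k using s(1) by (rule borel_measurable_simple_function)
  show ?thesis
  proof (rule borel_measurable_LIMSEQ_metric)
    show "(\<lambda>k. matrix_integral borel (Lt t) (s k)) \<longlonglongrightarrow> matrix_integral borel (Lt t) A"
      if "t \<in> space time" for t
      by (rule matrix_integral_dominated[OF Lt[OF that] sm A(1) sB s(2)])
    fix k
    have "s k -` {y} \<inter> space borel \<in> sets borel" for y using s(1)[of k] by (rule simple_functionD)
    then have "(\<lambda>t. \<Sum>y\<in>s k ` space borel. y \<bullet> Lt t (s k -` {y} \<inter> space borel)) \<in> borel_measurable time"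
      by (intro borel_measurable_sum borel_measurable_inner borel_measurable_const fibre_measurable(1)[OF dis])
    then show "(\<lambda>t. matrix_integral borel (Lt t) (s k)) \<in> borel_measurable time"
      by (subst measurable_cong[OF matrix_integral_simple[OF Lt s(1)]])
  qed
qed

text \<open>
  The dominating function for all limits under the time integral.
\<close>

lemma fibre_trace_integrable:
  assumes "matrix_disintegration L Lt"
  shows "integrable time (\<lambda>t. c * trace (Lt t UNIV))"
  unfolding trace_eq_inner
  by (intro integrable_mult_right integrable_inner_right fibre_measurable(2)[OF assms]) simp

lemma fibre_integral_integrable:
  fixes A :: "real^'n \<Rightarrow> real^'n^'n"
  assumes dis: "matrix_disintegration L Lt" and A: "A \<in> borel_measurable borel" "\<And>x. norm (A x) \<le> B"
  shows "integrable time (\<lambda>t. matrix_integral borel (Lt t) A)"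
proof (rule Bochner_Integration.integrable_bound[OF fibre_trace_integrable[OF dis, of "B * real (CARD('n) * CARD('n))"]])
  show "AE t in time. norm (matrix_integral borel (Lt t) A) \<le> norm (B * real (CARD('n) * CARD('n)) * trace (Lt t UNIV))"
  proof (rule AE_I2)
    fix t assume "t \<in> space time"
    then have "Lt t \<in> matrix_measures borel"
      using dis unfolding matrix_disintegration_def by (simp add: space_restrict_space)
    from matrix_integral_bound[OF this A]
    show "norm (matrix_integral borel (Lt t) A) \<le> norm (B * real (CARD('n) * CARD('n)) * trace (Lt t UNIV))"
      by (simp add: mult.assoc)
  qed
qed (rule fibre_integral_measurable[OF assms])


subsection \<open>Cut-off functions in time\<close>

lemma DERIV_max0_square: "((\<lambda>v::real. (max 0 v)\<^sup>2) has_real_derivative 2 * max 0 v) (at v)"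
proof -
  consider "v < 0" | "v = 0" | "0 < v" by linarith
  then show ?thesis
  proof cases
    case 1
    have d: "((\<lambda>v::real. 0) has_real_derivative 0) (at v)" by simp
    have "\<forall>\<^sub>F w in nhds v. w \<in> {..<0}" using 1 by (intro eventually_nhds_in_open) auto
    then have "\<forall>\<^sub>F w in nhds v. (max 0 w)\<^sup>2 = (0::real)" by eventually_elim simp
    from DERIV_cong_ev[OF refl this, of "2 * max 0 v" 0] d 1 show ?thesis by simp
  next
    case 2
    have "((\<lambda>h::real. ((max 0 h)\<^sup>2) / h) \<longlongrightarrow> 0) (at 0)"
    proof (rule Lim_null_comparison)
      show "\<forall>\<^sub>F h in at (0::real). norm ((max 0 h)\<^sup>2 / h) \<le> \<bar>h\<bar>"
        by (intro always_eventually) (auto simp: max_def power2_eq_square)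
      show "((\<lambda>h::real. \<bar>h\<bar>) \<longlongrightarrow> 0) (at 0)" by (rule tendsto_rabs_zero) (rule tendsto_ident_at)
    qed
    then show ?thesis unfolding 2 has_field_derivative_def[symmetric] DERIV_def by simp
  next
    case 3
    have d: "((\<lambda>v::real. v\<^sup>2) has_real_derivative 2 * v) (at v)"
      by (auto intro!: derivative_eq_intros)
    have "\<forall>\<^sub>F w in nhds v. w \<in> {0<..}" using 3 by (intro eventually_nhds_in_open) auto
    then have "\<forall>\<^sub>F w in nhds v. (max 0 w)\<^sup>2 = w\<^sup>2" by eventually_elim simp
    from DERIV_cong_ev[OF refl this, of "2 * max 0 v" "2 * v"] d 3 show ?thesis by simp
  qed
qed

lemma continuous_on_Icc_bound:
  fixes g :: "real \<Rightarrow> real"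
  assumes "continuous_on {a..b} g" obtains B where "\<And>t. t \<in> {a..b} \<Longrightarrow> \<bar>g t\<bar> \<le> B"
proof -
  have "bounded (g ` {a..b})" using assms by (intro compact_imp_bounded compact_continuous_image) auto
  then obtain B where "\<forall>y\<in>g ` {a..b}. norm y \<le> B" unfolding bounded_iff by blast
  then show ?thesis by (intro that[of B]) auto
qed

text \<open>A continuously differentiable step from \<open>0\<close> to \<open>1\<close> on \<open>[1,2]\<close>; its derivative is a tent.\<close>

definition step :: "real \<Rightarrow> real" where
  "step s = 2 * (max 0 (s - 1))\<^sup>2 - 4 * (max 0 (s - 3/2))\<^sup>2 + 2 * (max 0 (s - 2))\<^sup>2"

definition tent :: "real \<Rightarrow> real" where
  "tent s = 4 * max 0 (s - 1) - 8 * max 0 (s - 3/2) + 4 * max 0 (s - 2)"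

lemma DERIV_step: "(step has_real_derivative tent s) (at s)"
proof -
  have d: "((\<lambda>s. (max 0 (s - a))\<^sup>2) has_real_derivative 2 * max 0 (s - a)) (at s)" for a
  proof -
    have "((\<lambda>s. s - a) has_real_derivative 1) (at s)" by (auto intro!: derivative_eq_intros)
    from DERIV_chain2[OF DERIV_max0_square this] show ?thesis by simp
  qed
  have "(step has_real_derivative 2 * (2 * max 0 (s - 1)) - 4 * (2 * max 0 (s - 3/2)) + 2 * (2 * max 0 (s - 2))) (at s)"
    unfolding step_def[abs_def] by (intro DERIV_add DERIV_diff DERIV_cmult d)
  then show ?thesis by (simp add: tent_def)
qed

lemma step_below: "s \<le> 1 \<Longrightarrow> step s = 0" unfolding step_def by simp

lemma step_above: "2 \<le> s \<Longrightarrow> step s = 1"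
  unfolding step_def by (simp add: max_def power2_eq_square algebra_simps)

lemma tent_outside: "s \<le> 1 \<or> 2 \<le> s \<Longrightarrow> tent s = 0"
  unfolding tent_def by (auto simp: max_def)

lemma tent_nonneg: "0 \<le> tent s" unfolding tent_def by (auto simp: max_def)

lemma continuous_tent: "continuous_on A tent"
  unfolding tent_def[abs_def] by (intro continuous_intros)

lemma continuous_step: "continuous_on A step"
  unfolding step_def[abs_def] by (intro continuous_intros)

lemma tent_integral: "has_bochner_integral lborel tent 1"
proof -
  have "has_bochner_integral lborel (\<lambda>x. tent x * indicator {1..2} x) (step 2 - step 1)"
    by (rule has_bochner_integral_FTC_Icc_real) (auto intro: DERIV_step continuous_on_interior
        simp: continuous_on_eq_continuous_within continuous_tent[unfolded continuous_on_eq_continuous_within, of UNIV, simplified])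
  moreover have "tent x * indicator {1..2} x = tent x" for x
    by (cases "x \<in> {1..2}") (use tent_outside[of x] in auto)
  ultimately show ?thesis by (simp add: step_below step_above)
qed

lemma step_bounded: obtains C where "0 \<le> C" "\<And>s. \<bar>step s\<bar> \<le> C"
proof -
  obtain B where B: "\<And>s. s \<in> {1..2} \<Longrightarrow> \<bar>step s\<bar> \<le> B"
    using continuous_on_Icc_bound[OF continuous_step] by blast
  have "\<bar>step s\<bar> \<le> max 1 B" for s
    using B[of s] step_below[of s] step_above[of s] by (cases "s \<le> 1"; cases "2 \<le> s") auto
  then show ?thesis using that[of "max 1 B"] by simp
qed

text \<open>
  A step up at time \<open>0\<close> and, reflected, one down at time \<open>1\<close>, each of width of order \<open>1 / n\<close>. Both steps equal \<open>1\<close>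
  in between, hence the subtraction of \<open>1\<close>.
\<close>

definition cutoff :: "nat \<Rightarrow> real \<Rightarrow> real" where
  "cutoff n t = step (real n * t) + step (real n * (1 - t)) - 1"

definition cutoff' :: "nat \<Rightarrow> real \<Rightarrow> real" where
  "cutoff' n t = real n * tent (real n * t) - real n * tent (real n * (1 - t))"

lemma DERIV_cutoff: "(cutoff n has_real_derivative cutoff' n t) (at t)"
proof -
  have 1: "((\<lambda>t. real n * t) has_real_derivative real n) (at t)"
    and 2: "((\<lambda>t. real n * (1 - t)) has_real_derivative - real n) (at t)"
    by (auto intro!: derivative_eq_intros)
  have "(cutoff n has_real_derivative tent (real n * t) * real n + tent (real n * (1 - t)) * - real n - 0) (at t)"
    unfolding cutoff_def[abs_def]
    by (intro DERIV_add DERIV_diff DERIV_const DERIV_chain2[OF DERIV_step 1] DERIV_chain2[OF DERIV_step 2])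
  then show ?thesis by (simp add: cutoff'_def mult.commute)
qed

lemma cutoff_near_ends:
  assumes n: "3 \<le> n" and t: "t \<le> 1 / real n \<or> 1 - 1 / real n \<le> t"
  shows "cutoff n t = 0"
proof -
  have *: "cutoff n t = 0" if "t \<le> 1 / real n" for t
  proof -
    \<comment> \<open>one step vanishes and the other one must already be 1; this needs n - 1 \<ge> 2\<close>
    have 1: "real n * t \<le> 1" using that n by (simp add: field_simps)
    then have "2 \<le> real n * (1 - t)" using n by (simp add: algebra_simps)
    with 1 show ?thesis by (simp add: cutoff_def step_below step_above)
  qed
  have "cutoff n t = cutoff n (1 - t)" unfolding cutoff_def by simp
  with *[of t] *[of "1 - t"] t show ?thesis by auto
qed

lemma cutoff_tendsto:
  assumes t: "t \<in> {0<..<1}" shows "(\<lambda>n. cutoff n t) \<longlonglongrightarrow> 1"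
proof -
  have *: "\<forall>\<^sub>F n in sequentially. step (real n * t) = 1" if "0 < t" for t
  proof -
    obtain N where N: "2 / t < real N" using reals_Archimedean2 by blast
    have "step (real n * t) = 1" if "N \<le> n" for n
    proof -
      have "2 / t \<le> real n" using N that by simp
      then have "2 \<le> real n * t" using \<open>0 < t\<close> by (simp add: field_simps)
      then show ?thesis by (rule step_above)
    qed
    then show ?thesis by (rule eventually_sequentiallyI)
  qed
  have "\<forall>\<^sub>F n in sequentially. cutoff n t = 1"
    using *[of t] *[of "1 - t"] t by (auto simp: cutoff_def elim: eventually_elim2)
  then show ?thesis by (rule tendsto_eventually)
qed

text \<open>Rescaled tents concentrate at the end point from which they are scaled.\<close>

lemma tent_concentrates:
  fixes u :: "real \<Rightarrow> real"
  assumes u: "continuous_on {0..1} u"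
  shows "(\<lambda>n. LINT t|time. real n * tent (real n * t) * u t) \<longlonglongrightarrow> u 0"
proof -
  obtain B where B: "\<And>t. t \<in> {0..1} \<Longrightarrow> \<bar>u t\<bar> \<le> B"
    using continuous_on_Icc_bound[OF u] by blast
  \<comment> \<open>extension by 0, so that time can be rescaled on the whole line\<close>
  define v where "v t = indicator {0<..<1} t * u t" for t
  have vm [measurable]: "v \<in> borel_measurable borel"
  proof -
    have "continuous_on {0<..<1} u" using u by (rule continuous_on_subset) auto
    then have "(\<lambda>t. indicator {0<..<1} t *\<^sub>R u t) \<in> borel_measurable borel"
      by (intro borel_measurable_continuous_on_indicator) auto
    then show ?thesis unfolding v_def[abs_def] by simp
  qed
  have vB: "\<bar>v t\<bar> \<le> \<bar>B\<bar>" for t unfolding v_def using B[of t] by (auto simp: indicator_def)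
  have tm [measurable]: "tent \<in> borel_measurable borel"
    by (rule borel_measurable_continuous_onI[OF continuous_tent])
  have eq: "(LINT t|time. real n * tent (real n * t) * u t) = (LINT s|lborel. tent s * v (s / real n))" if n: "0 < n" for n
  proof -
    have "(LINT t|time. real n * tent (real n * t) * u t) = (LINT t|lborel. real n * tent (real n * t) * v t)"
      by (subst integral_restrict_space) (auto simp: v_def mult_ac intro!: Bochner_Integration.integral_cong)
    also have "\<dots> = \<bar>1 / real n\<bar> *\<^sub>R (LINT s|lborel. real n * tent (real n * (0 + 1 / real n * s)) * v (0 + 1 / real n * s))"
      using n by (intro lborel_integral_real_affine) auto
    also have "\<dots> = (LINT s|lborel. tent s * v (s / real n))"
      using n by (simp add: mult.assoc)
    finally show ?thesis .
  qed
  have "(\<lambda>n. LINT s|lborel. tent s * v (s / real n)) \<longlonglongrightarrow> (LINT s|lborel. tent s * u 0)"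
  proof (rule integral_dominated_convergence)
    show "integrable lborel (\<lambda>s. tent s * \<bar>B\<bar>)" using tent_integral by (auto simp: has_bochner_integral_iff)
    show "AE s in lborel. norm (tent s * v (s / real n)) \<le> tent s * \<bar>B\<bar>" for n
      using vB tent_nonneg by (intro AE_I2) (simp add: abs_mult mult_left_mono)
    show "AE s in lborel. (\<lambda>n. tent s * v (s / real n)) \<longlonglongrightarrow> tent s * u 0"
    proof (rule AE_I2)
      fix s :: real
      show "(\<lambda>n. tent s * v (s / real n)) \<longlonglongrightarrow> tent s * u 0"
      proof (cases "1 < s \<and> s < 2")
        case False
        then have "tent s = 0" by (intro tent_outside) auto
        then show ?thesis by simp
      next
        case True
        have in01: "\<forall>\<^sub>F n in sequentially. s / real n \<in> {0<..<1}"
          using True by (intro eventually_sequentiallyI[of 2]) (auto simp: field_simps)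
        have "(\<lambda>n. s / real n) \<longlonglongrightarrow> 0" by (rule lim_const_over_n)
        then have "((\<lambda>n. u (s / real n)) \<longlongrightarrow> u 0) sequentially"
          using u in01 by (intro continuous_on_tendsto_compose[OF u]) (auto elim: eventually_mono)
        moreover have "\<forall>\<^sub>F n in sequentially. u (s / real n) = v (s / real n)"
          using in01 by eventually_elim (auto simp: v_def)
        ultimately have "(\<lambda>n. v (s / real n)) \<longlonglongrightarrow> u 0" by (rule Lim_transform_eventually)
        then show ?thesis by (intro tendsto_intros)
      qed
    qed
  qed measurable
  also have "(LINT s|lborel. tent s * u 0) = u 0"
    using tent_integral by (simp add: has_bochner_integral_iff)
  finally have "(\<lambda>n. LINT s|lborel. tent s * v (s / real n)) \<longlonglongrightarrow> u 0" .
  moreover have "\<forall>\<^sub>F n in sequentially. (LINT s|lborel. tent s * v (s / real n)) = (LINT t|time. real n * tent (real n * t) * u t)"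
    using eq by (intro eventually_sequentiallyI[of 1]) simp
  ultimately show ?thesis by (rule Lim_transform_eventually)
qed

lemma time_reflect:
  fixes u :: "real \<Rightarrow> real" shows "(LINT t|time. u (1 - t)) = (LINT t|time. u t)"
proof -
  have "(LINT t|time. u t) = (LINT t|lborel. indicator {0<..<1} t *\<^sub>R u t)"
    by (subst integral_restrict_space) auto
  also have "\<dots> = \<bar>-1\<bar> *\<^sub>R (LINT t|lborel. indicator {0<..<1} (1 + (-1) * t) *\<^sub>R u (1 + (-1) * t))"
    by (rule lborel_integral_real_affine) simp
  also have "\<dots> = (LINT t|lborel. indicator {0<..<1} t *\<^sub>R u (1 - t))"
    by (auto simp: indicator_def intro!: Bochner_Integration.integral_cong)
  also have "\<dots> = (LINT t|time. u (1 - t))"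
    by (subst integral_restrict_space) auto
  finally show ?thesis ..
qed

text \<open>
  The derivative of the cutoff is a tent at \<open>0\<close> minus a tent at \<open>1\<close>; reflecting time turns the second into the first.
\<close>

lemma cutoff'_limit:
  fixes u :: "real \<Rightarrow> real"
  assumes u: "continuous_on {0..1} u"
  shows "(\<lambda>n. LINT t|time. cutoff' n t * u t) \<longlonglongrightarrow> u 0 - u 1"
proof -
  have u': "continuous_on {0..1} (\<lambda>t. u (1 - t))"
    by (rule continuous_on_compose2[OF u]) (auto intro!: continuous_intros)
  obtain B where B: "\<And>t. t \<in> {0..1} \<Longrightarrow> \<bar>u t\<bar> \<le> B"
    using continuous_on_Icc_bound[OF u] by blast
  have um: "u \<in> borel_measurable time"
  proof -
    have "continuous_on {0<..<1} u" using u by (rule continuous_on_subset) auto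
    then have "u \<in> borel_measurable (restrict_space borel {0<..<1})" by (rule borel_measurable_continuous_on_restrict)
    then show ?thesis by (simp cong: measurable_cong_sets add: sets_restrict_space)
  qed
  have fin: "finite_measure time" by (rule finite_measureI) (simp add: emeasure_restrict_space space_restrict_space)
  have tent_le: "tent s \<le> 4" for s unfolding tent_def by (auto simp: max_def)
  have int: "integrable time (\<lambda>t. real n * tent (g t) * u t)" if g: "continuous_on UNIV g" for n g
  proof (rule finite_measure.integrable_const_bound[OF fin, of _ "real n * 4 * B"])
    have "(\<lambda>t. tent (g t)) \<in> borel_measurable borel"
      by (intro borel_measurable_continuous_onI continuous_on_compose2[OF continuous_tent[of UNIV] g]) auto
    then have "(\<lambda>t. tent (g t)) \<in> borel_measurable time" by (intro measurable_restrict_space1) simp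
    then show "(\<lambda>t. real n * tent (g t) * u t) \<in> borel_measurable time" using um by measurable
    show "AE t in time. norm (real n * tent (g t) * u t) \<le> real n * 4 * B"
    proof (rule AE_I2)
      fix t assume "t \<in> space time"
      then have "\<bar>u t\<bar> \<le> B" using B[of t] by (auto simp: space_restrict_space)
      then show "norm (real n * tent (g t) * u t) \<le> real n * 4 * B"
        using tent_le[of "g t"] tent_nonneg[of "g t"] by (auto simp: abs_mult intro!: mult_mono)
    qed
  qed
  have "(LINT t|time. cutoff' n t * u t)
    = (LINT t|time. real n * tent (real n * t) * u t) - (LINT t|time. real n * tent (real n * (1 - t)) * u t)" for n
    unfolding cutoff'_def left_diff_distrib
    by (intro Bochner_Integration.integral_diff int continuous_intros)
  moreover have "(LINT t|time. real n * tent (real n * (1 - t)) * u t) = (LINT t|time. real n * tent (real n * t) * u (1 - t))" for n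
    using time_reflect[of "\<lambda>t. real n * tent (real n * t) * u (1 - t)"] by simp
  ultimately show ?thesis
    using tendsto_diff[OF tent_concentrates[OF u] tent_concentrates[OF u']] by simp
qed

subsection \<open>The Fokker-Planck equation tested with time-independent functions\<close>

lemma product_test_function:
  fixes \<psi> :: "real^'n \<Rightarrow> real"
  assumes \<psi>: "\<psi> \<in> Cb2" "bounded (range \<psi>)" and n: "3 \<le> n"
  defines "\<phi> \<equiv> \<lambda>(t, x). cutoff n t * \<psi> x"
  shows "\<phi> \<in> Cb12" "supported_in_strip \<phi>" "dt \<phi> (t, x) = cutoff' n t * \<psi> x"
    "hessian_x \<phi> (t, x) = cutoff n t *\<^sub>R hessian \<psi> x"
proof -
  have dt: "dt \<phi> p = cutoff' n (fst p) * \<psi> (snd p)" for p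
    unfolding dt_def \<phi>_def by (simp, intro DERIV_imp_deriv DERIV_cmult_right DERIV_cutoff)
  have hx: "hessian_x \<phi> p = cutoff n (fst p) *\<^sub>R hessian \<psi> (snd p)" for p
    unfolding hessian_x_def \<phi>_def by (simp add: Cb2_cmult(2)[OF \<psi>(1)])
  have gx: "grad_x \<phi> p = cutoff n (fst p) *\<^sub>R grad \<psi> (snd p)" for p
  proof -
    have d1: "((\<lambda>x. cutoff n t * \<psi> x) has_derivative (\<lambda>h. (cutoff n t *\<^sub>R grad \<psi> x) \<bullet> h)) (at x)" for t x
      using has_derivative_mult_right[OF Cb2D(1)[OF \<psi>(1)], of "cutoff n t" x] by simp
    have d2: "((\<lambda>x. cutoff n t *\<^sub>R grad \<psi> x) has_derivative (\<lambda>h. (cutoff n t *\<^sub>R hessian \<psi> x) *v h)) (at x)" for t x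
      using has_derivative_scaleR_right[OF Cb2D(2)[OF \<psi>(1)], of "cutoff n t" x] by (simp add: scaleR_matrix_vector_assoc)
    show ?thesis unfolding grad_x_def \<phi>_def by (simp add: hessian_eqI(2)[OF d1 d2])
  qed
  show "dt \<phi> (t, x) = cutoff' n t * \<psi> x" "hessian_x \<phi> (t, x) = cutoff n t *\<^sub>R hessian \<psi> x"
    by (simp_all add: dt hx)
  have tg: "continuous_on UNIV (\<lambda>t. tent (g t))" if "continuous_on UNIV g" for g :: "real \<Rightarrow> real"
    by (rule continuous_on_compose2[OF continuous_tent that subset_UNIV])
  have c: "continuous_on UNIV (cutoff n)" "continuous_on UNIV (cutoff' n)"
  proof -
    show "continuous_on UNIV (cutoff n)"
      by (intro continuous_at_imp_continuous_on ballI DERIV_isCont[OF DERIV_cutoff])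
    show "continuous_on UNIV (cutoff' n)"
      unfolding cutoff'_def[abs_def] by (intro continuous_intros tg)
  qed
  have cf: "continuous_on A (\<lambda>p::real \<times> (real^'n). cutoff n (fst p))" "continuous_on A (\<lambda>p::real \<times> (real^'n). cutoff' n (fst p))" for A
    by (rule continuous_on_compose2[OF c(1) continuous_on_fst[OF continuous_on_id] subset_UNIV],
        rule continuous_on_compose2[OF c(2) continuous_on_fst[OF continuous_on_id] subset_UNIV])
  have cs: "continuous_on A (\<lambda>p::real \<times> (real^'n). \<psi> (snd p))" "continuous_on A (\<lambda>p::real \<times> (real^'n). grad \<psi> (snd p))"
     "continuous_on A (\<lambda>p::real \<times> (real^'n). hessian \<psi> (snd p))" for A
    by (rule continuous_on_compose2[OF Cb2D(5)[OF \<psi>(1)] continuous_on_snd[OF continuous_on_id] subset_UNIV],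
        rule continuous_on_compose2[OF Cb2D(4)[OF \<psi>(1)] continuous_on_snd[OF continuous_on_id] subset_UNIV],
        rule continuous_on_compose2[OF Cb2D(3)[OF \<psi>(1)] continuous_on_snd[OF continuous_on_id] subset_UNIV])
  obtain B where B: "\<And>x. \<bar>\<psi> x\<bar> \<le> B" using \<psi>(2) unfolding bounded_iff by auto
  obtain H where H: "\<And>x. norm (hessian \<psi> x) \<le> H" using Cb2_hessian_bound[OF \<psi>(1)] by blast
  obtain C where C: "\<And>t. t \<in> {0..1} \<Longrightarrow> \<bar>cutoff n t\<bar> \<le> C"
    using continuous_on_Icc_bound[OF continuous_on_subset[OF c(1) subset_UNIV]] by blast
  obtain C' where C': "\<And>t. t \<in> {0..1} \<Longrightarrow> \<bar>cutoff' n t\<bar> \<le> C'"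
    using continuous_on_Icc_bound[OF continuous_on_subset[OF c(2) subset_UNIV]] by blast
  have C0: "0 \<le> C" "0 \<le> C'" using C[of 0] C'[of 0] by auto
  show "\<phi> \<in> Cb12"
    unfolding Cb12_def
  proof (intro CollectI conjI ballI allI)
    show "(\<lambda>s. \<phi> (s, x)) differentiable (at t)" for t x
    proof -
      have "((\<lambda>s. \<phi> (s, x)) has_real_derivative cutoff' n t * \<psi> x) (at t)"
        unfolding \<phi>_def prod.case by (rule DERIV_cmult_right[OF DERIV_cutoff])
      then show ?thesis unfolding has_field_derivative_def by (rule differentiableI)
    qed
    show "twice_differentiable (\<lambda>x. \<phi> (t, x))" for t
      using Cb2_cmult(1)[OF \<psi>(1), of "cutoff n t"] unfolding \<phi>_def Cb2_def by simp
    have "\<phi> = (\<lambda>p. cutoff n (fst p) * \<psi> (snd p))" unfolding \<phi>_def by (simp add: case_prod_unfold)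
    then show "continuous_on strip \<phi>" using cf(1) cs(1) by (auto intro!: continuous_intros)
    show "continuous_on strip (dt \<phi>)" unfolding dt[abs_def] using cf(2) cs(1) by (intro continuous_intros)
    show "continuous_on strip (grad_x \<phi>)" unfolding gx[abs_def] using cf(1) cs(2) by (intro continuous_intros)
    show "continuous_on strip (hessian_x \<phi>)" unfolding hx[abs_def] using cf(1) cs(3) by (intro continuous_intros)
    have "norm (dt \<phi> p) \<le> C' * B" if "p \<in> strip" for p
      unfolding dt using C'[of "fst p"] B[of "snd p"] that C0 by (auto simp: abs_mult intro!: mult_mono)
    then show "bounded (dt \<phi> ` strip)" unfolding bounded_iff by (intro exI[of _ "C' * B"]) blast
    have "norm (hessian_x \<phi> p) \<le> C * H" if "p \<in> strip" for p
      unfolding hx using C[of "fst p"] H[of "snd p"] that C0 by (auto intro!: mult_mono)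
    then show "bounded (hessian_x \<phi> ` strip)" unfolding bounded_iff by (intro exI[of _ "C * H"]) blast
  qed
  have n0: "0 < 1 / real n" "1 - 1 / real n < 1" using n by auto
  have "{p \<in> strip. \<phi> p \<noteq> 0} \<subseteq> {1 / real n..1 - 1 / real n} \<times> UNIV"
  proof (intro subsetI, elim CollectE conjE)
    fix p :: "real \<times> (real^'n)" assume "\<phi> p \<noteq> 0"
    then have "cutoff n (fst p) \<noteq> 0" unfolding \<phi>_def by (auto simp: case_prod_unfold)
    then have "1 / real n < fst p" "fst p < 1 - 1 / real n"
      using cutoff_near_ends[OF n, of "fst p"] by (meson not_le)+
    then show "p \<in> {1 / real n..1 - 1 / real n} \<times> UNIV" by (cases p) simp
  qed
  then have "closure {p \<in> strip. \<phi> p \<noteq> 0} \<subseteq> {1 / real n..1 - 1 / real n} \<times> UNIV"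
    by (rule closure_minimal) (intro closed_Times closed_atLeastAtMost closed_UNIV)
  also have "\<dots> \<subseteq> strip"
  proof (rule Sigma_mono)
    have "{a..b} \<subseteq> {0<..<1}" if "0 < a" "b < 1" for a b :: real using that by auto
    from this[OF n0] show "{1 / real n..1 - 1 / real n} \<subseteq> {0<..<1}" .
  qed simp
  finally show "supported_in_strip \<phi>" unfolding supported_in_strip_def .
qed

text \<open>
  Test with \<open>cutoff n t * \<psi> x\<close> and let \<open>n \<rightarrow> \<infinity>\<close>. The left side of the equation tends to the difference of the end
  values of \<open>t \<mapsto> \<integral>\<psi> d\<rho>\<^sub>t\<close>, which is continuous up to the end points because \<open>\<psi>\<close> is bounded; on the right
  side the cutoff disappears by dominated convergence.
\<close>

lemma dynamic_gain_bounded: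
  assumes comp: "dynamic_competitor \<mu> \<nu> \<rho> \<rho>t L Lt" and \<psi>: "\<psi> \<in> Cb2" "bounded (range \<psi>)"
  shows "gain \<mu> \<nu> \<psi> = (LINT t|time. matrix_integral borel (Lt t) (\<lambda>x. (1/2) *\<^sub>R hessian \<psi> x))"
proof -
  define g where "g t = matrix_integral borel (Lt t) (\<lambda>x. (1/2) *\<^sub>R hessian \<psi> x)" for t
  define u where "u t = (LINT x|\<rho>t t. \<psi> x)" for t
  have fp: "fokker_planck \<rho> \<rho>t L Lt" and nc: "narrowly_continuous_P2 \<rho>t" and ends: "\<rho>t 0 = \<mu>" "\<rho>t 1 = \<nu>"
    using comp unfolding dynamic_competitor_def by auto
  have dis: "matrix_disintegration L Lt" using fp unfolding fokker_planck_def by simp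
  have u: "continuous_on {0..1} u"
    unfolding u_def using nc Cb2D(5)[OF \<psi>(1)] \<psi>(2) unfolding narrowly_continuous_P2_def by blast
  have bh: "bcont (\<lambda>x. (1/2) *\<^sub>R hessian \<psi> x)" by (rule bcont_hessian[OF \<psi>(1)])
  obtain H where H: "\<And>x. norm ((1/2) *\<^sub>R hessian \<psi> x) \<le> H" using bcont_bound[OF bh] by blast
  have gi: "integrable time g"
    unfolding g_def by (rule fibre_integral_integrable[OF dis bcont_measurable[OF bh] H])
  have eq: "(LINT t|time. cutoff' n t * u t) = - (LINT t|time. cutoff n t * g t)" if n: "3 \<le> n" for n
  proof -
    let ?\<phi> = "\<lambda>(t, x). cutoff n t * \<psi> x"
    note \<phi> = product_test_function[OF \<psi> n]
    have "(LINT t|time. LINT x|\<rho>t t. dt ?\<phi> (t, x))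
      = - (LINT t|time. matrix_integral borel (Lt t) (\<lambda>x. (1/2) *\<^sub>R hessian_x ?\<phi> (t, x)))"
      using fp \<phi>(1,2) unfolding fokker_planck_def by blast
    moreover have "(LINT x|\<rho>t t. dt ?\<phi> (t, x)) = cutoff' n t * u t" for t
      unfolding \<phi>(3) u_def by simp
    moreover have "matrix_integral borel (Lt t) (\<lambda>x. (1/2) *\<^sub>R hessian_x ?\<phi> (t, x)) = cutoff n t * g t" for t
      unfolding \<phi>(4) g_def matrix_integral_def
      by (subst integral_mult_right_zero[symmetric]) (simp add: mult.commute)
    ultimately show ?thesis by simp
  qed
  obtain C where C: "0 \<le> C" "\<And>s. \<bar>step s\<bar> \<le> C" using step_bounded by blast
  have "(\<lambda>n. LINT t|time. cutoff n t * g t) \<longlonglongrightarrow> (LINT t|time. g t)"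
  proof (rule integral_dominated_convergence)
    show "integrable time (\<lambda>t. (2 * C + 1) * \<bar>g t\<bar>)" using gi by simp
    show "AE t in time. norm (cutoff n t * g t) \<le> (2 * C + 1) * \<bar>g t\<bar>" for n
    proof (rule AE_I2)
      fix t
      have "\<bar>cutoff n t\<bar> \<le> 2 * C + 1"
        unfolding cutoff_def using C(2)[of "real n * t"] C(2)[of "real n * (1 - t)"] by linarith
      then show "norm (cutoff n t * g t) \<le> (2 * C + 1) * \<bar>g t\<bar>" by (simp add: abs_mult mult_right_mono)
    qed
    show "AE t in time. (\<lambda>n. cutoff n t * g t) \<longlonglongrightarrow> g t"
    proof (rule AE_I2)
      fix t assume "t \<in> space time"
      then have "t \<in> {0<..<1}" by (simp add: space_restrict_space)
      from tendsto_mult_right[OF cutoff_tendsto[OF this], of "g t"]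
      show "(\<lambda>n. cutoff n t * g t) \<longlonglongrightarrow> g t" by simp
    qed
    show gm: "g \<in> borel_measurable time" using gi by simp
    fix n
    have "continuous_on UNIV (cutoff n)"
      by (intro continuous_at_imp_continuous_on ballI DERIV_isCont[OF DERIV_cutoff])
    then have "cutoff n \<in> borel_measurable time"
      by (intro measurable_restrict_space1) (simp add: borel_measurable_continuous_onI)
    then show "(\<lambda>t. cutoff n t * g t) \<in> borel_measurable time" using gm by measurable
  qed
  then have "(\<lambda>n. - (LINT t|time. cutoff n t * g t)) \<longlonglongrightarrow> - (LINT t|time. g t)" by (rule tendsto_minus)
  moreover have "\<forall>\<^sub>F n in sequentially. - (LINT t|time. cutoff n t * g t) = (LINT t|time. cutoff' n t * u t)"
    using eq by (intro eventually_sequentiallyI[of 3]) simp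
  ultimately have "(\<lambda>n. LINT t|time. cutoff' n t * u t) \<longlonglongrightarrow> - (LINT t|time. g t)"
    by (rule Lim_transform_eventually)
  then have "- (LINT t|time. g t) = u 0 - u 1"
    using cutoff'_limit[OF u] by (rule LIMSEQ_unique)
  then show ?thesis unfolding gain_def g_def u_def ends by simp
qed

text \<open>
  Both sides pass to the limit along the bounded truncations of \<open>\<psi>\<close>: the gains are dominated by \<open>|\<psi>|\<close>, the
  integrals against \<open>\<lambda>\<^sub>t\<close> by the uniform bound of the Hessians times the trace of the mass of \<open>\<lambda>\<^sub>t\<close>.
\<close>

lemma dynamic_gain:
  assumes comp: "dynamic_competitor \<mu> \<nu> \<rho> \<rho>t L Lt" and P: "\<mu> \<in> P2" "\<nu> \<in> P2" and \<psi>: "\<psi> \<in> Cb2"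
  shows "gain \<mu> \<nu> \<psi> = (LINT t|time. matrix_integral borel (Lt t) (\<lambda>x. (1/2) *\<^sub>R hessian \<psi> x))"
proof -
  have dis: "matrix_disintegration L Lt" using comp unfolding dynamic_competitor_def fokker_planck_def by simp
  have Lt: "Lt t \<in> matrix_measures borel" if "t \<in> space time" for t
    using dis that unfolding matrix_disintegration_def by (simp add: space_restrict_space)
  obtain \<Psi> B where \<Psi>: "\<And>n::nat. \<Psi> n \<in> Cb2" "\<And>n. bounded (range (\<Psi> n))"
    "\<And>n x. norm (hessian (\<Psi> n) x) \<le> B" "\<And>n x. \<bar>\<Psi> n x\<bar> \<le> \<bar>\<psi> x\<bar>"
    "\<And>x. (\<lambda>n. \<Psi> n x) \<longlonglongrightarrow> \<psi> x" "\<And>x. (\<lambda>n. hessian (\<Psi> n) x) \<longlonglongrightarrow> hessian \<psi> x"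
    using Cb2_truncation[OF \<psi>] by metis
  have lim1: "(\<lambda>n. LINT x|\<kappa>. \<Psi> n x) \<longlonglongrightarrow> (LINT x|\<kappa>. \<psi> x)" if \<kappa>: "\<kappa> \<in> P2" for \<kappa>
  proof (rule integral_dominated_convergence)
    show "integrable \<kappa> (\<lambda>x. \<bar>\<psi> x\<bar>)" using Cb2_integrable[OF \<psi> \<kappa>] by simp
    show "\<psi> \<in> borel_measurable \<kappa>" "\<Psi> n \<in> borel_measurable \<kappa>" for n
      using Cb2_integrable[OF \<psi> \<kappa>] Cb2_integrable[OF \<Psi>(1) \<kappa>] by auto
  qed (use \<Psi> in auto)
  have "(\<lambda>n. gain \<mu> \<nu> (\<Psi> n)) \<longlonglongrightarrow> gain \<mu> \<nu> \<psi>"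
    unfolding gain_def by (intro tendsto_diff lim1 P)
  moreover have "(\<lambda>n. LINT t|time. matrix_integral borel (Lt t) (\<lambda>x. (1/2) *\<^sub>R hessian (\<Psi> n) x))
    \<longlonglongrightarrow> (LINT t|time. matrix_integral borel (Lt t) (\<lambda>x. (1/2) *\<^sub>R hessian \<psi> x))"
  proof (rule integral_dominated_convergence)
    note hm = bcont_measurable[OF bcont_hessian]
    have "0 \<le> B" by (rule order_trans[OF norm_ge_zero \<Psi>(3)])
    then have nb: "norm ((1/2) *\<^sub>R hessian (\<Psi> n) x) \<le> B" for n x using \<Psi>(3)[of n x] by simp
    obtain H where H: "\<And>x. norm ((1/2) *\<^sub>R hessian \<psi> x) \<le> H" using bcont_bound[OF bcont_hessian[OF \<psi>]] by blast
    show "(\<lambda>t. matrix_integral borel (Lt t) (\<lambda>x. (1/2) *\<^sub>R hessian \<psi> x)) \<in> borel_measurable time"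
      by (rule fibre_integral_measurable[OF dis hm[OF \<psi>] H])
    show "(\<lambda>t. matrix_integral borel (Lt t) (\<lambda>x. (1/2) *\<^sub>R hessian (\<Psi> n) x)) \<in> borel_measurable time" for n
      by (rule fibre_integral_measurable[OF dis hm[OF \<Psi>(1)] nb])
    show "integrable time (\<lambda>t. (B * real (CARD('a) * CARD('a))) * trace (Lt t UNIV))"
      by (rule fibre_trace_integrable[OF dis])
    show "AE t in time. norm (matrix_integral borel (Lt t) (\<lambda>x. (1/2) *\<^sub>R hessian (\<Psi> n) x))
        \<le> (B * real (CARD('a) * CARD('a))) * trace (Lt t UNIV)" for n
      using matrix_integral_bound[OF Lt hm[OF \<Psi>(1)] nb] by (intro AE_I2) (simp add: mult.assoc)
    show "AE t in time. (\<lambda>n. matrix_integral borel (Lt t) (\<lambda>x. (1/2) *\<^sub>R hessian (\<Psi> n) x))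
        \<longlonglongrightarrow> matrix_integral borel (Lt t) (\<lambda>x. (1/2) *\<^sub>R hessian \<psi> x)"
      by (intro AE_I2 matrix_integral_dominated[OF Lt hm[OF \<Psi>(1)] hm[OF \<psi>] nb] tendsto_scaleR tendsto_const \<Psi>(6))
  qed
  moreover have "gain \<mu> \<nu> (\<Psi> n) = (LINT t|time. matrix_integral borel (Lt t) (\<lambda>x. (1/2) *\<^sub>R hessian (\<Psi> n) x))" for n
    by (rule dynamic_gain_bounded[OF comp \<Psi>(1,2)])
  ultimately show ?thesis using LIMSEQ_unique by simp
qed

text \<open>
  The bound of \<open>matrix_integral_le_action\<close> at each time, integrated. The nonnegative integral is monotone even for
  functions that are not measurable, such as possibly the action of \<open>\<lambda>\<^sub>t\<close>.
\<close>

lemma (in cost_function) dynamic_weak_duality: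
  assumes comp: "dynamic_competitor \<mu> \<nu> \<rho> \<rho>t L Lt" and P: "\<mu> \<in> P2" "\<nu> \<in> P2" and \<psi>: "feasible f \<psi>"
  shows "ennreal (gain \<mu> \<nu> \<psi>) \<le> dynamic_cost f Lt"
proof -
  have Lt: "Lt t \<in> matrix_measures borel" if "t \<in> space time" for t
    using comp that unfolding dynamic_competitor_def fokker_planck_def matrix_disintegration_def
    by (simp add: space_restrict_space)
  have "ennreal (gain \<mu> \<nu> \<psi>) \<le> (\<integral>\<^sup>+t. ennreal (matrix_integral borel (Lt t) (\<lambda>x. (1/2) *\<^sub>R hessian \<psi> x)) \<partial>time)"
    using dynamic_gain[OF comp P] \<psi> by (simp add: ennreal_integral_le_nn_integral)
  also have "\<dots> \<le> dynamic_cost f Lt"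
    unfolding dynamic_cost_def using \<psi> by (intro nn_integral_mono matrix_integral_le_action Lt) auto
  finally show ?thesis .
qed


section \<open>Static competitors as stationary dynamic ones\<close>

lemma prob_space_time: "prob_space time"
  by (rule prob_spaceI) (simp add: emeasure_restrict_space space_restrict_space)

text \<open>
  The space-time of the problem is the Borel space of the strip, while Fubini's theorem needs product measures.
  This lemma and the next one translate between them.
\<close>

lemma strip_measurable_pair:
  assumes "sets \<kappa> = sets borel"
  shows "(\<lambda>p. p) \<in> measurable (time \<Otimes>\<^sub>M \<kappa>) (spacetime :: (real \<times> (real^'n)) measure)"
proof (rule measurable_restrict_space2)
  show "(\<lambda>p. p) \<in> space (time \<Otimes>\<^sub>M \<kappa>) \<rightarrow> strip"
    by (auto simp: space_pair_measure space_restrict_space)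
  have 1: "fst \<in> measurable (time \<Otimes>\<^sub>M \<kappa>) (borel :: real measure)"
  proof (rule measurable_compose[OF measurable_fst])
    show "(\<lambda>x. x) \<in> measurable time borel" by (rule measurable_restrict_space1) simp
  qed
  have 2: "snd \<in> measurable (time \<Otimes>\<^sub>M \<kappa>) (borel :: (real^'n) measure)"
    by (rule measurable_compose[OF measurable_snd]) (simp add: assms cong: measurable_cong_sets)
  have "(\<lambda>p. (fst p, snd p)) \<in> measurable (time \<Otimes>\<^sub>M \<kappa>) (borel \<Otimes>\<^sub>M borel)"
    by (rule measurable_Pair[OF 1 2])
  then show "(\<lambda>p. p) \<in> measurable (time \<Otimes>\<^sub>M \<kappa>) (borel :: (real \<times> (real^'n)) measure)"
    by (simp add: borel_prod)
qed

lemma spacetime_set_pair: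
  fixes E :: "(real \<times> (real^'n)) set"
  assumes "sets \<kappa> = sets borel" "E \<in> sets spacetime"
  shows "E \<in> sets (time \<Otimes>\<^sub>M \<kappa>)"
proof -
  have "E \<subseteq> strip" using assms(2) sets.sets_into_space by (fastforce simp: space_restrict_space)
  then have "E = (\<lambda>p. p) -` E \<inter> space (time \<Otimes>\<^sub>M \<kappa>)"
    using sets_eq_imp_space_eq[OF assms(1)] by (auto simp: space_pair_measure space_restrict_space)
  also have "\<dots> \<in> sets (time \<Otimes>\<^sub>M \<kappa>)" by (rule measurable_sets[OF strip_measurable_pair assms(2)]) fact
  finally show ?thesis .
qed

lemma section_measurable:
  fixes E :: "(real \<times> (real^'n)) set"
  assumes "E \<in> sets spacetime" "t \<in> {0<..<1}" shows "Pair t -` E \<in> sets borel"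
  using sets_Pair1[OF spacetime_set_pair[OF refl assms(1)], of t] assms(2) by simp

subsection \<open>Linear interpolation of measures\<close>

text \<open>
  The mixture \<open>(1 - t) \<mu> + t \<nu>\<close>, realised by drawing an end point with a Bernoulli variable and then a point from
  its measure; this makes the calculus of \<open>bind\<close> available.
\<close>

definition interpolation :: "(real^'n) measure \<Rightarrow> (real^'n) measure \<Rightarrow> real \<Rightarrow> (real^'n) measure" where
  "interpolation \<mu> \<nu> t = measure_pmf (bernoulli_pmf t) \<bind> (\<lambda>b. if b then \<nu> else \<mu>)"

context
  fixes \<mu> \<nu> :: "(real^'n) measure"
  assumes mu: "\<mu> \<in> P2" and nu: "\<nu> \<in> P2"
begin

lemma end_points: "prob_space \<mu>" "prob_space \<nu>" "sets \<mu> = sets borel" "sets \<nu> = sets borel"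
  using mu nu unfolding P2_def by auto

lemma kernel_ends: "(\<lambda>b. if b then \<nu> else \<mu>) \<in> measurable (measure_pmf (bernoulli_pmf t)) (subprob_algebra borel)"
proof -
  have "\<nu> \<in> space (subprob_algebra borel)" "\<mu> \<in> space (subprob_algebra borel)"
    by (simp_all add: space_subprob_algebra prob_space_imp_subprob_space end_points)
  then show ?thesis by simp
qed

lemma sets_interpolation [simp]: "sets (interpolation \<mu> \<nu> t) = sets borel"
  unfolding interpolation_def
  by (rule sets_bind[where N = borel]) (auto simp: end_points)

lemma space_interpolation [simp]: "space (interpolation \<mu> \<nu> t) = UNIV"
  using sets_eq_imp_space_eq[OF sets_interpolation] by simp

lemma nn_integral_interpolation:
  assumes "t \<in> {0..1}" "g \<in> borel_measurable borel"
  shows "(\<integral>\<^sup>+x. g x \<partial>interpolation \<mu> \<nu> t) = (\<integral>\<^sup>+x. g x \<partial>\<nu>) * ennreal t + (\<integral>\<^sup>+x. g x \<partial>\<mu>) * ennreal (1 - t)"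
  unfolding interpolation_def using assms
  by (subst nn_integral_bind[OF assms(2) kernel_ends]) simp

lemma emeasure_interpolation:
  assumes "t \<in> {0..1}" "E \<in> sets borel"
  shows "emeasure (interpolation \<mu> \<nu> t) E = emeasure \<nu> E * ennreal t + emeasure \<mu> E * ennreal (1 - t)"
  using nn_integral_interpolation[OF assms(1), of "indicator E"] assms(2) end_points by simp

lemma integral_interpolation:
  fixes g :: "real^'n \<Rightarrow> real"
  assumes "t \<in> {0..1}" "g \<in> borel_measurable borel" "\<And>x. \<bar>g x\<bar> \<le> B"
  shows "(LINT x|interpolation \<mu> \<nu> t. g x) = t * (LINT x|\<nu>. g x) + (1 - t) * (LINT x|\<mu>. g x)"
proof -
  have "(LINT x|interpolation \<mu> \<nu> t. g x) = (LINT b|measure_pmf (bernoulli_pmf t). LINT x|(if b then \<nu> else \<mu>). g x)"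
    unfolding interpolation_def
  proof (rule integral_bind[OF assms(2) assms(3) kernel_ends])
    show "finite_measure (measure_pmf (bernoulli_pmf t))" by (rule measure_pmf.finite_measure_axioms)
    show "AE b in measure_pmf (bernoulli_pmf t).
        emeasure (if b then \<nu> else \<mu>) (space (if b then \<nu> else \<mu>)) \<le> ennreal 1"
      using prob_space.emeasure_space_1[OF end_points(1)] prob_space.emeasure_space_1[OF end_points(2)]
      by (intro AE_I2) simp
  qed
  also have "\<dots> = t * (LINT x|\<nu>. g x) + (1 - t) * (LINT x|\<mu>. g x)"
    using assms(1) by (subst integral_bernoulli_pmf) (auto simp: algebra_simps)
  finally show ?thesis .
qed

lemma prob_space_interpolation: "t \<in> {0..1} \<Longrightarrow> prob_space (interpolation \<mu> \<nu> t)"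
proof (rule prob_spaceI)
  assume t: "t \<in> {0..1}"
  have "emeasure \<mu> UNIV = 1" "emeasure \<nu> UNIV = 1"
    using prob_space.emeasure_space_1[OF end_points(1)] prob_space.emeasure_space_1[OF end_points(2)]
      sets_eq_imp_space_eq[OF end_points(3)] sets_eq_imp_space_eq[OF end_points(4)] by simp_all
  then show "emeasure (interpolation \<mu> \<nu> t) (space (interpolation \<mu> \<nu> t)) = 1"
    using t emeasure_interpolation[OF t, of UNIV] by (simp add: ennreal_plus[symmetric] del: ennreal_plus)
qed

lemma second_moment_finite: "(\<integral>\<^sup>+x. ennreal ((norm x)\<^sup>2) \<partial>\<mu>) < \<infinity>" "(\<integral>\<^sup>+x. ennreal ((norm x)\<^sup>2) \<partial>\<nu>) < \<infinity>"
  using mu nu unfolding P2_def by (auto simp: integrable_iff_bounded)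

lemma interpolation_P2: assumes "t \<in> {0..1}" shows "interpolation \<mu> \<nu> t \<in> P2"
proof -
  have "(\<integral>\<^sup>+x. ennreal ((norm x)\<^sup>2) \<partial>interpolation \<mu> \<nu> t) < \<infinity>"
    using second_moment_finite by (subst nn_integral_interpolation[OF assms]) (auto simp: ennreal_mult_less_top)
  moreover have "(\<lambda>x::real^'n. (norm x)\<^sup>2) \<in> borel_measurable (interpolation \<mu> \<nu> t)"
    by (simp cong: measurable_cong_sets)
  ultimately have "integrable (interpolation \<mu> \<nu> t) (\<lambda>x. (norm x)\<^sup>2)"
    by (simp add: integrable_iff_bounded)
  then show ?thesis unfolding P2_def using prob_space_interpolation[OF assms] by simp
qed

lemma interpolation_ends: "interpolation \<mu> \<nu> 0 = \<mu>" "interpolation \<mu> \<nu> 1 = \<nu>"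
  by (rule measure_eqI; simp add: emeasure_interpolation end_points)+

lemma interpolation_narrowly_continuous: "narrowly_continuous_P2 (interpolation \<mu> \<nu>)"
  unfolding narrowly_continuous_P2_def
proof (intro conjI ballI allI impI interpolation_P2)
  fix g :: "real^'n \<Rightarrow> real" assume g: "continuous_on UNIV g" "bounded (range g)"
  obtain B where B: "\<And>x. \<bar>g x\<bar> \<le> B" using g(2) unfolding bounded_iff by auto
  have "continuous_on {0..1} (\<lambda>t. t * (LINT x|\<nu>. g x) + (1 - t) * (LINT x|\<mu>. g x))"
    by (intro continuous_intros)
  then show "continuous_on {0..1} (\<lambda>t. LINT x|interpolation \<mu> \<nu> t. g x)"
    using integral_interpolation[OF _ borel_measurable_continuous_onI[OF g(1)] B]
    by (subst continuous_on_cong[OF refl]) auto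
qed

lemma section_emeasure_measurable:
  assumes E: "E \<in> sets spacetime"
  shows "(\<lambda>t. emeasure (interpolation \<mu> \<nu> t) (Pair t -` E)) \<in> borel_measurable time"
proof -
  interpret m: prob_space \<mu> by (rule end_points)
  interpret n: prob_space \<nu> by (rule end_points)
  have "(\<lambda>t. emeasure \<nu> (Pair t -` E)) \<in> borel_measurable time"
    by (rule n.measurable_emeasure_Pair[OF spacetime_set_pair[OF end_points(4) E]])
  moreover have "(\<lambda>t. emeasure \<mu> (Pair t -` E)) \<in> borel_measurable time"
    by (rule m.measurable_emeasure_Pair[OF spacetime_set_pair[OF end_points(3) E]])
  moreover have "(\<lambda>t. t) \<in> borel_measurable time" by (rule measurable_restrict_space1) simp
  ultimately have "(\<lambda>t. emeasure \<nu> (Pair t -` E) * ennreal t + emeasure \<mu> (Pair t -` E) * ennreal (1 - t)) \<in> borel_measurable time"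
    by measurable
  then show ?thesis
    using emeasure_interpolation section_measurable[OF E]
    by (subst measurable_cong[where g = "\<lambda>t. emeasure \<nu> (Pair t -` E) * ennreal t + emeasure \<mu> (Pair t -` E) * ennreal (1 - t)"])
      (auto simp: space_restrict_space)
qed

lemma interpolation_kernel: "interpolation \<mu> \<nu> \<in> measurable time (prob_algebra borel)"
proof (rule measurable_prob_algebraI)
  show p: "prob_space (interpolation \<mu> \<nu> t)" if "t \<in> space time" for t
    using that by (intro prob_space_interpolation) (auto simp: space_restrict_space)
  show "interpolation \<mu> \<nu> \<in> measurable time (subprob_algebra borel)"
  proof (rule measurable_subprob_algebra)
    fix A :: "(real^'n) set" assume A: "A \<in> sets borel"
    have "(\<lambda>t. emeasure \<nu> A * ennreal t + emeasure \<mu> A * ennreal (1 - t)) \<in> borel_measurable time"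
      by (rule measurable_restrict_space1) measurable
    then show "(\<lambda>t. emeasure (interpolation \<mu> \<nu> t) A) \<in> borel_measurable time"
      using emeasure_interpolation[OF _ A]
      by (subst measurable_cong[where g = "\<lambda>t. emeasure \<nu> A * ennreal t + emeasure \<mu> A * ennreal (1 - t)"])
        (auto simp: space_restrict_space)
  qed (use p in \<open>auto intro: prob_space_imp_subprob_space\<close>)
qed

definition path_measure :: "(real \<times> (real^'n)) measure" where
  "path_measure = time \<bind> (\<lambda>t. distr (interpolation \<mu> \<nu> t) spacetime (Pair t))"

lemma Pair_measurable: "t \<in> {0<..<1} \<Longrightarrow> Pair t \<in> measurable (interpolation \<mu> \<nu> t) (spacetime :: (real \<times> (real^'n)) measure)"
  by (rule measurable_restrict_space2) (auto simp: borel_prod[symmetric] cong: measurable_cong_sets)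

lemma path_kernel: "(\<lambda>t. distr (interpolation \<mu> \<nu> t) spacetime (Pair t)) \<in> measurable time (subprob_algebra spacetime)"
proof (rule measurable_subprob_algebra)
  fix t assume "t \<in> space time"
  then have t: "t \<in> {0<..<1}" by (simp add: space_restrict_space)
  then show "subprob_space (distr (interpolation \<mu> \<nu> t) spacetime (Pair t))"
    using Pair_measurable prob_space_interpolation[of t]
    by (intro prob_space_imp_subprob_space prob_space.prob_space_distr) auto
next
  fix E :: "(real \<times> (real^'n)) set" assume E: "E \<in> sets spacetime"
  show "(\<lambda>t. emeasure (distr (interpolation \<mu> \<nu> t) spacetime (Pair t)) E) \<in> borel_measurable time"
    using section_emeasure_measurable[OF E]
    by (subst measurable_cong[where g = "\<lambda>t. emeasure (interpolation \<mu> \<nu> t) (Pair t -` E)"])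
      (use E Pair_measurable in \<open>auto simp: space_restrict_space emeasure_distr\<close>)
qed simp

lemma time_not_empty: "space time \<noteq> {}"
  by (simp add: space_restrict_space)

lemma emeasure_path:
  assumes "E \<in> sets spacetime"
  shows "emeasure path_measure E = (\<integral>\<^sup>+t. emeasure (interpolation \<mu> \<nu> t) (Pair t -` E) \<partial>time)"
  unfolding path_measure_def
  by (subst emeasure_bind[OF time_not_empty path_kernel assms], intro nn_integral_cong)
    (use assms Pair_measurable in \<open>auto simp: space_restrict_space emeasure_distr\<close>)

lemma sets_path: "sets path_measure = sets spacetime"
  unfolding path_measure_def by (rule sets_bind[OF _ time_not_empty]) simp

lemma path_P2: "path_measure \<in> P2_spacetime"
  unfolding P2_spacetime_def
proof (intro CollectI conjI sets_path)
  have sp: "space path_measure = strip" using sets_eq_imp_space_eq[OF sets_path] by (simp add: space_restrict_space)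
  show "prob_space path_measure"
  proof (rule prob_spaceI)
    have st: "strip \<in> sets (spacetime :: (real \<times> (real^'n)) measure)"
      using sets.top[of "spacetime :: (real \<times> (real^'n)) measure"] by (simp add: space_restrict_space)
    have "emeasure path_measure (space path_measure) = (\<integral>\<^sup>+t. emeasure (interpolation \<mu> \<nu> t) (Pair t -` strip) \<partial>time)"
      unfolding sp by (rule emeasure_path[OF st])
    also have "\<dots> = (\<integral>\<^sup>+t. 1 \<partial>time)"
    proof (rule nn_integral_cong)
      fix t assume "t \<in> space time"
      then have t: "t \<in> {0<..<1}" by (simp add: space_restrict_space)
      then have "Pair t -` strip = (UNIV :: (real^'n) set)" by auto
      then show "emeasure (interpolation \<mu> \<nu> t) (Pair t -` strip) = 1"
        using prob_space.emeasure_space_1[OF prob_space_interpolation, of t] t by simp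
    qed
    also have "\<dots> = 1" using prob_space.emeasure_space_1[OF prob_space_time] by simp
    finally show "emeasure path_measure (space path_measure) = 1" .
  qed
  have m: "(\<lambda>p. ennreal ((norm (snd p))\<^sup>2)) \<in> borel_measurable (spacetime :: (real \<times> (real^'n)) measure)"
    by (rule measurable_restrict_space1) (simp add: borel_prod[symmetric])
  have "(\<integral>\<^sup>+p. ennreal ((norm (snd p))\<^sup>2) \<partial>path_measure)
    = (\<integral>\<^sup>+t. \<integral>\<^sup>+p. ennreal ((norm (snd p))\<^sup>2) \<partial>distr (interpolation \<mu> \<nu> t) spacetime (Pair t) \<partial>time)"
    unfolding path_measure_def by (rule nn_integral_bind[OF m path_kernel])
  also have "\<dots> \<le> (\<integral>\<^sup>+t. (\<integral>\<^sup>+x. ennreal ((norm x)\<^sup>2) \<partial>\<nu>) + (\<integral>\<^sup>+x. ennreal ((norm x)\<^sup>2) \<partial>\<mu>) \<partial>time)"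
  proof (rule nn_integral_mono)
    fix t assume "t \<in> space time"
    then have t: "t \<in> {0<..<1}" by (simp add: space_restrict_space)
    have "(\<integral>\<^sup>+p. ennreal ((norm (snd p))\<^sup>2) \<partial>distr (interpolation \<mu> \<nu> t) spacetime (Pair t))
      = (\<integral>\<^sup>+x. ennreal ((norm x)\<^sup>2) \<partial>interpolation \<mu> \<nu> t)"
      using m by (subst nn_integral_distr[OF Pair_measurable[OF t]]) auto
    also have "\<dots> = (\<integral>\<^sup>+x. ennreal ((norm x)\<^sup>2) \<partial>\<nu>) * ennreal t + (\<integral>\<^sup>+x. ennreal ((norm x)\<^sup>2) \<partial>\<mu>) * ennreal (1 - t)"
      using t by (intro nn_integral_interpolation) auto
    also have "\<dots> \<le> (\<integral>\<^sup>+x. ennreal ((norm x)\<^sup>2) \<partial>\<nu>) * 1 + (\<integral>\<^sup>+x. ennreal ((norm x)\<^sup>2) \<partial>\<mu>) * 1"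
      using t by (intro add_mono mult_left_mono) (auto simp: ennreal_le_1)
    finally show "(\<integral>\<^sup>+p. ennreal ((norm (snd p))\<^sup>2) \<partial>distr (interpolation \<mu> \<nu> t) spacetime (Pair t))
      \<le> (\<integral>\<^sup>+x. ennreal ((norm x)\<^sup>2) \<partial>\<nu>) + (\<integral>\<^sup>+x. ennreal ((norm x)\<^sup>2) \<partial>\<mu>)" by simp
  qed
  also have "\<dots> = (\<integral>\<^sup>+x. ennreal ((norm x)\<^sup>2) \<partial>\<nu>) + (\<integral>\<^sup>+x. ennreal ((norm x)\<^sup>2) \<partial>\<mu>)"
    using prob_space.emeasure_space_1[OF prob_space_time] by simp
  also have "\<dots> < \<infinity>" using second_moment_finite by simp
  finally have fin: "(\<integral>\<^sup>+p. ennreal ((norm (snd p))\<^sup>2) \<partial>path_measure) < \<infinity>" .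
  have "(\<lambda>p. (norm (snd p))\<^sup>2) \<in> borel_measurable (spacetime :: (real \<times> (real^'n)) measure)"
    by (rule measurable_restrict_space1) (simp add: borel_prod[symmetric])
  then have "(\<lambda>p. (norm (snd p))\<^sup>2) \<in> borel_measurable path_measure"
    using sets_path by (simp cong: measurable_cong_sets)
  then show "integrable path_measure (\<lambda>p. (norm (snd p))\<^sup>2)"
    using fin by (simp add: integrable_iff_bounded)
qed

lemma path_disintegration: "disintegration path_measure (interpolation \<mu> \<nu>)"
  unfolding disintegration_def using interpolation_kernel emeasure_path by simp

end

subsection \<open>The constant curve of matrix measures\<close>

text \<open>
  With a density \<open>\<sigma>\<close> of \<open>L\<close> with respect to \<open>m\<close>, the space-time measure has density \<open>\<sigma> x\<close> with respect to the
  product of time and \<open>m\<close>; measurability of sections and countable additivity follow from Fubini's theorem.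
\<close>

lemma constant_disintegration:
  fixes L :: "(real^'n) set \<Rightarrow> real^'n^'n"
  assumes L: "L \<in> matrix_measures borel"
  defines "L' \<equiv> \<lambda>E. LINT t|time. L (Pair t -` E)"
  shows "matrix_disintegration L' (\<lambda>t. L)" "L' \<in> matrix_measures spacetime"
proof -
  obtain \<sigma> where d: "density_measure borel (trace_measure borel L) L \<sigma>"
    using matrix_measure_has_density[OF L] by metis
  define m where "m = trace_measure borel L"
  interpret D: density_measure borel m L \<sigma> using d unfolding m_def .
  interpret T: prob_space time by (rule prob_space_time)
  interpret m: finite_measure m by (rule D.fin)
  interpret P: pair_sigma_finite time m ..
  have int: "integrable (time \<Otimes>\<^sub>M m) (\<lambda>p. \<sigma> (snd p))"
  proof (rule P.Fubini_integrable)
    show "(\<lambda>p. \<sigma> (snd p)) \<in> borel_measurable (time \<Otimes>\<^sub>M m)" by measurable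
    show "integrable time (\<lambda>t. LINT x|m. norm (\<sigma> (snd (t, x))))" by simp
    show "AE t in time. integrable m (\<lambda>x. \<sigma> (snd (t, x)))" using D.int by simp
  qed
  have Em: "E \<in> sets (time \<Otimes>\<^sub>M m)" if "E \<in> sets spacetime" for E
    by (rule spacetime_set_pair[OF D.sets_m that])
  have sec: "L (Pair t -` E) = (LINT x|m. indicator E (t, x) *\<^sub>R \<sigma> (snd (t, x)))"
    if "E \<in> sets spacetime" "t \<in> {0<..<1}" for E t
    using D.L[OF section_measurable[OF that]]
    by (simp add: set_lebesgue_integral_def indicator_def)
  have intE: "integrable (time \<Otimes>\<^sub>M m) (\<lambda>p. indicator E p *\<^sub>R \<sigma> (snd p))" if "E \<in> sets spacetime" for E
    using Em[OF that] int by (rule integrable_mult_indicator)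
  have iL: "integrable time (\<lambda>t. L (Pair t -` E))" if E: "E \<in> sets spacetime" for E
  proof -
    have "integrable time (\<lambda>t. LINT x|m. indicator E (t, x) *\<^sub>R \<sigma> (snd (t, x)))"
      using P.integrable_fst'[OF intE[OF E]] by simp
    then show ?thesis
      using sec[OF E] by (subst Bochner_Integration.integrable_cong[OF refl]) (auto simp: space_restrict_space)
  qed
  have L'E: "L' E = (LINT p:E|(time \<Otimes>\<^sub>M m). \<sigma> (snd p))" if E: "E \<in> sets spacetime" for E
  proof -
    have "L' E = (LINT t|time. LINT x|m. indicator E (t, x) *\<^sub>R \<sigma> (snd (t, x)))"
      unfolding L'_def using sec[OF E] by (intro Bochner_Integration.integral_cong) (auto simp: space_restrict_space)
    also have "\<dots> = (LINT p|(time \<Otimes>\<^sub>M m). indicator E p *\<^sub>R \<sigma> (snd p))"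
      using P.integral_fst'[OF intE[OF E]] by simp
    finally show ?thesis by (simp add: set_lebesgue_integral_def)
  qed
  show "matrix_disintegration L' (\<lambda>t. L)"
    unfolding matrix_disintegration_def using L iL by (auto simp: has_bochner_integral_iff L'_def)
  have psd: "L (Pair t -` E) \<in> psd_mats" if "E \<in> sets spacetime" "t \<in> space time" for E t
    using L section_measurable[OF that(1), of t] that(2) unfolding matrix_measures_def by (auto simp: space_restrict_space)
  show "L' \<in> matrix_measures spacetime"
    unfolding matrix_measures_def
  proof (intro CollectI conjI ballI allI impI)
    fix E :: "(real \<times> (real^'n)) set" assume E: "E \<in> sets spacetime"
    have "transpose (L' E) = (LINT t|time. transpose (L (Pair t -` E)))"
      unfolding L'_def by (rule integral_bounded_linear[OF bounded_linear_transpose iL[OF E], symmetric])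
    also have "\<dots> = L' E"
      unfolding L'_def using psd_sym[OF psd[OF E]]
      by (intro Bochner_Integration.integral_cong) (auto simp: sym_mats_def)
    finally have "L' E \<in> sym_mats" unfolding sym_mats_def by simp
    moreover have "0 \<le> v \<bullet> (L' E *v v)" for v
    proof -
      have bl: "bounded_linear (\<lambda>A :: real^'n^'n. v \<bullet> (A *v v))"
        by (intro linear_conv_bounded_linear[THEN iffD1] linearI)
          (auto simp: matrix_vector_mult_add_rdistrib scaleR_matrix_vector_assoc[symmetric] inner_add_right)
      have "v \<bullet> (L' E *v v) = (LINT t|time. v \<bullet> (L (Pair t -` E) *v v))"
        unfolding L'_def by (rule integral_bounded_linear[OF bl iL[OF E], symmetric])
      also have "0 \<le> \<dots>"
        using psd[OF E] by (intro integral_nonneg_AE AE_I2) (auto simp: psd_mats_def)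
      finally show ?thesis .
    qed
    ultimately show "L' E \<in> psd_mats" unfolding psd_mats_def by simp
  next
    show "L' {} = 0" using L unfolding L'_def matrix_measures_def by simp
  next
    fix A :: "nat \<Rightarrow> (real \<times> (real^'n)) set" assume A: "range A \<subseteq> sets spacetime" "disjoint_family A"
    have Ai: "A i \<in> sets spacetime" for i using A(1) by auto
    have "(\<lambda>i. LINT p:A i|(time \<Otimes>\<^sub>M m). \<sigma> (snd p)) sums (LINT p:(\<Union>i. A i)|(time \<Otimes>\<^sub>M m). \<sigma> (snd p))"
      using Em[OF Ai] by (intro set_integral_sums[OF int _ A(2)]) auto
    then show "(\<lambda>i. L' (A i)) sums L' (\<Union>i. A i)"
      using L'E Ai sets.countable_UN[of A UNIV] A(1) by simp
  qed
qed

subsection \<open>The Fokker-Planck equation of the stationary curve\<close>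

lemma Cb12_derivative:
  assumes "\<phi> \<in> Cb12" "t \<in> {0<..<1}"
  shows "((\<lambda>s. \<phi> (s, x)) has_real_derivative dt \<phi> (t, x)) (at t)"
  using assms unfolding Cb12_def dt_def by (simp add: DERIV_deriv_iff_real_differentiable)

lemma Cb12_section:
  assumes \<phi>: "\<phi> \<in> Cb12" and t: "t \<in> {0<..<1}"
  shows "(\<lambda>x. \<phi> (t, x)) \<in> Cb2"
proof -
  have c: "continuous_on strip (hessian_x \<phi>)" and b: "bounded (hessian_x \<phi> ` strip)"
    and td: "twice_differentiable (\<lambda>x. \<phi> (t, x))"
    using \<phi> t unfolding Cb12_def by auto
  have eq: "hessian (\<lambda>x. \<phi> (t, x)) = (\<lambda>x. hessian_x \<phi> (t, x))" by (simp add: hessian_x_def)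
  have "continuous_on UNIV (\<lambda>x. hessian_x \<phi> (t, x))"
    by (rule continuous_on_compose2[OF c]) (use t in \<open>auto intro!: continuous_intros\<close>)
  moreover have "bounded (range (\<lambda>x. hessian_x \<phi> (t, x)))"
    by (rule bounded_subset[OF b]) (use t in auto)
  ultimately show ?thesis unfolding Cb2_def eq using td by (simp add: eq)
qed

text \<open>
  The closed support does not contain \<open>(0, x)\<close> and \<open>(1, x)\<close>. The width \<open>d\<close> depends on \<open>x\<close>, as the support need not be
  compact.
\<close>

lemma supported_vanishes:
  assumes "supported_in_strip \<phi>"
  obtains d where "0 < d" "d < 1/2" "\<And>t. 0 < t \<Longrightarrow> t < d \<Longrightarrow> \<phi> (t, x) = 0"
    "\<And>t. 1 - d < t \<Longrightarrow> t < 1 \<Longrightarrow> \<phi> (t, x) = 0"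
proof -
  define S where "S = closure {p \<in> strip. \<phi> p \<noteq> 0}"
  have "{p \<in> strip. \<phi> p \<noteq> 0} \<subseteq> S" unfolding S_def by (rule closure_subset)
  then have S: "S \<subseteq> strip" "open (- S)" "\<And>p. p \<in> strip \<Longrightarrow> p \<notin> S \<Longrightarrow> \<phi> p = 0"
    using assms unfolding S_def supported_in_strip_def by auto
  have "(0, x) \<in> - S" "(1, x) \<in> - S" using S(1) by auto
  then obtain e0 e1 where e: "0 < e0" "ball (0, x) e0 \<subseteq> - S" "0 < e1" "ball (1, x) e1 \<subseteq> - S"
    using S(2) by (meson open_contains_ball)
  define d where "d = Min {e0, e1, 1/3}"
  have d: "0 < d" "d \<le> e0" "d \<le> e1" "d \<le> 1/3" unfolding d_def using e by auto
  show ?thesis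
  proof (rule that[of d])
    show "\<phi> (t, x) = 0" if "0 < t" "t < d" for t
    proof (rule S(3))
      have "(t, x) \<in> ball (0, x) e0" using that d by (simp add: dist_Pair_Pair dist_real_def)
      then show "(t, x) \<notin> S" using e(2) by auto
    qed (use that d in auto)
    show "\<phi> (t, x) = 0" if "1 - d < t" "t < 1" for t
    proof (rule S(3))
      have "(t, x) \<in> ball (1, x) e1" using that d by (simp add: dist_Pair_Pair dist_real_def)
      then show "(t, x) \<notin> S" using e(4) by auto
    qed (use that d in auto)
  qed (use d in auto)
qed

text \<open>
  Test functions are not assumed to be bounded. They are, because they start at \<open>0\<close> and move with bounded speed
  for a time less than \<open>1\<close>. This is what Fubini's theorem needs in \<open>stationary_equation\<close>.
\<close>

lemma Cb12_bounded:
  assumes \<phi>: "\<phi> \<in> Cb12" "supported_in_strip \<phi>"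
    and D: "\<And>t x. t \<in> {0<..<1} \<Longrightarrow> \<bar>dt \<phi> (t, x)\<bar> \<le> D" and t: "t \<in> {0<..<1}"
  shows "\<bar>\<phi> (t, x)\<bar> \<le> D"
proof -
  obtain d where d: "0 < d" "d < 1/2" "\<And>t. 0 < t \<Longrightarrow> t < d \<Longrightarrow> \<phi> (t, x) = 0"
    using supported_vanishes[OF \<phi>(2), of x] by metis
  define a where "a = min d t / 2"
  have a: "0 < a" "a < d" "a < t" unfolding a_def using d t by auto
  have "\<exists>z>a. z < t \<and> \<phi> (t, x) - \<phi> (a, x) = (t - a) * dt \<phi> (z, x)"
    by (rule MVT2[OF a(3)]) (use Cb12_derivative[OF \<phi>(1)] a t in auto)
  then obtain z where z: "a < z" "z < t" "\<phi> (t, x) = (t - a) * dt \<phi> (z, x)" using d(3)[of a] a by auto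
  have "\<bar>\<phi> (t, x)\<bar> = (t - a) * \<bar>dt \<phi> (z, x)\<bar>" using z a by (simp add: abs_mult)
  also have "\<dots> \<le> 1 * D" using a z t D[of z x] by (intro mult_mono) auto
  finally show ?thesis by simp
qed

text \<open>Integration by parts in time, without boundary terms because of the support.\<close>

lemma integration_by_parts_time:
  assumes \<phi>: "\<phi> \<in> Cb12" "supported_in_strip \<phi>"
  shows "(LINT t|time. (\<alpha> + \<beta> * t) * dt \<phi> (t, x) + \<beta> * \<phi> (t, x)) = 0"
proof -
  obtain d where d: "0 < d" "d < 1/2" "\<And>t. 0 < t \<Longrightarrow> t < d \<Longrightarrow> \<phi> (t, x) = 0"
    "\<And>t. 1 - d < t \<Longrightarrow> t < 1 \<Longrightarrow> \<phi> (t, x) = 0"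
    using supported_vanishes[OF \<phi>(2), of x] by metis
  define h where "h t = (\<alpha> + \<beta> * t) * dt \<phi> (t, x) + \<beta> * \<phi> (t, x)" for t
  define a where "a = d / 2"
  have a: "0 < a" "a < d" unfolding a_def using d by auto
  have D: "((\<lambda>s. (\<alpha> + \<beta> * s) * \<phi> (s, x)) has_real_derivative h t) (at t)" if "t \<in> {0<..<1}" for t
  proof -
    have "((\<lambda>s. \<alpha> + \<beta> * s) has_real_derivative \<beta>) (at t)" by (auto intro!: derivative_eq_intros)
    from DERIV_mult[OF this Cb12_derivative[OF \<phi>(1) that, of x]] show ?thesis
      by (simp add: h_def algebra_simps)
  qed
  have cont: "continuous_on {0<..<1} h"
  proof -
    have c: "continuous_on strip (dt \<phi>)" "continuous_on strip \<phi>" using \<phi>(1) unfolding Cb12_def by auto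
    have "continuous_on {0<..<1} (\<lambda>t. dt \<phi> (t, x))" "continuous_on {0<..<1} (\<lambda>t. \<phi> (t, x))"
      by (rule continuous_on_compose2[OF c(1)] continuous_on_compose2[OF c(2)]; auto intro!: continuous_intros)+
    then show ?thesis unfolding h_def by (intro continuous_intros)
  qed
  \<comment> \<open>near the ends \<phi> vanishes on an open interval, so its derivative vanishes too\<close>
  have h0: "h t = 0" if t: "t \<in> {0<..<1}" "t < d \<or> 1 - d < t" for t
  proof -
    have z: "\<phi> (t, x) = 0" using d(3,4)[of t] t by auto
    have "\<forall>\<^sub>F s in nhds t. s \<in> (if t < d then {0<..<d} else {1 - d<..<1})"
      using t by (intro eventually_nhds_in_open) auto
    then have "\<forall>\<^sub>F s in nhds t. \<phi> (s, x) = 0"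
      by eventually_elim (use d(3,4) in \<open>auto split: if_splits\<close>)
    from DERIV_cong_ev[OF refl this refl, of "dt \<phi> (t, x)"] Cb12_derivative[OF \<phi>(1) t(1), of x]
    have "((\<lambda>s. 0) has_real_derivative dt \<phi> (t, x)) (at t)" by simp
    then have "dt \<phi> (t, x) = 0" using DERIV_unique[OF _ DERIV_const] by blast
    with z show ?thesis unfolding h_def by simp
  qed
  have "(LINT t|time. h t) = (LINT t|lborel. indicator {0<..<1} t *\<^sub>R h t)"
    by (subst integral_restrict_space) auto
  also have "\<dots> = (LINT t|lborel. h t * indicator {a..1 - a} t)"
  proof (rule Bochner_Integration.integral_cong[OF refl])
    fix t
    consider "t \<in> {a..1 - a}" | "t \<in> {0<..<1}" "t < a \<or> 1 - a < t" | "t \<notin> {0<..<1}" by fastforce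
    then show "indicator {0<..<1} t *\<^sub>R h t = h t * indicator {a..1 - a} t"
    proof cases
      case 1 then show ?thesis using a d by auto
    next
      case 2 then show ?thesis using h0[of t] a by auto
    next
      case 3 then have "t \<notin> {a..1 - a}" using a d by auto
      with 3 show ?thesis by simp
    qed
  qed
  also have "\<dots> = (\<alpha> + \<beta> * (1 - a)) * \<phi> (1 - a, x) - (\<alpha> + \<beta> * a) * \<phi> (a, x)"
  proof (rule integral_FTC_Icc_real)
    show "a \<le> 1 - a" using a d by simp
    fix t assume "a \<le> t" "t \<le> 1 - a"
    then have t: "t \<in> {0<..<1}" using a by auto
    then show "((\<lambda>s. (\<alpha> + \<beta> * s) * \<phi> (s, x)) has_real_derivative h t) (at t)" by (rule D)
    show "isCont h t" using cont t by (simp add: continuous_on_eq_continuous_at)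
  qed
  also have "\<dots> = 0" using d(3)[of a] d(4)[of "1 - a"] a d by simp
  finally show ?thesis unfolding h_def .
qed

text \<open>
  Fubini's theorem and integration by parts in time for \<open>\<mu>\<close> with weight \<open>1 - t\<close> and for \<open>\<nu>\<close> with weight \<open>t\<close>; the
  derivatives \<open>-1\<close> and \<open>1\<close> of the weights leave the difference of the integrals of \<open>\<phi>\<close>.
\<close>

lemma stationary_equation:
  fixes \<phi> :: "real \<times> (real^'n) \<Rightarrow> real"
  assumes P: "\<mu> \<in> P2" "\<nu> \<in> P2" and \<phi>: "\<phi> \<in> Cb12" "supported_in_strip \<phi>"
  shows "(LINT t|time. LINT x|interpolation \<mu> \<nu> t. dt \<phi> (t, x))
    = - (LINT t|time. (LINT x|\<nu>. \<phi> (t, x)) - (LINT x|\<mu>. \<phi> (t, x)))"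
proof -
  have c: "continuous_on strip (dt \<phi>)" "continuous_on strip \<phi>" and bd: "bounded (dt \<phi> ` strip)"
    using \<phi>(1) unfolding Cb12_def by auto
  obtain D where D': "\<And>p. p \<in> dt \<phi> ` strip \<Longrightarrow> norm p \<le> D"
    using bd unfolding bounded_iff by blast
  have D: "\<bar>dt \<phi> (t, x)\<bar> \<le> D" if "t \<in> {0<..<1}" for t x
    using D'[of "dt \<phi> (t, x)"] that by auto
  have B: "\<bar>\<phi> (t, x)\<bar> \<le> D" if "t \<in> {0<..<1}" for t x by (rule Cb12_bounded[OF \<phi> D that])
  have m: "dt \<phi> \<in> borel_measurable spacetime" "\<phi> \<in> borel_measurable spacetime"
    using c by (auto intro: borel_measurable_continuous_on_restrict)
  have lin: "(LINT t|time. (\<alpha> + \<beta> * t) * (LINT x|\<kappa>. dt \<phi> (t, x))) = - \<beta> * (LINT t|time. LINT x|\<kappa>. \<phi> (t, x))"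
    and int: "integrable time (\<lambda>t. (\<alpha> + \<beta> * t) * (LINT x|\<kappa>. dt \<phi> (t, x)))"
    and int': "integrable time (\<lambda>t. LINT x|\<kappa>. \<phi> (t, x))"
    if \<kappa>: "\<kappa> \<in> P2" for \<kappa> \<alpha> \<beta>
  proof -
    have s: "sets \<kappa> = sets borel" using \<kappa> unfolding P2_def by simp
    interpret K: prob_space \<kappa> using \<kappa> unfolding P2_def by simp
    interpret T: prob_space time by (rule prob_space_time)
    interpret Q: pair_prob_space time \<kappa> ..
    note id = strip_measurable_pair[OF s]
    have [measurable]: "dt \<phi> \<in> borel_measurable (time \<Otimes>\<^sub>M \<kappa>)" "\<phi> \<in> borel_measurable (time \<Otimes>\<^sub>M \<kappa>)"
      using measurable_compose[OF id m(1)] measurable_compose[OF id m(2)] by simp_all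
    have [measurable]: "(\<lambda>t. t) \<in> borel_measurable time" by (rule measurable_restrict_space1) simp
    have sp: "fst p \<in> {0<..<1}" if "p \<in> space (time \<Otimes>\<^sub>M \<kappa>)" for p
      using that by (auto simp: space_pair_measure space_restrict_space)
    have i1: "integrable (time \<Otimes>\<^sub>M \<kappa>) (\<lambda>p. (\<alpha> + \<beta> * fst p) * dt \<phi> p)"
    proof (rule Q.P.integrable_const_bound[of _ "(\<bar>\<alpha>\<bar> + \<bar>\<beta>\<bar>) * D"])
      show "AE p in time \<Otimes>\<^sub>M \<kappa>. norm ((\<alpha> + \<beta> * fst p) * dt \<phi> p) \<le> (\<bar>\<alpha>\<bar> + \<bar>\<beta>\<bar>) * D"
      proof (rule AE_I2)
        fix p assume p: "p \<in> space (time \<Otimes>\<^sub>M \<kappa>)"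
        have "\<bar>\<beta> * fst p\<bar> \<le> \<bar>\<beta>\<bar>" using sp[OF p] by (simp add: abs_mult mult_left_le)
        then have "\<bar>\<alpha> + \<beta> * fst p\<bar> \<le> \<bar>\<alpha>\<bar> + \<bar>\<beta>\<bar>" by linarith
        moreover have "\<bar>dt \<phi> p\<bar> \<le> D" using D[OF sp[OF p], of "snd p"] by simp
        ultimately show "norm ((\<alpha> + \<beta> * fst p) * dt \<phi> p) \<le> (\<bar>\<alpha>\<bar> + \<bar>\<beta>\<bar>) * D"
          by (simp add: abs_mult mult_mono)
      qed
    qed measurable
    have i2: "integrable (time \<Otimes>\<^sub>M \<kappa>) \<phi>"
    proof (rule Q.P.integrable_const_bound[of _ D])
      show "AE p in time \<Otimes>\<^sub>M \<kappa>. norm (\<phi> p) \<le> D"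
      proof (rule AE_I2)
        fix p assume p: "p \<in> space (time \<Otimes>\<^sub>M \<kappa>)"
        show "norm (\<phi> p) \<le> D" using B[OF sp[OF p], of "snd p"] by simp
      qed
    qed measurable
    show int': "integrable time (\<lambda>t. LINT x|\<kappa>. \<phi> (t, x))" using Q.integrable_fst'[OF i2] by simp
    show int: "integrable time (\<lambda>t. (\<alpha> + \<beta> * t) * (LINT x|\<kappa>. dt \<phi> (t, x)))" using Q.integrable_fst'[OF i1] by simp
    have "(LINT t|time. (\<alpha> + \<beta> * t) * (LINT x|\<kappa>. dt \<phi> (t, x))) + \<beta> * (LINT t|time. LINT x|\<kappa>. \<phi> (t, x))
      = (LINT p|(time \<Otimes>\<^sub>M \<kappa>). (\<alpha> + \<beta> * fst p) * dt \<phi> p) + \<beta> * (LINT p|(time \<Otimes>\<^sub>M \<kappa>). \<phi> p)"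
      using Q.integral_fst'[OF i1] Q.integral_fst'[OF i2] by simp
    also have "\<dots> = (LINT p|(time \<Otimes>\<^sub>M \<kappa>). (\<alpha> + \<beta> * fst p) * dt \<phi> p + \<beta> * \<phi> p)"
      using i1 i2 by simp
    also have "\<dots> = (LINT x|\<kappa>. LINT t|time. (\<alpha> + \<beta> * t) * dt \<phi> (t, x) + \<beta> * \<phi> (t, x))"
      using Q.integral_snd[of "\<lambda>t x. (\<alpha> + \<beta> * t) * dt \<phi> (t, x) + \<beta> * \<phi> (t, x)"] i1 i2
      by (simp add: case_prod_unfold)
    also have "\<dots> = 0" by (simp add: integration_by_parts_time[OF \<phi>])
    finally show "(LINT t|time. (\<alpha> + \<beta> * t) * (LINT x|\<kappa>. dt \<phi> (t, x))) = - \<beta> * (LINT t|time. LINT x|\<kappa>. \<phi> (t, x))"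
      by linarith
  qed
  have "(LINT t|time. LINT x|interpolation \<mu> \<nu> t. dt \<phi> (t, x))
    = (LINT t|time. (0 + 1 * t) * (LINT x|\<nu>. dt \<phi> (t, x)) + (1 + (-1) * t) * (LINT x|\<mu>. dt \<phi> (t, x)))"
  proof (rule Bochner_Integration.integral_cong[OF refl])
    fix t assume "t \<in> space time"
    then have t: "t \<in> {0<..<1}" by (simp add: space_restrict_space)
    have "continuous_on UNIV (\<lambda>x. dt \<phi> (t, x))"
      by (rule continuous_on_compose2[OF c(1)]) (use t in \<open>auto intro!: continuous_intros\<close>)
    then show "(LINT x|interpolation \<mu> \<nu> t. dt \<phi> (t, x))
      = (0 + 1 * t) * (LINT x|\<nu>. dt \<phi> (t, x)) + (1 + (-1) * t) * (LINT x|\<mu>. dt \<phi> (t, x))"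
      using integral_interpolation[OF P, of t "\<lambda>x. dt \<phi> (t, x)" D] D[OF t] t
      by (simp add: borel_measurable_continuous_onI)
  qed
  also have "\<dots> = (LINT t|time. (0 + 1 * t) * (LINT x|\<nu>. dt \<phi> (t, x))) + (LINT t|time. (1 + (-1) * t) * (LINT x|\<mu>. dt \<phi> (t, x)))"
    by (rule Bochner_Integration.integral_add[OF int[OF P(2)] int[OF P(1)]])
  also have "\<dots> = - (LINT t|time. LINT x|\<nu>. \<phi> (t, x)) + (LINT t|time. LINT x|\<mu>. \<phi> (t, x))"
    unfolding lin[OF P(2)] lin[OF P(1)] by simp
  also have "\<dots> = - (LINT t|time. (LINT x|\<nu>. \<phi> (t, x)) - (LINT x|\<mu>. \<phi> (t, x)))"
    using int'[OF P(2)] int'[OF P(1)] by simp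
  finally show ?thesis .
qed

text \<open>
  By the stationary equation the Fokker-Planck equation of the interpolation becomes, at each time, the static
  equation tested with \<open>\<phi> (t, \<cdot>)\<close>. As time has total mass \<open>1\<close>, a constant curve costs what \<open>L\<close> costs.
\<close>

theorem stationary_competitor:
  assumes P: "\<mu> \<in> P2" "\<nu> \<in> P2" and L: "static_competitor \<mu> \<nu> L"
  shows "dynamic_competitor \<mu> \<nu> (path_measure \<mu> \<nu>) (interpolation \<mu> \<nu>)
      (\<lambda>E. LINT t|time. L (Pair t -` E)) (\<lambda>t. L)"
    and "dynamic_cost f (\<lambda>t. L) = action f borel L"
proof -
  have Lm: "L \<in> matrix_measures borel" and Lv: "emeasure (total_variation borel L) UNIV < \<infinity>"
    and Ls: "\<And>\<psi>. \<psi> \<in> Cb2 \<Longrightarrow> matrix_integral borel L (\<lambda>x. (1/2) *\<^sub>R hessian \<psi> x) = (LINT x|\<nu>. \<psi> x) - (LINT x|\<mu>. \<psi> x)"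
    using L unfolding static_competitor_def by auto
  have one: "emeasure time (space time) = 1" by (rule prob_space.emeasure_space_1[OF prob_space_time])
  have fp: "(LINT t|time. LINT x|interpolation \<mu> \<nu> t. dt \<phi> (t, x))
      = - (LINT t|time. matrix_integral borel L (\<lambda>x. (1/2) *\<^sub>R hessian_x \<phi> (t, x)))"
    if \<phi>: "\<phi> \<in> Cb12" "supported_in_strip \<phi>" for \<phi>
  proof -
    have "(LINT t|time. matrix_integral borel L (\<lambda>x. (1/2) *\<^sub>R hessian_x \<phi> (t, x)))
      = (LINT t|time. (LINT x|\<nu>. \<phi> (t, x)) - (LINT x|\<mu>. \<phi> (t, x)))"
    proof (rule Bochner_Integration.integral_cong[OF refl])
      fix t assume "t \<in> space time"
      then have "t \<in> {0<..<1}" by (simp add: space_restrict_space)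
      from Ls[OF Cb12_section[OF \<phi>(1) this]]
      show "matrix_integral borel L (\<lambda>x. (1/2) *\<^sub>R hessian_x \<phi> (t, x)) = (LINT x|\<nu>. \<phi> (t, x)) - (LINT x|\<mu>. \<phi> (t, x))"
        by (simp add: hessian_x_def)
    qed
    with stationary_equation[OF P \<phi>] show ?thesis by simp
  qed
  show "dynamic_competitor \<mu> \<nu> (path_measure \<mu> \<nu>) (interpolation \<mu> \<nu>) (\<lambda>E. LINT t|time. L (Pair t -` E)) (\<lambda>t. L)"
    unfolding dynamic_competitor_def fokker_planck_def
    using path_P2[OF P] constant_disintegration[OF Lm] path_disintegration[OF P] Lv one fp
      interpolation_narrowly_continuous[OF P] interpolation_ends[OF P]
    by simp
  show "dynamic_cost f (\<lambda>t. L) = action f borel L"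
    unfolding dynamic_cost_def using one by simp
qed


section \<open>Duality and existence\<close>

theorem theorem3p6:
  fixes f :: "real^'n^'n \<Rightarrow> ennreal"
    and \<mu> \<nu> :: "(real^'n) measure"
  assumes convex: "\<forall>A\<in>sym_mats. \<forall>B\<in>sym_mats. \<forall>u\<in>{0..1}.
      f ((1 - u) *\<^sub>R A + u *\<^sub>R B) \<le> ennreal (1 - u) * f A + ennreal u * f B"
    and homogeneous: "\<forall>A\<in>sym_mats. \<forall>t\<ge>0. f (t *\<^sub>R A) = ennreal t * f A"
    and lsc: "\<forall>A\<in>sym_mats. f A \<le> Liminf (at A within sym_mats) f"
    and dom_psd: "dom_fun f \<subseteq> psd_mats"
    and dom_nonempty: "dom_fun f \<noteq> {}"
    and dom_dense: "dom_fun f \<subseteq> closure (dom_fun f \<inter> pd_mats)"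
    and mu: "\<mu> \<in> P2" and nu: "\<nu> \<in> P2"
  shows "enn2ereal (dynamic_value f \<mu> \<nu>) =
      (SUP \<psi> \<in> {\<psi> \<in> Cb2. \<forall>x. - fenchel_conj f ((1/2) *\<^sub>R hessian \<psi> x) = 0}.
         ereal ((LINT x|\<nu>. \<psi> x) - (LINT x|\<mu>. \<psi> x)))
    \<and> (dynamic_value f \<mu> \<nu> < \<infinity> \<longrightarrow>
         (\<exists>\<rho> \<rho>t L Lt. dynamic_competitor \<mu> \<nu> \<rho> \<rho>t L Lt \<and> dynamic_cost f Lt = dynamic_value f \<mu> \<nu>) \<and>
         (\<exists>L. static_competitor \<mu> \<nu> L \<and> action f borel L = static_value f \<mu> \<nu>))"
proof -
  interpret cost_function f
    using convex homogeneous lsc dom_psd by (rule cost_function.intro)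
  let ?A = "{\<psi> \<in> Cb2. \<forall>x. - fenchel_conj f ((1/2) *\<^sub>R hessian \<psi> x) = 0}"
  have A: "?A = {\<psi>. feasible f \<psi>}" unfolding admissible_iff_conj by blast
  \<comment> \<open>a negative gain becomes 0 in the nonnegative extended reals, which only strengthens the premise\<close>
  have gain_le: "ereal (gain \<mu> \<nu> \<psi>) \<le> enn2ereal c" if "ennreal (gain \<mu> \<nu> \<psi>) \<le> c" for \<psi> c
  proof -
    have "ereal (gain \<mu> \<nu> \<psi>) \<le> enn2ereal (ennreal (gain \<mu> \<nu> \<psi>))" by (simp add: ennreal.rep_eq)
    also have "\<dots> \<le> enn2ereal c" using that by (simp add: less_eq_ennreal.rep_eq)
    finally show ?thesis .
  qed
  define D where "D = (SUP \<psi>\<in>?A. ereal (gain \<mu> \<nu> \<psi>))"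
  have D0: "0 \<le> D"
  proof -
    have "(\<lambda>x. 0) \<in> ?A" unfolding A by (simp add: Cb2_zero zero_admissible)
    then have "ereal (gain \<mu> \<nu> (\<lambda>x. 0)) \<le> D" unfolding D_def by (rule SUP_upper)
    then show ?thesis by (simp add: gain_def zero_ereal_def)
  qed
  have dyn_ge: "D \<le> enn2ereal (dynamic_cost f Lt)" if "dynamic_competitor \<mu> \<nu> \<rho> \<rho>t L Lt" for \<rho> \<rho>t L Lt
    unfolding D_def using dynamic_weak_duality[OF that mu nu] unfolding A
    by (intro SUP_least gain_le) simp
  have stat_ge: "D \<le> enn2ereal (action f borel L)" if "static_competitor \<mu> \<nu> L" for L
    unfolding D_def using static_weak_duality[OF that] unfolding A by (intro SUP_least gain_le) simp
  have val_ge: "D \<le> enn2ereal (dynamic_value f \<mu> \<nu>)"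
  proof -
    have "e2ennreal D \<le> dynamic_value f \<mu> \<nu>"
      unfolding dynamic_value_def
    proof (rule Inf_greatest, elim CollectE exE conjE)
      fix z \<rho> \<rho>t L Lt assume z: "z = dynamic_cost f Lt" "dynamic_competitor \<mu> \<nu> \<rho> \<rho>t L Lt"
      then have "e2ennreal D \<le> e2ennreal (enn2ereal z)" using dyn_ge by (intro e2ennreal_mono) simp
      then show "e2ennreal D \<le> z" by simp
    qed
    then have "enn2ereal (e2ennreal D) \<le> enn2ereal (dynamic_value f \<mu> \<nu>)" by (simp add: less_eq_ennreal.rep_eq)
    then show ?thesis using D0 by (simp add: enn2ereal_e2ennreal)
  qed
  have attained: "enn2ereal (dynamic_value f \<mu> \<nu>) = D
    \<and> (\<exists>\<rho> \<rho>t L Lt. dynamic_competitor \<mu> \<nu> \<rho> \<rho>t L Lt \<and> dynamic_cost f Lt = dynamic_value f \<mu> \<nu>)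
    \<and> (\<exists>L. static_competitor \<mu> \<nu> L \<and> action f borel L = static_value f \<mu> \<nu>)" if fin: "D < \<infinity>"
  proof -
    obtain S where S: "D = ereal S" "0 \<le> S" using D0 fin by (cases D) auto
    interpret dual_bound f \<mu> \<nu> S
    proof (intro dual_bound.intro dual_bound_axioms.intro cost_function_axioms mu nu)
      fix \<psi> assume "feasible f \<psi>"
      then have "\<psi> \<in> ?A" unfolding A by simp
      then have "ereal (gain \<mu> \<nu> \<psi>) \<le> D" unfolding D_def by (rule SUP_upper)
      then show "gain \<mu> \<nu> \<psi> \<le> S" unfolding S(1) by simp
    qed
    obtain L where L: "static_competitor \<mu> \<nu> L" "action f borel L \<le> ennreal S" by (rule static_solution)
    have DS: "D = enn2ereal (ennreal S)" unfolding S(1) using S(2) by (simp add: ennreal.rep_eq)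
    \<comment> \<open>L costs at most S by construction and at least S by weak duality\<close>
    have act: "action f borel L = ennreal S"
      using L(2) stat_ge[OF L(1)] unfolding DS by (simp add: less_eq_ennreal.rep_eq[symmetric] antisym)
    note dyn = stationary_competitor[OF mu nu L(1)]
    have "dynamic_value f \<mu> \<nu> \<le> dynamic_cost f (\<lambda>t. L)"
      unfolding dynamic_value_def using dyn(1) by (intro Inf_lower) blast
    then have le: "dynamic_value f \<mu> \<nu> \<le> ennreal S" unfolding dyn(2) act .
    moreover have "ennreal S \<le> dynamic_value f \<mu> \<nu>"
      using val_ge unfolding DS by (simp add: less_eq_ennreal.rep_eq)
    ultimately have val: "dynamic_value f \<mu> \<nu> = ennreal S" by (rule antisym)
    have "static_value f \<mu> \<nu> = ennreal S"
    proof (rule antisym)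
      show "static_value f \<mu> \<nu> \<le> ennreal S"
        unfolding static_value_def act[symmetric] using L(1) by (intro Inf_lower) blast
      show "ennreal S \<le> static_value f \<mu> \<nu>"
        unfolding static_value_def
        using stat_ge unfolding DS by (intro Inf_greatest) (auto simp: less_eq_ennreal.rep_eq)
    qed
    then show ?thesis
      using dyn L(1) val act DS by metis
  qed
  show ?thesis
  proof (cases "D < \<infinity>")
    case True
    then show ?thesis using attained unfolding D_def gain_def by simp
  next
    case False
    then have "D = \<infinity>" by simp
    then have "enn2ereal (dynamic_value f \<mu> \<nu>) = \<infinity>" using val_ge by simp
    moreover from this have "\<not> dynamic_value f \<mu> \<nu> < \<infinity>" by (auto simp: less_ennreal.rep_eq)
    ultimately show ?thesis using \<open>D = \<infinity>\<close> unfolding D_def gain_def by simp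
  qed
qed

end
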